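(* Let $k$ be an algebraically closed field and let $f:X\to Y$ be a morphism of schemes of finite type over $k$. If the induced morphism $f_m:X_m\to Y_m$ of $m$-jet schemes is flat for some integer $m\ge 1$, then $f$ is flat.
   Context: For a scheme $X$ of finite type over $k$ and $m\ge 0$, the $m$-jet scheme $X_m$ is the scheme of finite type over $k$ characterized by a bijection, functorial in the $k$-scheme $Z$, $\operatorname{Hom}_k(Z,X_m)\simeq \operatorname{Hom}_k(Z\times_{\operatorname{Spec} k}\operatorname{Spec} k[t]/(t^{m+1}),X)$. A $k$-morphism $f:X\to Y$ induces $f_m:X_m\to Y_m$ by composing: under these bijections, $f_m$ sends a morphism $\alpha:Z\times_{\operatorname{Spec} k}\operatorname{Spec} k[t]/(t^{m+1})\to X$ to $f\circ\alpha$. *)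

theory Defs
  imports "HOL-Algebra.Algebra" "HOL-Analysis.Abstract_Topology"
begin

no_notation var (\<open>X\<index>\<close>)

section \<open>Localization\<close>

text \<open>\<open>frac A S a s\<close> is the fraction \<open>a/s\<close> of \<open>S\<^sup>-\<^sup>1A\<close>, as an equivalence class of pairs. The operations
  of quotients (here and for stalks below) are written as unions over representatives, all of
  which contribute the same class.\<close>

definition frac :: "'a ring \<Rightarrow> 'a set \<Rightarrow> 'a \<Rightarrow> 'a \<Rightarrow> ('a \<times> 'a) set" where
  "frac A S a s = {(b, t). b \<in> carrier A \<and> t \<in> S \<and>
     (\<exists>u\<in>S. u \<otimes>\<^bsub>A\<^esub> (a \<otimes>\<^bsub>A\<^esub> t) = u \<otimes>\<^bsub>A\<^esub> (b \<otimes>\<^bsub>A\<^esub> s))}"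

definition loc :: "'a ring \<Rightarrow> 'a set \<Rightarrow> ('a \<times> 'a) set ring" where
  "loc A S = \<lparr>carrier = {frac A S a s | a s. a \<in> carrier A \<and> s \<in> S},
     monoid.mult = (\<lambda>C D. \<Union>(a, s)\<in>C. \<Union>(b, t)\<in>D. frac A S (a \<otimes>\<^bsub>A\<^esub> b) (s \<otimes>\<^bsub>A\<^esub> t)),
     monoid.one = frac A S \<one>\<^bsub>A\<^esub> \<one>\<^bsub>A\<^esub>,
     ring.zero = frac A S \<zero>\<^bsub>A\<^esub> \<one>\<^bsub>A\<^esub>,
     ring.add = (\<lambda>C D. \<Union>(a, s)\<in>C. \<Union>(b, t)\<in>D.
       frac A S ((a \<otimes>\<^bsub>A\<^esub> t) \<oplus>\<^bsub>A\<^esub> (b \<otimes>\<^bsub>A\<^esub> s)) (s \<otimes>\<^bsub>A\<^esub> t))\<rparr>"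

section \<open>Ringed spaces\<close>

text \<open>\<open>res X U V\<close> is the restriction from \<open>sec X U\<close> to \<open>sec X V\<close>. The values of \<open>sec\<close> and \<open>res\<close> are
  only meaningful on open sets \<open>V \<subseteq> U\<close>.\<close>

record ('p, 'a) ringed_space =
  tp :: "'p topology"
  sec :: "'p set \<Rightarrow> 'a ring"
  res :: "'p set \<Rightarrow> 'p set \<Rightarrow> 'a \<Rightarrow> 'a"

abbreviation points :: "('p, 'a) ringed_space \<Rightarrow> 'p set" where
  "points X \<equiv> topspace (tp X)"

definition presheaf_of_rings :: "('p, 'a) ringed_space \<Rightarrow> bool" where
  "presheaf_of_rings X \<longleftrightarrow>
     (\<forall>U. openin (tp X) U \<longrightarrow> cring (sec X U)) \<and>
     (\<forall>U V. openin (tp X) U \<longrightarrow> openin (tp X) V \<longrightarrow> V \<subseteq> U \<longrightarrow>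
        res X U V \<in> ring_hom (sec X U) (sec X V)) \<and>
     (\<forall>U s. openin (tp X) U \<longrightarrow> s \<in> carrier (sec X U) \<longrightarrow> res X U U s = s) \<and>
     (\<forall>U V W s. openin (tp X) U \<longrightarrow> openin (tp X) V \<longrightarrow> openin (tp X) W \<longrightarrow> W \<subseteq> V \<longrightarrow> V \<subseteq> U \<longrightarrow>
        s \<in> carrier (sec X U) \<longrightarrow> res X V W (res X U V s) = res X U W s)"

definition sheaf_of_rings :: "('p, 'a) ringed_space \<Rightarrow> bool" where
  "sheaf_of_rings X \<longleftrightarrow> presheaf_of_rings X \<and>
     (\<forall>\<U> s. (\<forall>U\<in>\<U>. openin (tp X) U \<and> s U \<in> carrier (sec X U)) \<longrightarrow>
        (\<forall>U\<in>\<U>. \<forall>V\<in>\<U>. res X U (U \<inter> V) (s U) = res X V (U \<inter> V) (s V)) \<longrightarrow>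
        (\<exists>!t. t \<in> carrier (sec X (\<Union>\<U>)) \<and> (\<forall>U\<in>\<U>. res X (\<Union>\<U>) U t = s U)))"

definition germ :: "('p, 'a) ringed_space \<Rightarrow> 'p \<Rightarrow> 'p set \<Rightarrow> 'a \<Rightarrow> ('p set \<times> 'a) set" where
  "germ X x U s = {(V, t). openin (tp X) V \<and> x \<in> V \<and> t \<in> carrier (sec X V) \<and>
     (\<exists>W. openin (tp X) W \<and> x \<in> W \<and> W \<subseteq> U \<inter> V \<and> res X U W s = res X V W t)}"

definition stalk :: "('p, 'a) ringed_space \<Rightarrow> 'p \<Rightarrow> ('p set \<times> 'a) set ring" where
  "stalk X x = \<lparr>carrier = {germ X x U s | U s. openin (tp X) U \<and> x \<in> U \<and> s \<in> carrier (sec X U)},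
     monoid.mult = (\<lambda>C D. \<Union>(U, s)\<in>C. \<Union>(V, t)\<in>D.
       germ X x (U \<inter> V) (res X U (U \<inter> V) s \<otimes>\<^bsub>sec X (U \<inter> V)\<^esub> res X V (U \<inter> V) t)),
     monoid.one = germ X x (points X) \<one>\<^bsub>sec X (points X)\<^esub>,
     ring.zero = germ X x (points X) \<zero>\<^bsub>sec X (points X)\<^esub>,
     ring.add = (\<lambda>C D. \<Union>(U, s)\<in>C. \<Union>(V, t)\<in>D.
       germ X x (U \<inter> V) (res X U (U \<inter> V) s \<oplus>\<^bsub>sec X (U \<inter> V)\<^esub> res X V (U \<inter> V) t))\<rparr>"

definition local_ring :: "'a ring \<Rightarrow> bool" where
  "local_ring R \<longleftrightarrow> cring R \<and> (\<exists>!M. maximalideal M R)"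

definition local_hom :: "'a ring \<Rightarrow> 'b ring \<Rightarrow> ('a \<Rightarrow> 'b) \<Rightarrow> bool" where
  "local_hom R S \<phi> \<longleftrightarrow> \<phi> \<in> ring_hom R S \<and>
     (\<forall>M N. maximalideal M R \<longrightarrow> maximalideal N S \<longrightarrow> \<phi> ` M \<subseteq> N)"

definition locally_ringed_space :: "('p, 'a) ringed_space \<Rightarrow> bool" where
  "locally_ringed_space X \<longleftrightarrow> sheaf_of_rings X \<and> (\<forall>x\<in>points X. local_ring (stalk X x))"

definition open_subspace :: "('p, 'a) ringed_space \<Rightarrow> 'p set \<Rightarrow> ('p, 'a) ringed_space" where
  "open_subspace X U = \<lparr>tp = subtopology (tp X) U, sec = sec X, res = res X\<rparr>"

section \<open>Morphisms of locally ringed spaces\<close>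

text \<open>A morphism \<open>f\<close> from \<open>X\<close> to \<open>Y\<close> consists of a map of points and, for each open \<open>V\<close> of \<open>Y\<close>, a ring
  homomorphism \<open>smap f V\<close> from \<open>sec Y V\<close> to \<open>sec X (f\<^sup>-\<^sup>1V)\<close>. All these functions are extensional, so
  that HOL equality of morphisms is equality in the mathematical sense.\<close>

record ('p, 'a, 'q, 'b) mor =
  pmap :: "'p \<Rightarrow> 'q"
  smap :: "'q set \<Rightarrow> 'b \<Rightarrow> 'a"

definition pre :: "('p, 'a) ringed_space \<Rightarrow> ('p, 'a, 'q, 'b) mor \<Rightarrow> 'q set \<Rightarrow> 'p set" where
  "pre X f V = {x \<in> points X. pmap f x \<in> V}"

definition stalk_map ::
  "('p, 'a) ringed_space \<Rightarrow> ('p, 'a, 'q, 'b) mor \<Rightarrow> 'p \<Rightarrow> ('q set \<times> 'b) set \<Rightarrow> ('p set \<times> 'a) set" where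
  "stalk_map X f x C = (\<Union>(V, t)\<in>C. germ X x (pre X f V) (smap f V t))"

definition lrs_hom ::
  "('p, 'a) ringed_space \<Rightarrow> ('q, 'b) ringed_space \<Rightarrow> ('p, 'a, 'q, 'b) mor set" where
  "lrs_hom X Y = {f. continuous_map (tp X) (tp Y) (pmap f) \<and>
     pmap f \<in> extensional (points X) \<and>
     smap f \<in> extensional {V. openin (tp Y) V} \<and>
     (\<forall>V. openin (tp Y) V \<longrightarrow> smap f V \<in> extensional (carrier (sec Y V)) \<and>
        smap f V \<in> ring_hom (sec Y V) (sec X (pre X f V))) \<and>
     (\<forall>V W t. openin (tp Y) V \<longrightarrow> openin (tp Y) W \<longrightarrow> W \<subseteq> V \<longrightarrow> t \<in> carrier (sec Y V) \<longrightarrow>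
        smap f W (res Y V W t) = res X (pre X f V) (pre X f W) (smap f V t)) \<and>
     (\<forall>x\<in>points X. local_hom (stalk Y (pmap f x)) (stalk X x) (stalk_map X f x))}"

definition mor_id :: "('p, 'a) ringed_space \<Rightarrow> ('p, 'a, 'p, 'a) mor" where
  "mor_id X = \<lparr>pmap = (\<lambda>x\<in>points X. x),
     smap = (\<lambda>V\<in>{V. openin (tp X) V}. \<lambda>s\<in>carrier (sec X V). s)\<rparr>"

definition mor_comp ::
  "('p, 'a) ringed_space \<Rightarrow> ('q, 'b) ringed_space \<Rightarrow> ('r, 'c) ringed_space \<Rightarrow>
   ('q, 'b, 'r, 'c) mor \<Rightarrow> ('p, 'a, 'q, 'b) mor \<Rightarrow> ('p, 'a, 'r, 'c) mor" where
  "mor_comp X Y Z g f = \<lparr>pmap = compose (points X) (pmap g) (pmap f),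
     smap = (\<lambda>V\<in>{V. openin (tp Z) V}. compose (carrier (sec Z V)) (smap f (pre Y g V)) (smap g V))\<rparr>"

definition isomorphic :: "('p, 'a) ringed_space \<Rightarrow> ('q, 'b) ringed_space \<Rightarrow> bool" where
  "isomorphic X Y \<longleftrightarrow> (\<exists>f\<in>lrs_hom X Y. \<exists>g\<in>lrs_hom Y X.
     mor_comp X Y X g f = mor_id X \<and> mor_comp Y X Y f g = mor_id Y)"

section \<open>Affine schemes and schemes\<close>

definition zariski_open :: "'a ring \<Rightarrow> 'a set set \<Rightarrow> bool" where
  "zariski_open A U \<longleftrightarrow> (\<exists>S\<subseteq>carrier A. U = {P. primeideal P A \<and> \<not> S \<subseteq> P})"

lemma istopology_zariski:
  assumes "cring A"
  shows "istopology (zariski_open A)"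
  unfolding istopology_def
proof (intro conjI allI impI)
  interpret cring A by fact
  fix U V assume "zariski_open A U" "zariski_open A V"
  then obtain S T where S: "S \<subseteq> carrier A" "U = {P. primeideal P A \<and> \<not> S \<subseteq> P}"
    and T: "T \<subseteq> carrier A" "V = {P. primeideal P A \<and> \<not> T \<subseteq> P}"
    unfolding zariski_open_def by blast
  let ?R = "{s \<otimes>\<^bsub>A\<^esub> t | s t. s \<in> S \<and> t \<in> T}"
  have "(\<not> ?R \<subseteq> P) \<longleftrightarrow> \<not> S \<subseteq> P \<and> \<not> T \<subseteq> P" if P: "primeideal P A" for P
  proof -
    interpret P: primeideal P A by fact
    show ?thesis
    proof
      assume "\<not> ?R \<subseteq> P"
      then obtain s t where "s \<in> S" "t \<in> T" "s \<otimes>\<^bsub>A\<^esub> t \<notin> P" by blast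
      then show "\<not> S \<subseteq> P \<and> \<not> T \<subseteq> P"
        using S(1) T(1) P.I_l_closed[of t s] P.I_r_closed[of s t] by auto
    next
      assume "\<not> S \<subseteq> P \<and> \<not> T \<subseteq> P"
      then obtain s t where "s \<in> S" "s \<notin> P" "t \<in> T" "t \<notin> P" by blast
      then show "\<not> ?R \<subseteq> P" using P.I_prime[of s t] S(1) T(1) by blast
    qed
  qed
  then have "U \<inter> V = {P. primeideal P A \<and> \<not> ?R \<subseteq> P}" using S(2) T(2) by blast
  moreover have "?R \<subseteq> carrier A" using S(1) T(1) by blast
  ultimately show "zariski_open A (U \<inter> V)" unfolding zariski_open_def by blast
next
  fix \<U> assume "\<forall>U\<in>\<U>. zariski_open A U"
  then have "\<forall>U\<in>\<U>. \<exists>S. S \<subseteq> carrier A \<and> U = {P. primeideal P A \<and> \<not> S \<subseteq> P}"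
    unfolding zariski_open_def by blast
  then obtain S where S: "\<forall>U\<in>\<U>. S U \<subseteq> carrier A \<and> U = {P. primeideal P A \<and> \<not> S U \<subseteq> P}"
    by (rule bchoice[THEN exE])
  have "P \<in> \<Union>\<U> \<longleftrightarrow> primeideal P A \<and> \<not> (\<Union>U\<in>\<U>. S U) \<subseteq> P" for P
  proof -
    have "P \<in> U \<longleftrightarrow> primeideal P A \<and> \<not> S U \<subseteq> P" if "U \<in> \<U>" for U
      using S that by (metis (no_types, lifting) mem_Collect_eq)
    then show ?thesis by (auto simp add: UN_subset_iff)
  qed
  then have "\<Union>\<U> = {P. primeideal P A \<and> \<not> (\<Union>U\<in>\<U>. S U) \<subseteq> P}" by (simp add: set_eq_iff)
  moreover have "(\<Union>U\<in>\<U>. S U) \<subseteq> carrier A" using S by (simp add: UN_subset_iff)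
  ultimately show "zariski_open A (\<Union>\<U>)" unfolding zariski_open_def by blast
qed

definition Spec :: "'a ring \<Rightarrow> ('a set, 'a set \<Rightarrow> ('a \<times> 'a) set) ringed_space" where
  "Spec A = \<lparr>tp = topology (zariski_open A),
     sec = (\<lambda>U. \<lparr>carrier = {s \<in> (\<Pi>\<^sub>E P\<in>U. carrier (loc A (carrier A - P))).
         \<forall>P\<in>U. \<exists>V a b. zariski_open A V \<and> P \<in> V \<and> V \<subseteq> U \<and> a \<in> carrier A \<and> b \<in> carrier A \<and>
           (\<forall>Q\<in>V. b \<notin> Q \<and> s Q = frac A (carrier A - Q) a b)},
       monoid.mult = (\<lambda>s t. \<lambda>P\<in>U. s P \<otimes>\<^bsub>loc A (carrier A - P)\<^esub> t P),
       monoid.one = (\<lambda>P\<in>U. \<one>\<^bsub>loc A (carrier A - P)\<^esub>),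
       ring.zero = (\<lambda>P\<in>U. \<zero>\<^bsub>loc A (carrier A - P)\<^esub>),
       ring.add = (\<lambda>s t. \<lambda>P\<in>U. s P \<oplus>\<^bsub>loc A (carrier A - P)\<^esub> t P)\<rparr>),
     res = (\<lambda>U V s. restrict s V)\<rparr>"

lemma openin_Spec: "cring A \<Longrightarrow> openin (tp (Spec A)) = zariski_open A"
  by (simp add: Spec_def istopology_zariski)

lemma points_Spec: "cring A \<Longrightarrow> points (Spec A) = {P. primeideal P A}"
proof -
  assume A: "cring A"
  interpret cring A by fact
  have "zariski_open A {P. primeideal P A}"
  proof -
    have "{P. primeideal P A} = {P. primeideal P A \<and> \<not> carrier A \<subseteq> P}"
      using primeideal.I_notcarr primeideal.axioms(1) ideal.Icarr by (metis subset_antisym subsetI)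
    then show ?thesis unfolding zariski_open_def by blast
  qed
  then show ?thesis
    unfolding topspace_def openin_Spec[OF A] using zariski_open_def[of A] by blast
qed

definition Spec_map ::
  "'a ring \<Rightarrow> 'b ring \<Rightarrow> ('a \<Rightarrow> 'b) \<Rightarrow>
   ('b set, 'b set \<Rightarrow> ('b \<times> 'b) set, 'a set, 'a set \<Rightarrow> ('a \<times> 'a) set) mor" where
  "Spec_map A B \<phi> = (let c = (\<lambda>P. {a \<in> carrier A. \<phi> a \<in> P}) in
     \<lparr>pmap = (\<lambda>P\<in>points (Spec B). c P),
      smap = (\<lambda>V\<in>{V. openin (tp (Spec A)) V}. \<lambda>s\<in>carrier (sec (Spec A) V).
        \<lambda>P\<in>{P \<in> points (Spec B). c P \<in> V}.
          \<Union>(a, b)\<in>s (c P). frac B (carrier B - P) (\<phi> a) (\<phi> b))\<rparr>)"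

text \<open>The ring \<open>A\<close> may be sought on the type \<open>'a\<close> of the sections of \<open>X\<close>, because an open subspace \<open>U\<close>
  isomorphic to \<open>Spec A\<close> has \<open>sec X U\<close> isomorphic to \<open>A\<close>.\<close>

definition affine_open :: "('p, 'a) ringed_space \<Rightarrow> 'p set \<Rightarrow> bool" where
  "affine_open X U \<longleftrightarrow> openin (tp X) U \<and>
     (\<exists>A :: 'a ring. cring A \<and> isomorphic (open_subspace X U) (Spec A))"

definition scheme :: "('p, 'a) ringed_space \<Rightarrow> bool" where
  "scheme X \<longleftrightarrow> locally_ringed_space X \<and> (\<forall>x\<in>points X. \<exists>U. x \<in> U \<and> affine_open X U)"

definition finitely_generated_algebra :: "'a ring \<Rightarrow> 'b ring \<Rightarrow> ('a \<Rightarrow> 'b) \<Rightarrow> bool" where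
  "finitely_generated_algebra R S \<phi> \<longleftrightarrow> (\<exists>G. finite G \<and> G \<subseteq> carrier S \<and>
     generate_ring S (\<phi> ` carrier R \<union> G) = carrier S)"

definition finite_type ::
  "('p, 'a) ringed_space \<Rightarrow> ('q, 'b) ringed_space \<Rightarrow> ('p, 'a, 'q, 'b) mor \<Rightarrow> bool" where
  "finite_type X Y f \<longleftrightarrow> (\<exists>\<V>. (\<forall>V\<in>\<V>. affine_open Y V) \<and> \<Union>\<V> = points Y \<and>
     (\<forall>V\<in>\<V>. \<exists>\<U>. finite \<U> \<and> \<Union>\<U> = pre X f V \<and>
        (\<forall>U\<in>\<U>. affine_open X U \<and>
           finitely_generated_algebra (sec Y V) (sec X U)
             (\<lambda>t. res X (pre X f V) U (smap f V t)))))"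

text \<open>The test objects \<open>W\<close> are taken in the type of the apex \<open>P\<close>.\<close>

definition fibre_product ::
  "('q, 'b) ringed_space \<Rightarrow> ('r, 'c) ringed_space \<Rightarrow> ('s, 'd) ringed_space \<Rightarrow>
   ('q, 'b, 's, 'd) mor \<Rightarrow> ('r, 'c, 's, 'd) mor \<Rightarrow>
   ('p, 'a) ringed_space \<Rightarrow> ('p, 'a, 'q, 'b) mor \<Rightarrow> ('p, 'a, 'r, 'c) mor \<Rightarrow> bool" where
  "fibre_product X Y S f g P p q \<longleftrightarrow>
     scheme P \<and> p \<in> lrs_hom P X \<and> q \<in> lrs_hom P Y \<and>
     mor_comp P X S f p = mor_comp P Y S g q \<and>
     (\<forall>W :: ('p, 'a) ringed_space. \<forall>u v. scheme W \<longrightarrow> u \<in> lrs_hom W X \<longrightarrow> v \<in> lrs_hom W Y \<longrightarrow>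
        mor_comp W X S f u = mor_comp W Y S g v \<longrightarrow>
        (\<exists>!w. w \<in> lrs_hom W P \<and> mor_comp W P X p w = u \<and> mor_comp W P Y q w = v))"

section \<open>Flatness\<close>

definition linear_maps :: "'r ring \<Rightarrow> ('r, 'm) module \<Rightarrow> ('r, 'n) module \<Rightarrow> ('m \<Rightarrow> 'n) set" where
  "linear_maps R M N = {h \<in> carrier M \<rightarrow> carrier N.
     (\<forall>x\<in>carrier M. \<forall>y\<in>carrier M. h (x \<oplus>\<^bsub>M\<^esub> y) = h x \<oplus>\<^bsub>N\<^esub> h y) \<and>
     (\<forall>a\<in>carrier R. \<forall>x\<in>carrier M. h (a \<odot>\<^bsub>M\<^esub> x) = a \<odot>\<^bsub>N\<^esub> h x)}"

text \<open>The tensor product over \<open>R\<close> is the free abelian group on pairs modulo the bilinearity relations;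
  only its additive group matters for exactness.\<close>

definition tensor_relations ::
  "'r ring \<Rightarrow> ('r, 'm) module \<Rightarrow> ('r, 'n) module \<Rightarrow> ('m \<times> 'n \<Rightarrow>\<^sub>0 int) set" where
  "tensor_relations R M N = generate (free_Abelian_group (carrier M \<times> carrier N))
     ({frag_of (x \<oplus>\<^bsub>M\<^esub> x', y) - frag_of (x, y) - frag_of (x', y) | x x' y.
         x \<in> carrier M \<and> x' \<in> carrier M \<and> y \<in> carrier N} \<union>
      {frag_of (x, y \<oplus>\<^bsub>N\<^esub> y') - frag_of (x, y) - frag_of (x, y') | x y y'.
         x \<in> carrier M \<and> y \<in> carrier N \<and> y' \<in> carrier N} \<union>
      {frag_of (a \<odot>\<^bsub>M\<^esub> x, y) - frag_of (x, a \<odot>\<^bsub>N\<^esub> y) | a x y.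
         a \<in> carrier R \<and> x \<in> carrier M \<and> y \<in> carrier N})"

definition tensor ::
  "'r ring \<Rightarrow> ('r, 'm) module \<Rightarrow> ('r, 'n) module \<Rightarrow> ('m \<times> 'n \<Rightarrow>\<^sub>0 int) set monoid" where
  "tensor R M N = free_Abelian_group (carrier M \<times> carrier N) Mod tensor_relations R M N"

text \<open>\<open>tensor_map R M N h\<close> is the map \<open>id \<otimes> h\<close> into the tensor product of \<open>M\<close> and \<open>N\<close>.\<close>

definition tensor_map ::
  "'r ring \<Rightarrow> ('r, 'm) module \<Rightarrow> ('r, 'n) module \<Rightarrow> ('l \<Rightarrow> 'n) \<Rightarrow>
   ('m \<times> 'l \<Rightarrow>\<^sub>0 int) set \<Rightarrow> ('m \<times> 'n \<Rightarrow>\<^sub>0 int) set" where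
  "tensor_map R M N h C = (\<Union>c\<in>C. tensor_relations R M N
     #>\<^bsub>free_Abelian_group (carrier M \<times> carrier N)\<^esub> frag_extend (\<lambda>(x, y). frag_of (x, h y)) c)"

text \<open>Tensoring with \<open>M\<close> preserves exactness. A definition cannot quantify over types, so the test
  modules live on a fixed type; up to isomorphism these include all quotients of finite powers of
  \<open>R\<close>, hence all finitely generated modules, which suffice to detect flatness.\<close>

definition flat_module :: "'r ring \<Rightarrow> ('r, 'm) module \<Rightarrow> bool" where
  "flat_module R M \<longleftrightarrow> (\<forall>(N1 :: ('r, (nat \<Rightarrow> 'r) set) module) (N2 :: ('r, (nat \<Rightarrow> 'r) set) module)
       (N3 :: ('r, (nat \<Rightarrow> 'r) set) module) g h.
     module R N1 \<longrightarrow> module R N2 \<longrightarrow> module R N3 \<longrightarrow>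
     g \<in> linear_maps R N1 N2 \<longrightarrow> h \<in> linear_maps R N2 N3 \<longrightarrow>
     g ` carrier N1 = a_kernel N2 N3 h \<longrightarrow>
     tensor_map R M N2 g ` carrier (tensor R M N1) =
       kernel (tensor R M N2) (tensor R M N3) (tensor_map R M N3 h))"

definition flat_ring_hom :: "'r ring \<Rightarrow> 's ring \<Rightarrow> ('r \<Rightarrow> 's) \<Rightarrow> bool" where
  "flat_ring_hom R S \<phi> \<longleftrightarrow> flat_module R
     \<lparr>carrier = carrier S, monoid.mult = monoid.mult S, monoid.one = \<one>\<^bsub>S\<^esub>,
      ring.zero = \<zero>\<^bsub>S\<^esub>, ring.add = ring.add S, smult = (\<lambda>a x. \<phi> a \<otimes>\<^bsub>S\<^esub> x)\<rparr>"

definition flat_mor ::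
  "('p, 'a) ringed_space \<Rightarrow> ('q, 'b) ringed_space \<Rightarrow> ('p, 'a, 'q, 'b) mor \<Rightarrow> bool" where
  "flat_mor X Y f \<longleftrightarrow>
     (\<forall>x\<in>points X. flat_ring_hom (stalk Y (pmap f x)) (stalk X x) (stalk_map X f x))"

section \<open>Schemes over a ring\<close>

type_synonym ('p, 'a, 'k) mor_to_Spec = "('p, 'a, 'k set, 'k set \<Rightarrow> ('k \<times> 'k) set) mor"

record ('p, 'a, 'k) over_scheme =
  tot :: "('p, 'a) ringed_space"
  str :: "('p, 'a, 'k) mor_to_Spec"

definition scheme_over :: "'k ring \<Rightarrow> ('p, 'a, 'k) over_scheme \<Rightarrow> bool" where
  "scheme_over K X \<longleftrightarrow> scheme (tot X) \<and> str X \<in> lrs_hom (tot X) (Spec K)"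

definition finite_type_over :: "'k ring \<Rightarrow> ('p, 'a, 'k) over_scheme \<Rightarrow> bool" where
  "finite_type_over K X \<longleftrightarrow> scheme_over K X \<and> finite_type (tot X) (Spec K) (str X)"

definition hom_over ::
  "'k ring \<Rightarrow> ('p, 'a, 'k) over_scheme \<Rightarrow> ('q, 'b, 'k) over_scheme \<Rightarrow> ('p, 'a, 'q, 'b) mor set" where
  "hom_over K X Y =
     {f \<in> lrs_hom (tot X) (tot Y). mor_comp (tot X) (tot Y) (Spec K) (str Y) f = str X}"

definition comp_over ::
  "('p, 'a, 'k) over_scheme \<Rightarrow> ('q, 'b, 'k) over_scheme \<Rightarrow> ('r, 'c, 'k) over_scheme \<Rightarrow>
   ('q, 'b, 'r, 'c) mor \<Rightarrow> ('p, 'a, 'q, 'b) mor \<Rightarrow> ('p, 'a, 'r, 'c) mor" where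
  "comp_over X Y Z = mor_comp (tot X) (tot Y) (tot Z)"

section \<open>Jet schemes\<close>

text \<open>\<open>K[t]/(t\<^sup>m\<^sup>+\<^sup>1)\<close> with its structure map from \<open>K\<close>.\<close>

abbreviation trunc_ideal :: "'k ring \<Rightarrow> nat \<Rightarrow> 'k list set" where
  "trunc_ideal K m \<equiv> PIdl\<^bsub>poly_ring K\<^esub> (var K [^]\<^bsub>poly_ring K\<^esub> (m + 1))"

definition trunc_ring :: "'k ring \<Rightarrow> nat \<Rightarrow> 'k list set ring" where
  "trunc_ring K m = poly_ring K Quot trunc_ideal K m"

definition trunc_const :: "'k ring \<Rightarrow> nat \<Rightarrow> 'k \<Rightarrow> 'k list set" where
  "trunc_const K m a = trunc_ideal K m +>\<^bsub>poly_ring K\<^esub> ring.poly_of_const K a"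

definition jet_disc ::
  "'k ring \<Rightarrow> nat \<Rightarrow> ('k list set set, 'k list set set \<Rightarrow> ('k list set \<times> 'k list set) set, 'k) over_scheme" where
  "jet_disc K m = \<lparr>tot = Spec (trunc_ring K m),
     str = Spec_map K (trunc_ring K m) (trunc_const K m)\<rparr>"

record ('p, 'a, 'k) cone =
  apex :: "('p, 'a, 'k) over_scheme"
  pr1 :: "('p, 'a, 'p, 'a) mor"
  pr2 :: "('p, 'a, 'k list set) mor_to_Spec"

text \<open>\<open>C\<close> is a fibre product of \<open>Z\<close> and \<open>Spec K[t]/(t\<^sup>m\<^sup>+\<^sup>1)\<close> over \<open>Spec K\<close>, regarded as a scheme over \<open>K\<close>.\<close>

definition jet_product ::
  "'k ring \<Rightarrow> nat \<Rightarrow> ('p, 'a, 'k) over_scheme \<Rightarrow> ('p, 'a, 'k) cone \<Rightarrow> bool" where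
  "jet_product K m Z C \<longleftrightarrow>
     fibre_product (tot Z) (tot (jet_disc K m)) (Spec K) (str Z) (str (jet_disc K m))
       (tot (apex C)) (pr1 C) (pr2 C) \<and>
     str (apex C) = mor_comp (tot (apex C)) (tot Z) (Spec K) (str Z) (pr1 C)"

text \<open>\<open>J\<close> with the bijections \<open>\<Phi>\<close> is the \<open>m\<close>-jet scheme of \<open>X\<close>. The types \<open>'p\<close> and \<open>'a\<close> play the role of a
  universe, in which the test schemes \<open>Z\<close> and their products with \<open>Spec K[t]/(t\<^sup>m\<^sup>+\<^sup>1)\<close> live; the second
  conjunct makes this explicit, since for an arbitrary ring \<open>K\<close> the types need not be closed under
  these products. They are closed if \<open>K\<close> is an infinite field: the product has the points of \<open>Z\<close> and
  the sections \<open>sec Z U[t]/(t\<^sup>m\<^sup>+\<^sup>1)\<close>, for which \<open>'a\<close> is large enough because it is infinite when \<open>Z\<close>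
  is not empty. Fibre products being determined only up to isomorphism, \<open>\<Phi>\<close> is given for each of
  them, and the functoriality condition also covers a change of the product.\<close>

definition jet_scheme ::
  "'k ring \<Rightarrow> nat \<Rightarrow> ('p, 'a, 'k) over_scheme \<Rightarrow> ('p, 'a, 'k) over_scheme \<Rightarrow>
   (('p, 'a, 'k) over_scheme \<Rightarrow> ('p, 'a, 'k) cone \<Rightarrow>
     ('p, 'a, 'p, 'a) mor \<Rightarrow> ('p, 'a, 'p, 'a) mor) \<Rightarrow> bool" where
  "jet_scheme K m X J \<Phi> \<longleftrightarrow> finite_type_over K J \<and>
     (\<forall>Z :: ('p, 'a, 'k) over_scheme. scheme_over K Z \<longrightarrow> (\<exists>C. jet_product K m Z C)) \<and>
     (\<forall>Z C. scheme_over K Z \<longrightarrow> jet_product K m Z C \<longrightarrow>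
        bij_betw (\<Phi> Z C) (hom_over K Z J) (hom_over K (apex C) X)) \<and>
     (\<forall>Z C Z' C' g g' h. scheme_over K Z \<longrightarrow> jet_product K m Z C \<longrightarrow>
        scheme_over K Z' \<longrightarrow> jet_product K m Z' C' \<longrightarrow>
        g \<in> hom_over K Z' Z \<longrightarrow> g' \<in> hom_over K (apex C') (apex C) \<longrightarrow>
        comp_over (apex C') (apex C) Z (pr1 C) g' = comp_over (apex C') Z' Z g (pr1 C') \<longrightarrow>
        comp_over (apex C') (apex C) (jet_disc K m) (pr2 C) g' = pr2 C' \<longrightarrow>
        h \<in> hom_over K Z J \<longrightarrow>
        \<Phi> Z' C' (comp_over Z' Z J h g) = comp_over (apex C') (apex C) X (\<Phi> Z C h) g')"

definition induced_jet_mor ::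
  "'k ring \<Rightarrow> nat \<Rightarrow>
   ('p, 'a, 'k) over_scheme \<Rightarrow> ('p, 'a, 'k) over_scheme \<Rightarrow> ('p, 'a, 'p, 'a) mor \<Rightarrow>
   ('p, 'a, 'k) over_scheme \<Rightarrow>
   (('p, 'a, 'k) over_scheme \<Rightarrow> ('p, 'a, 'k) cone \<Rightarrow>
     ('p, 'a, 'p, 'a) mor \<Rightarrow> ('p, 'a, 'p, 'a) mor) \<Rightarrow>
   ('p, 'a, 'k) over_scheme \<Rightarrow>
   (('p, 'a, 'k) over_scheme \<Rightarrow> ('p, 'a, 'k) cone \<Rightarrow>
     ('p, 'a, 'p, 'a) mor \<Rightarrow> ('p, 'a, 'p, 'a) mor) \<Rightarrow>
   ('p, 'a, 'p, 'a) mor \<Rightarrow> bool" where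
  "induced_jet_mor K m X Y f X\<^sub>m \<Phi> Y\<^sub>m \<Psi> f\<^sub>m \<longleftrightarrow> f\<^sub>m \<in> hom_over K X\<^sub>m Y\<^sub>m \<and>
     (\<forall>Z C h. scheme_over K Z \<longrightarrow> jet_product K m Z C \<longrightarrow> h \<in> hom_over K Z X\<^sub>m \<longrightarrow>
        \<Psi> Z C (comp_over Z X\<^sub>m Y\<^sub>m f\<^sub>m h) = comp_over (apex C) X Y f (\<Phi> Z C h))"

end

theory Submission
  imports Defs
begin

text \<open>
  The morphism \<open>f\<close> is a retract of \<open>f\<^sub>m\<close>, and flatness passes to retracts.

  On points with values in \<open>Z\<close>, the jets of \<open>X\<close> are the morphisms from \<open>Z \<times> Spec K[t]/(t\<^sup>m\<^sup>+\<^sup>1)\<close> to \<open>X\<close>.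
  Composing with the first projection of the product turns a morphism from \<open>Z\<close> to \<open>X\<close> into a constant
  jet, which gives \<open>s : X \<rightarrow> X\<^sub>m\<close>. Restricting to \<open>t = 0\<close> gives \<open>\<pi> : X\<^sub>m \<rightarrow> X\<close>. A constant jet has the
  expected value at \<open>t = 0\<close>, so \<open>\<pi> \<circ> s\<close> is the identity (\<open>projection_constant_jets\<close>), and both
  morphisms are natural in \<open>X\<close> (\<open>constant_jets_natural\<close>, \<open>jet_projection_natural\<close>).

  Fix a point \<open>x\<close> of \<open>X\<close>. On stalks at \<open>x\<close>, \<open>s x\<close> and their images, one obtains ring maps \<open>A \<rightarrow> B\<close>
  (from \<open>f\<close>) and \<open>A' \<rightarrow> B'\<close> (from \<open>f\<^sub>m\<close>), maps \<open>A \<rightarrow> A'\<close> and \<open>B \<rightarrow> B'\<close> from the projections, and maps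
  \<open>A' \<rightarrow> A\<close> and \<open>B' \<rightarrow> B\<close> from the constant jets that are left inverse to them; all squares commute.
  An \<open>A\<close>-module \<open>N\<close> becomes an \<open>A'\<close>-module through \<open>A' \<rightarrow> A\<close>, without change of its underlying group,
  so exact sequences stay exact. The maps between \<open>B\<close> and \<open>B'\<close> make \<open>B \<otimes>\<^sub>A N\<close> a direct summand of
  \<open>B' \<otimes> N\<close> over \<open>A'\<close>, naturally in \<open>N\<close>. A direct summand of an exact sequence is exact, so \<open>B\<close> is flat over \<open>A\<close>
  if \<open>B'\<close> is flat over \<open>A'\<close> (\<open>flat_ring_hom_retract\<close>).

  To restrict to \<open>t = 0\<close> one needs the closed point of \<open>Spec K[t]/(t\<^sup>m\<^sup>+\<^sup>1)\<close> as a morphism of locally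
  ringed spaces from an arbitrary \<open>K\<close>-scheme. It is the composite of the structure morphism to
  \<open>Spec K\<close> with the morphism of spectra induced by \<open>t \<mapsto> 0\<close>, and it is local because the latter sends
  the maximal ideal of the stalk to zero (\<open>Spec_map_field_comp_lrs_hom\<close>).
\<close>

section \<open>Tensor products and retracts of flat ring maps\<close>

text \<open>The map that \<open>u \<otimes> v\<close> is before passing to the quotient by the bilinearity relations.\<close>

definition frag_map :: "('a \<Rightarrow> 'c) \<Rightarrow> ('b \<Rightarrow> 'd) \<Rightarrow> ('a \<times> 'b \<Rightarrow>\<^sub>0 int) \<Rightarrow> ('c \<times> 'd \<Rightarrow>\<^sub>0 int)" where
  "frag_map u v = frag_extend (\<lambda>(x, y). frag_of (u x, v y))"

lemma frag_map_simps [simp]: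
  "frag_map u v 0 = 0" "frag_map u v (c + d) = frag_map u v c + frag_map u v d"
  "frag_map u v (c - d) = frag_map u v c - frag_map u v d"
  "frag_map u v (- c) = - frag_map u v c"
  "frag_map u v (frag_of (x, y)) = frag_of (u x, v y)"
  by (simp_all add: frag_map_def frag_extend_add frag_extend_diff frag_extend_minus)

lemma frag_map_closed:
  assumes "Poly_Mapping.keys c \<subseteq> A \<times> B" "u \<in> A \<rightarrow> A'" "v \<in> B \<rightarrow> B'"
  shows "Poly_Mapping.keys (frag_map u v c) \<subseteq> A' \<times> B'"
  using assms(1)
proof (induction c rule: free_Abelian_group_induct[consumes 1])
  case (2 c d)
  then show ?case using keys_diff[of "frag_map u v c" "frag_map u v d"] by auto
qed (use assms(2,3) in auto)

lemma frag_map_cong: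
  assumes "Poly_Mapping.keys c \<subseteq> A \<times> B"
    and "\<And>x. x \<in> A \<Longrightarrow> u' (u x) = w x" "\<And>y. y \<in> B \<Longrightarrow> v' (v y) = z y"
  shows "frag_map u' v' (frag_map u v c) = frag_map w z c"
  using assms(1) by (induction c rule: free_Abelian_group_induct[consumes 1]) (auto simp: assms(2,3))

lemma frag_map_commute:
  "frag_map u (\<lambda>y. y) (frag_map (\<lambda>x. x) k c) = frag_map (\<lambda>x. x) k (frag_map u (\<lambda>y. y) c)"
  using frag_map_cong[of c UNIV UNIV u "\<lambda>x. x" u "\<lambda>y. y" k k]
    frag_map_cong[of c UNIV UNIV "\<lambda>x. x" u u k "\<lambda>y. y" k] by simp

lemma subgroup_tensor_relations:
  assumes "module R M" "module R N"
  shows "subgroup (tensor_relations R M N) (free_Abelian_group (carrier M \<times> carrier N))"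
proof -
  interpret M: module R M by fact
  interpret N: module R N by fact
  have "Poly_Mapping.keys (frag_of p - frag_of q) \<subseteq> A" if "p \<in> A" "q \<in> A"
    for A and p q :: "'b \<times> 'c"
    using keys_diff[of "frag_of p" "frag_of q"] that by auto
  moreover have "Poly_Mapping.keys (frag_of p - frag_of q - frag_of r) \<subseteq> A"
    if "p \<in> A" "q \<in> A" "r \<in> A" for A and p q r :: "'b \<times> 'c"
    using keys_diff[of "frag_of p - frag_of q" "frag_of r"] keys_diff[of "frag_of p" "frag_of q"] that
    by auto
  ultimately show ?thesis
    unfolding tensor_relations_def
    by (intro group.generate_is_subgroup[OF group_free_Abelian_group]) (auto 0 3)
qed

text \<open>The base ring may change from \<open>R\<close> to \<open>R'\<close>. A balancing relation for the scalar \<open>a\<close> becomes one for a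
  scalar \<open>b\<close> of \<open>R'\<close> that does the work of \<open>a\<close> on both sides of the tensor sign.\<close>

lemma frag_map_tensor_relations:
  assumes M: "module R M" "module R N" and M': "module R' M'" "module R' N'"
    and u: "u \<in> carrier M \<rightarrow> carrier M'" and v: "v \<in> carrier N \<rightarrow> carrier N'"
    and ua: "\<And>x x'. x \<in> carrier M \<Longrightarrow> x' \<in> carrier M \<Longrightarrow> u (x \<oplus>\<^bsub>M\<^esub> x') = u x \<oplus>\<^bsub>M'\<^esub> u x'"
    and va: "\<And>y y'. y \<in> carrier N \<Longrightarrow> y' \<in> carrier N \<Longrightarrow> v (y \<oplus>\<^bsub>N\<^esub> y') = v y \<oplus>\<^bsub>N'\<^esub> v y'"
    and bal: "\<And>a x y. a \<in> carrier R \<Longrightarrow> x \<in> carrier M \<Longrightarrow> y \<in> carrier N \<Longrightarrow>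
      \<exists>b\<in>carrier R'. u (a \<odot>\<^bsub>M\<^esub> x) = b \<odot>\<^bsub>M'\<^esub> u x \<and> v (a \<odot>\<^bsub>N\<^esub> y) = b \<odot>\<^bsub>N'\<^esub> v y"
    and c: "c \<in> tensor_relations R M N"
  shows "frag_map u v c \<in> tensor_relations R' M' N'"
proof -
  let ?T = "tensor_relations R' M' N'"
  let ?F = "free_Abelian_group (carrier M \<times> carrier N)"
  interpret T: subgroup ?T "free_Abelian_group (carrier M' \<times> carrier N')"
    by (rule subgroup_tensor_relations[OF M'])
  have gen: "x \<in> ?T" if "x \<in> {frag_of (x \<oplus>\<^bsub>M'\<^esub> x', y) - frag_of (x, y) - frag_of (x', y) | x x' y.
         x \<in> carrier M' \<and> x' \<in> carrier M' \<and> y \<in> carrier N'} \<union>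
      {frag_of (x, y \<oplus>\<^bsub>N'\<^esub> y') - frag_of (x, y) - frag_of (x, y') | x y y'.
         x \<in> carrier M' \<and> y \<in> carrier N' \<and> y' \<in> carrier N'} \<union>
      {frag_of (a \<odot>\<^bsub>M'\<^esub> x, y) - frag_of (x, a \<odot>\<^bsub>N'\<^esub> y) | a x y.
         a \<in> carrier R' \<and> x \<in> carrier M' \<and> y \<in> carrier N'}" for x
    unfolding tensor_relations_def by (rule generate.incl[OF that])
  have sub: "tensor_relations R M N \<subseteq> carrier ?F"
    by (rule subgroup.subset[OF subgroup_tensor_relations[OF M]])
  have neg: "- d \<in> ?T" if "d \<in> ?T" for d
    using T.m_inv_closed[OF that] subsetD[OF T.subset that] by simp
  have base: "frag_map u v d \<in> ?T" if d: "d \<in> {frag_of (x \<oplus>\<^bsub>M\<^esub> x', y) - frag_of (x, y) - frag_of (x', y) | x x' y.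
         x \<in> carrier M \<and> x' \<in> carrier M \<and> y \<in> carrier N} \<union>
      {frag_of (x, y \<oplus>\<^bsub>N\<^esub> y') - frag_of (x, y) - frag_of (x, y') | x y y'.
         x \<in> carrier M \<and> y \<in> carrier N \<and> y' \<in> carrier N} \<union>
      {frag_of (a \<odot>\<^bsub>M\<^esub> x, y) - frag_of (x, a \<odot>\<^bsub>N\<^esub> y) | a x y.
         a \<in> carrier R \<and> x \<in> carrier M \<and> y \<in> carrier N}" (is "d \<in> ?A \<union> ?B \<union> ?C") for d
  proof -
    consider "d \<in> ?A" | "d \<in> ?B" | "d \<in> ?C" using d by blast
    then show ?thesis
    proof cases
      case 1
      then obtain x x' y where "d = frag_of (x \<oplus>\<^bsub>M\<^esub> x', y) - frag_of (x, y) - frag_of (x', y)"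
        and xy: "x \<in> carrier M" "x' \<in> carrier M" "y \<in> carrier N" by blast
      then have "frag_map u v d =
          frag_of (u x \<oplus>\<^bsub>M'\<^esub> u x', v y) - frag_of (u x, v y) - frag_of (u x', v y)"
        by (simp add: ua)
      moreover have "u x \<in> carrier M'" "u x' \<in> carrier M'" "v y \<in> carrier N'"
        using xy u v by auto
      ultimately show ?thesis by (intro gen) blast
    next
      case 2
      then obtain x y y' where "d = frag_of (x, y \<oplus>\<^bsub>N\<^esub> y') - frag_of (x, y) - frag_of (x, y')"
        and xy: "x \<in> carrier M" "y \<in> carrier N" "y' \<in> carrier N" by blast
      then have "frag_map u v d =
          frag_of (u x, v y \<oplus>\<^bsub>N'\<^esub> v y') - frag_of (u x, v y) - frag_of (u x, v y')"
        by (simp add: va)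
      moreover have "u x \<in> carrier M'" "v y \<in> carrier N'" "v y' \<in> carrier N'"
        using xy u v by auto
      ultimately show ?thesis by (intro gen) blast
    next
      case 3
      then obtain a x y where d: "d = frag_of (a \<odot>\<^bsub>M\<^esub> x, y) - frag_of (x, a \<odot>\<^bsub>N\<^esub> y)"
        and xy: "a \<in> carrier R" "x \<in> carrier M" "y \<in> carrier N" by blast
      from bal[OF xy] obtain b where b: "b \<in> carrier R'" "u (a \<odot>\<^bsub>M\<^esub> x) = b \<odot>\<^bsub>M'\<^esub> u x"
        "v (a \<odot>\<^bsub>N\<^esub> y) = b \<odot>\<^bsub>N'\<^esub> v y" by blast
      have "frag_map u v d = frag_of (b \<odot>\<^bsub>M'\<^esub> u x, v y) - frag_of (u x, b \<odot>\<^bsub>N'\<^esub> v y)"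
        using b d by simp
      moreover have "u x \<in> carrier M'" "v y \<in> carrier N'"
        using xy u v by auto
      ultimately show ?thesis using b(1) by (intro gen) blast
    qed
  qed
  from c have "c \<in> generate ?F ({frag_of (x \<oplus>\<^bsub>M\<^esub> x', y) - frag_of (x, y) - frag_of (x', y) | x x' y.
         x \<in> carrier M \<and> x' \<in> carrier M \<and> y \<in> carrier N} \<union>
      {frag_of (x, y \<oplus>\<^bsub>N\<^esub> y') - frag_of (x, y) - frag_of (x, y') | x y y'.
         x \<in> carrier M \<and> y \<in> carrier N \<and> y' \<in> carrier N} \<union>
      {frag_of (a \<odot>\<^bsub>M\<^esub> x, y) - frag_of (x, a \<odot>\<^bsub>N\<^esub> y) | a x y.
         a \<in> carrier R \<and> x \<in> carrier M \<and> y \<in> carrier N})"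
    unfolding tensor_relations_def .
  then show ?thesis
  proof induction
    case one
    then show ?case using T.one_closed by simp
  next
    case (incl d)
    then show ?case by (rule base)
  next
    case (inv d)
    then have "d \<in> carrier ?F"
      using sub generate.incl[OF inv, of ?F] unfolding tensor_relations_def by blast
    then show ?case using neg[OF base[OF inv]] by simp
  next
    case (eng d e)
    then show ?case using T.m_closed[OF eng(3,4)] by simp
  qed
qed

text \<open>Exactness in terms of representatives in the free abelian groups: in this form it can be carried
  along \<open>frag_map\<close>, without any map between the tensor products themselves.\<close>

lemma tensor_exact_iff:
  assumes M: "module R M" and N: "module R N1" "module R N2" "module R N3"
    and g: "g \<in> linear_maps R N1 N2" and h: "h \<in> linear_maps R N2 N3"
  shows "tensor_map R M N2 g ` carrier (tensor R M N1) =
      kernel (tensor R M N2) (tensor R M N3) (tensor_map R M N3 h) \<longleftrightarrow>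
    (\<forall>c. Poly_Mapping.keys c \<subseteq> carrier M \<times> carrier N2 \<longrightarrow>
      (frag_map (\<lambda>x. x) h c \<in> tensor_relations R M N3 \<longleftrightarrow>
       (\<exists>d. Poly_Mapping.keys d \<subseteq> carrier M \<times> carrier N1 \<and>
          c - frag_map (\<lambda>x. x) g d \<in> tensor_relations R M N2)))"
    (is "?L = ?K \<longleftrightarrow> (\<forall>c. ?keys2 c \<longrightarrow> (?P c \<longleftrightarrow> ?Q c))")
proof -
  let ?F = "\<lambda>N. free_Abelian_group (carrier M \<times> carrier N)"
  let ?T = "tensor_relations R M"
  have coset: "?T N #>\<^bsub>?F N\<^esub> c = ?T N #>\<^bsub>?F N\<^esub> d \<longleftrightarrow> c - d \<in> ?T N"
    if "module R N" "Poly_Mapping.keys c \<subseteq> carrier M \<times> carrier N"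
       "Poly_Mapping.keys d \<subseteq> carrier M \<times> carrier N" for N :: "('a, 'x) module" and c d
  proof -
    interpret T: subgroup "?T N" "?F N" by (rule subgroup_tensor_relations[OF M that(1)])
    have "?T N #>\<^bsub>?F N\<^esub> c = ?T N #>\<^bsub>?F N\<^esub> d \<longleftrightarrow> c \<in> ?T N #>\<^bsub>?F N\<^esub> d"
      using that group.repr_independence[OF group_free_Abelian_group _ _ T.subgroup_axioms]
        group.rcos_self[OF group_free_Abelian_group _ T.subgroup_axioms]
      by (metis carrier_free_Abelian_group_iff)
    also have "\<dots> \<longleftrightarrow> c - d \<in> ?T N"
      unfolding r_coset_def by (auto simp: algebra_simps) (metis add_diff_cancel_left' diff_add_cancel)
    finally show ?thesis .
  qed
  have map: "tensor_map R M N' k (?T N #>\<^bsub>?F N\<^esub> c) = ?T N' #>\<^bsub>?F N'\<^esub> frag_map (\<lambda>x. x) k c"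
    if NN: "module R N" "module R N'" and k: "k \<in> linear_maps R N N'"
      and c: "Poly_Mapping.keys c \<subseteq> carrier M \<times> carrier N"
    for N :: "('a, 'x) module" and N' :: "('a, 'y) module" and k c
  proof -
    interpret T: subgroup "?T N" "?F N" by (rule subgroup_tensor_relations[OF M NN(1)])
    have closed: "Poly_Mapping.keys (frag_map (\<lambda>x. x) k d) \<subseteq> carrier M \<times> carrier N'"
      if "Poly_Mapping.keys d \<subseteq> carrier M \<times> carrier N" for d
      using k by (intro frag_map_closed[OF that]) (auto simp: linear_maps_def)
    have "?T N' #>\<^bsub>?F N'\<^esub> frag_map (\<lambda>x. x) k d = ?T N' #>\<^bsub>?F N'\<^esub> frag_map (\<lambda>x. x) k c"
      if "d \<in> ?T N #>\<^bsub>?F N\<^esub> c" for d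
    proof -
      from that obtain e where e: "e \<in> ?T N" "d = e + c" unfolding r_coset_def by auto
      have "frag_map (\<lambda>x. x) k e \<in> ?T N'"
        using k by (intro frag_map_tensor_relations[OF M NN(1) M NN(2) _ _ _ _ _ e(1)])
          (auto simp: linear_maps_def)
      moreover have "Poly_Mapping.keys d \<subseteq> carrier M \<times> carrier N"
        using e c subsetD[OF T.subset e(1)] keys_add[of e c] by auto
      ultimately show ?thesis
        using e(2) by (subst coset[OF NN(2) closed closed]) (auto simp: c)
    qed
    moreover have "c \<in> ?T N #>\<^bsub>?F N\<^esub> c"
      using c group.rcos_self[OF group_free_Abelian_group _ T.subgroup_axioms] by simp
    ultimately show ?thesis
      unfolding tensor_map_def frag_map_def[symmetric] by blast
  qed
  have one: "\<one>\<^bsub>tensor R M N\<^esub> = ?T N #>\<^bsub>?F N\<^esub> 0" if "module R N" for N :: "('a, 'x) module"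
    using group.coset_mult_one[OF group_free_Abelian_group
        subgroup.subset[OF subgroup_tensor_relations[OF M that]]]
    by (simp add: tensor_def FactGroup_def)
  have carr: "carrier (tensor R M N) = (\<lambda>c. ?T N #>\<^bsub>?F N\<^esub> c) `
      {c. Poly_Mapping.keys c \<subseteq> carrier M \<times> carrier N}" for N :: "('a, 'x) module"
    by (auto simp: tensor_def FactGroup_def RCOSETS_def)
  have closed2: "Poly_Mapping.keys (frag_map (\<lambda>x. x) g d) \<subseteq> carrier M \<times> carrier N2"
    if "Poly_Mapping.keys d \<subseteq> carrier M \<times> carrier N1" for d
    using g by (intro frag_map_closed[OF that]) (auto simp: linear_maps_def)
  have closed3: "Poly_Mapping.keys (frag_map (\<lambda>x. x) h d) \<subseteq> carrier M \<times> carrier N3"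
    if "?keys2 d" for d
    using h by (intro frag_map_closed[OF that]) (auto simp: linear_maps_def)
  have L: "?T N2 #>\<^bsub>?F N2\<^esub> c \<in> ?L \<longleftrightarrow> ?Q c" if "?keys2 c" for c
  proof -
    have "?T N2 #>\<^bsub>?F N2\<^esub> c \<in> ?L \<longleftrightarrow> (\<exists>d. Poly_Mapping.keys d \<subseteq> carrier M \<times> carrier N1 \<and>
        ?T N2 #>\<^bsub>?F N2\<^esub> c = ?T N2 #>\<^bsub>?F N2\<^esub> frag_map (\<lambda>x. x) g d)"
      unfolding carr by (auto simp: map[OF N(1,2) g] image_iff)
    then show ?thesis using coset[OF N(2) that closed2] by blast
  qed
  have K: "?T N2 #>\<^bsub>?F N2\<^esub> c \<in> ?K \<longleftrightarrow> ?P c" if "?keys2 c" for c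
    using that coset[OF N(3) closed3[OF that], of 0] unfolding kernel_def carr
    by (auto simp: one[OF N(3)] map[OF N(2,3) h])
  have "?L \<subseteq> carrier (tensor R M N2)"
    unfolding carr using closed2 by (auto simp: map[OF N(1,2) g])
  moreover have "?K \<subseteq> carrier (tensor R M N2)" unfolding kernel_def by blast
  ultimately have "?L = ?K \<longleftrightarrow> (\<forall>C\<in>carrier (tensor R M N2). C \<in> ?L \<longleftrightarrow> C \<in> ?K)" by blast
  also have "\<dots> \<longleftrightarrow> (\<forall>c. ?keys2 c \<longrightarrow> (?P c \<longleftrightarrow> ?Q c))"
    unfolding carr by (auto simp: L[unfolded carr] K[unfolded carr])
  finally show ?thesis .
qed

abbreviation ring_as_module :: "'s ring \<Rightarrow> ('r \<Rightarrow> 's) \<Rightarrow> ('r, 's) module" where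
  "ring_as_module S \<phi> \<equiv> \<lparr>carrier = carrier S, monoid.mult = monoid.mult S, monoid.one = \<one>\<^bsub>S\<^esub>,
      ring.zero = \<zero>\<^bsub>S\<^esub>, ring.add = ring.add S, smult = (\<lambda>a x. \<phi> a \<otimes>\<^bsub>S\<^esub> x)\<rparr>"

lemma module_ring_as_module:
  assumes "cring R" "cring S" "\<phi> \<in> ring_hom R S"
  shows "module R (ring_as_module S \<phi>)"
proof -
  interpret R: cring R by fact
  interpret S: cring S by fact
  interpret ring_hom_cring R S \<phi> by unfold_locales (rule assms)
  show ?thesis
  proof (rule moduleI)
    show "abelian_group (ring_as_module S \<phi>)"
    proof (rule abelian_groupI, goal_cases)
      case (6 x)
      then show ?case by (auto intro!: bexI[of _ "\<ominus>\<^bsub>S\<^esub> x"] S.l_neg)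
    qed (auto simp: S.add.m_assoc S.add.m_comm S.add.m_lcomm)
  qed (auto simp: R.is_cring S.l_distr S.r_distr S.m_assoc)
qed

lemma module_restrict_scalars:
  assumes "cring R'" "\<sigma> \<in> ring_hom R' R" "module R N"
  shows "module R' (N\<lparr>smult := (\<lambda>a x. \<sigma> a \<odot>\<^bsub>N\<^esub> x)\<rparr>)"
proof -
  interpret R': cring R' by fact
  interpret N: module R N by fact
  interpret ring_hom_cring R' R \<sigma> by unfold_locales (rule assms)
  show ?thesis
  proof (rule moduleI)
    show "abelian_group (N\<lparr>smult := (\<lambda>a x. \<sigma> a \<odot>\<^bsub>N\<^esub> x)\<rparr>)"
    proof (rule abelian_groupI, goal_cases)
      case (6 x)
      then show ?case by (auto intro!: bexI[of _ "\<ominus>\<^bsub>N\<^esub> x"] N.M.l_neg)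
    qed (auto simp: N.M.add.m_assoc N.M.add.m_comm N.M.add.m_lcomm)
  qed (auto simp: R'.is_cring N.smult_l_distr N.smult_r_distr N.smult_assoc1)
qed

text \<open>The group of \<open>N\<close> restricted along \<open>s\<close> is that of \<open>N\<close>, so exactness of \<open>N1 \<rightarrow> N2 \<rightarrow> N3\<close> over \<open>A\<close> and over
  \<open>A'\<close> mean the same. The maps \<open>q \<otimes> id\<close> from \<open>B \<otimes> N\<close> to \<open>B' \<otimes> N\<close> and \<open>t \<otimes> id\<close> back respect the relations
  over \<open>A\<close> and over \<open>A'\<close>: a scalar \<open>a\<close> of \<open>A\<close> corresponds to \<open>p a\<close>, which acts on \<open>N\<close> as \<open>s (p a) = a\<close>,
  and a scalar \<open>a\<close> of \<open>A'\<close> corresponds to \<open>s a\<close>. Their composite is the identity. Hence an exactness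
  question over \<open>A\<close> is pushed to \<open>A'\<close> by \<open>q\<close>, answered there, and pulled back by \<open>t\<close>.\<close>

lemma flat_ring_hom_retract:
  fixes A A' :: "'r ring" and B :: "'s ring" and B' :: "'t ring"
  assumes cring: "cring A" "cring B" "cring A'" "cring B'"
    and \<phi>: "\<phi> \<in> ring_hom A B" and \<phi>': "\<phi>' \<in> ring_hom A' B'"
    and p: "p \<in> ring_hom A A'" and q: "q \<in> ring_hom B B'"
    and s: "s \<in> ring_hom A' A" and t: "t \<in> ring_hom B' B"
    and sp: "\<And>a. a \<in> carrier A \<Longrightarrow> s (p a) = a" and tq: "\<And>b. b \<in> carrier B \<Longrightarrow> t (q b) = b"
    and q\<phi>: "\<And>a. a \<in> carrier A \<Longrightarrow> q (\<phi> a) = \<phi>' (p a)"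
    and t\<phi>: "\<And>a. a \<in> carrier A' \<Longrightarrow> t (\<phi>' a) = \<phi> (s a)"
    and flat: "flat_ring_hom A' B' \<phi>'"
  shows "flat_ring_hom A B \<phi>"
  unfolding flat_ring_hom_def flat_module_def
proof (intro allI impI)
  fix N1 N2 N3 :: "('r, (nat \<Rightarrow> 'r) set) module" and g h
  assume N: "module A N1" "module A N2" "module A N3"
    and g: "g \<in> linear_maps A N1 N2" and h: "h \<in> linear_maps A N2 N3"
    and ex: "g ` carrier N1 = a_kernel N2 N3 h"
  let ?r = "\<lambda>N :: ('r, (nat \<Rightarrow> 'r) set) module. N\<lparr>smult := (\<lambda>a x. s a \<odot>\<^bsub>N\<^esub> x)\<rparr>"
  let ?M = "ring_as_module B \<phi>" and ?M' = "ring_as_module B' \<phi>'"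
  note M = module_ring_as_module[OF cring(1,2) \<phi>]
  note M' = module_ring_as_module[OF cring(3,4) \<phi>']
  have N': "module A' (?r N1)" "module A' (?r N2)" "module A' (?r N3)"
    using N by (auto intro: module_restrict_scalars[OF cring(3) s])
  have g': "g \<in> linear_maps A' (?r N1) (?r N2)" and h': "h \<in> linear_maps A' (?r N2) (?r N3)"
    using g h ring_hom_memE(1)[OF s] by (auto simp: linear_maps_def)
  have "g ` carrier (?r N1) = a_kernel (?r N2) (?r N3) h"
    using ex by (simp add: a_kernel_def kernel_def)
  with flat N' g' h' have ex':
    "tensor_map A' ?M' (?r N2) g ` carrier (tensor A' ?M' (?r N1)) =
     kernel (tensor A' ?M' (?r N2)) (tensor A' ?M' (?r N3)) (tensor_map A' ?M' (?r N3) h)"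
    unfolding flat_ring_hom_def flat_module_def by blast
  note exact' = ex'[unfolded tensor_exact_iff[OF M' N' g' h'], rule_format, simplified]
  let ?q = "frag_map q (\<lambda>y. y)" and ?t = "frag_map t (\<lambda>y. y)"
  have q_rel: "?q c \<in> tensor_relations A' ?M' (?r N)" if "module A N" "c \<in> tensor_relations A ?M N"
    for c and N :: "('r, (nat \<Rightarrow> 'r) set) module"
  proof (rule frag_map_tensor_relations[OF M that(1) M' module_restrict_scalars[OF cring(3) s that(1)]
        _ _ _ _ _ that(2)], goal_cases)
    case (5 a x y)
    then have "q (\<phi> a \<otimes>\<^bsub>B\<^esub> x) = \<phi>' (p a) \<otimes>\<^bsub>B'\<^esub> q x"
      using ring_hom_memE(2)[OF q, of "\<phi> a" x] ring_hom_memE(1)[OF \<phi>, of a] by (simp add: q\<phi>)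
    then show ?case using 5 ring_hom_memE(1)[OF p] by (auto simp: sp intro!: bexI[of _ "p a"])
  qed (use ring_hom_memE[OF q] in auto)
  have t_rel: "?t c \<in> tensor_relations A ?M N"
    if "module A N" "c \<in> tensor_relations A' ?M' (?r N)"
    for c and N :: "('r, (nat \<Rightarrow> 'r) set) module"
  proof (rule frag_map_tensor_relations[OF M' module_restrict_scalars[OF cring(3) s that(1)] M that(1)
        _ _ _ _ _ that(2)], goal_cases)
    case (5 a x y)
    then have "t (\<phi>' a \<otimes>\<^bsub>B'\<^esub> x) = \<phi> (s a) \<otimes>\<^bsub>B\<^esub> t x"
      using ring_hom_memE(2)[OF t, of "\<phi>' a" x] ring_hom_memE(1)[OF \<phi>', of a] by (simp add: t\<phi>)
    then show ?case using 5 ring_hom_memE(1)[OF s] by (auto intro!: bexI[of _ "s a"])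
  qed (use ring_hom_memE[OF t] in auto)
  have qc: "Poly_Mapping.keys (?q c) \<subseteq> carrier B' \<times> X"
    if "Poly_Mapping.keys c \<subseteq> carrier B \<times> X" for c and X :: "(nat \<Rightarrow> 'r) set set"
    using ring_hom_memE(1)[OF q] by (intro frag_map_closed[OF that]) auto
  have tc: "Poly_Mapping.keys (?t c) \<subseteq> carrier B \<times> X"
    if "Poly_Mapping.keys c \<subseteq> carrier B' \<times> X" for c and X :: "(nat \<Rightarrow> 'r) set set"
    using ring_hom_memE(1)[OF t] by (intro frag_map_closed[OF that]) auto
  have tq': "?t (?q c) = c" if "Poly_Mapping.keys c \<subseteq> carrier B \<times> X"
    for c and X :: "(nat \<Rightarrow> 'r) set set"
  proof -
    have "?t (?q c) = frag_map (\<lambda>x. x) (\<lambda>y. y) c" by (rule frag_map_cong[OF that]) (auto simp: tq)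
    also have "\<dots> = c" using that by (induction c rule: free_Abelian_group_induct[consumes 1]) auto
    finally show ?thesis .
  qed
  have "frag_map (\<lambda>x. x) h c \<in> tensor_relations A ?M N3 \<longleftrightarrow>
      (\<exists>d. Poly_Mapping.keys d \<subseteq> carrier B \<times> carrier N1 \<and>
          c - frag_map (\<lambda>x. x) g d \<in> tensor_relations A ?M N2)" (is "?P \<longleftrightarrow> ?Q")
    if c: "Poly_Mapping.keys c \<subseteq> carrier B \<times> carrier N2" for c
  proof
    assume ?P
    have "frag_map (\<lambda>x. x) h (?q c) \<in> tensor_relations A' ?M' (?r N3)"
      using q_rel[OF N(3) \<open>?P\<close>] by (simp add: frag_map_commute[of q] frag_map_commute[of t])
    then obtain d where d: "Poly_Mapping.keys d \<subseteq> carrier B' \<times> carrier N1"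
      "?q c - frag_map (\<lambda>x. x) g d \<in> tensor_relations A' ?M' (?r N2)"
      using exact'[OF qc[OF c]] by auto
    then have "c - frag_map (\<lambda>x. x) g (?t d) \<in> tensor_relations A ?M N2"
      using t_rel[OF N(2) d(2)] by (simp add: frag_map_commute[of t] tq'[OF c])
    then show ?Q using tc[OF d(1)] by blast
  next
    assume ?Q
    then obtain d where d: "Poly_Mapping.keys d \<subseteq> carrier B \<times> carrier N1"
      "c - frag_map (\<lambda>x. x) g d \<in> tensor_relations A ?M N2" by blast
    have "?q c - frag_map (\<lambda>x. x) g (?q d) \<in> tensor_relations A' ?M' (?r N2)"
      using q_rel[OF N(2) d(2)] by (simp add: frag_map_commute[of q] frag_map_commute[of t])
    then have "frag_map (\<lambda>x. x) h (?q c) \<in> tensor_relations A' ?M' (?r N3)"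
      using exact'[OF qc[OF c]] qc[OF d(1)] by auto
    from t_rel[OF N(3) this] show ?P by (simp add: frag_map_commute[of t] tq'[OF c])
  qed
  then show "tensor_map A ?M N2 g ` carrier (tensor A ?M N1) =
      kernel (tensor A ?M N2) (tensor A ?M N3) (tensor_map A ?M N3 h)"
    unfolding tensor_exact_iff[OF M N g h] by simp
qed

section \<open>Stalks of presheaves\<close>

lemma presheaf_cring: "presheaf_of_rings X \<Longrightarrow> openin (tp X) U \<Longrightarrow> cring (sec X U)"
  by (simp add: presheaf_of_rings_def)

lemma presheaf_res:
  assumes "presheaf_of_rings X" "openin (tp X) U" "openin (tp X) V" "V \<subseteq> U"
  shows presheaf_res_hom: "res X U V \<in> ring_hom (sec X U) (sec X V)"
    and presheaf_res_closed: "s \<in> carrier (sec X U) \<Longrightarrow> res X U V s \<in> carrier (sec X V)"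
    and presheaf_res_res: "openin (tp X) W \<Longrightarrow> W \<subseteq> V \<Longrightarrow> s \<in> carrier (sec X U) \<Longrightarrow>
      res X V W (res X U V s) = res X U W s"
proof -
  note D = assms(1)[unfolded presheaf_of_rings_def]
  show *: "res X U V \<in> ring_hom (sec X U) (sec X V)"
    by (rule conjunct1[OF conjunct2[OF D], rule_format, OF assms(2-4)])
  show "res X U V s \<in> carrier (sec X V)" if "s \<in> carrier (sec X U)"
    using ring_hom_memE(1)[OF * that] .
  show "res X V W (res X U V s) = res X U W s"
    if "openin (tp X) W" "W \<subseteq> V" "s \<in> carrier (sec X U)"
    by (rule conjunct2[OF conjunct2[OF conjunct2[OF D]], rule_format, OF assms(2,3) that(1,2) assms(4) that(3)])
qed

definition local_section :: "('p, 'a) ringed_space \<Rightarrow> 'p \<Rightarrow> 'p set \<Rightarrow> 'a \<Rightarrow> bool" where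
  "local_section X x U s \<longleftrightarrow> openin (tp X) U \<and> x \<in> U \<and> s \<in> carrier (sec X U)"

lemma local_section_res:
  assumes "presheaf_of_rings X" "local_section X x U s" "openin (tp X) V" "x \<in> V" "V \<subseteq> U"
  shows "local_section X x V (res X U V s)"
  using assms presheaf_res_closed unfolding local_section_def by fastforce

lemma germ_eqI:
  assumes X: "presheaf_of_rings X" and s: "local_section X x U s" and t: "local_section X x V t"
    and W: "openin (tp X) W" "x \<in> W" "W \<subseteq> U" "W \<subseteq> V" "res X U W s = res X V W t"
  shows "germ X x U s = germ X x V t"
proof -
  have *: "germ X x U s \<subseteq> germ X x V t"
    if s: "local_section X x U s" and t: "local_section X x V t"
      and W: "W \<subseteq> U" "W \<subseteq> V" "res X U W s = res X V W t" for U V s t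
  proof
    fix p assume "p \<in> germ X x U s"
    then obtain V' t' W' where p: "p = (V', t')" "openin (tp X) V'" "x \<in> V'" "t' \<in> carrier (sec X V')"
      and W': "openin (tp X) W'" "x \<in> W'" "W' \<subseteq> U" "W' \<subseteq> V'" "res X U W' s = res X V' W' t'"
      unfolding germ_def by blast
    have I: "openin (tp X) (W \<inter> W')" using assms(4) W'(1) by (rule openin_Int)
    have "res X V (W \<inter> W') t = res X W (W \<inter> W') (res X V W t)"
      using X t W I assms(4) by (simp add: presheaf_res_res local_section_def)
    also have "\<dots> = res X U (W \<inter> W') s"
      using X s W I assms(4) by (simp add: presheaf_res_res local_section_def flip: W(3))
    also have "\<dots> = res X W' (W \<inter> W') (res X U W' s)"
      using X s W'(1-4) I by (simp add: presheaf_res_res local_section_def)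
    also have "\<dots> = res X V' (W \<inter> W') t'"
      using X p W' I by (simp add: presheaf_res_res)
    finally show "p \<in> germ X x V t"
      using p W W' I assms(5) unfolding germ_def by auto
  qed
  show ?thesis
    using *[OF s t] *[OF t s] W by auto
qed

lemma germ_memD:
  assumes X: "presheaf_of_rings X" and s: "local_section X x U s" and m: "(V, t) \<in> germ X x U s"
  shows "local_section X x V t" "germ X x V t = germ X x U s"
proof -
  from m show t: "local_section X x V t" unfolding germ_def local_section_def by blast
  from m obtain W where "openin (tp X) W" "x \<in> W" "W \<subseteq> U" "W \<subseteq> V" "res X U W s = res X V W t"
    unfolding germ_def by blast
  then show "germ X x V t = germ X x U s" using germ_eqI[OF X s t] by simp
qed

lemma germ_self:
  assumes "local_section X x U s"
  shows "(U, s) \<in> germ X x U s"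
  using assms unfolding germ_def local_section_def by blast

lemma germ_res:
  assumes X: "presheaf_of_rings X" and s: "local_section X x U s"
    and V: "openin (tp X) V" "x \<in> V" "V \<subseteq> U"
  shows "germ X x V (res X U V s) = germ X x U s"
proof (rule germ_eqI[OF X local_section_res[OF X s V] s V(1,2)])
  show "res X V V (res X U V s) = res X U V s"
    using X s V by (simp add: local_section_def presheaf_res_res)
qed (use V in auto)

lemma germ_in_stalk: "local_section X x U s \<Longrightarrow> germ X x U s \<in> carrier (stalk X x)"
  unfolding local_section_def stalk_def by auto

lemma stalkE:
  assumes "C \<in> carrier (stalk X x)"
  obtains U s where "local_section X x U s" "C = germ X x U s"
  using assms unfolding local_section_def stalk_def by auto

text \<open>Multiplication and addition of the stalk at once. The common neighbourhood on which two pairs of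
  representatives agree is the intersection of those for the two factors.\<close>

lemma stalk_op:
  assumes X: "presheaf_of_rings X"
    and op_closed: "\<And>W a b. openin (tp X) W \<Longrightarrow> a \<in> carrier (sec X W) \<Longrightarrow> b \<in> carrier (sec X W) \<Longrightarrow>
      f W a b \<in> carrier (sec X W)"
    and op_res: "\<And>U W a b. openin (tp X) U \<Longrightarrow> openin (tp X) W \<Longrightarrow> W \<subseteq> U \<Longrightarrow> a \<in> carrier (sec X U) \<Longrightarrow>
      b \<in> carrier (sec X U) \<Longrightarrow> res X U W (f U a b) = f W (res X U W a) (res X U W b)"
    and s: "local_section X x U s" and t: "local_section X x U t"
  shows "(\<Union>(A, a)\<in>germ X x U s. \<Union>(B, b)\<in>germ X x U t.
    germ X x (A \<inter> B) (f (A \<inter> B) (res X A (A \<inter> B) a) (res X B (A \<inter> B) b))) = germ X x U (f U s t)"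
proof -
  have *: "germ X x (A \<inter> B) (f (A \<inter> B) (res X A (A \<inter> B) a) (res X B (A \<inter> B) b)) = germ X x U (f U s t)"
    if a: "(A, a) \<in> germ X x U s" and b: "(B, b) \<in> germ X x U t" for A B a b
  proof -
    note a' = germ_memD(1)[OF X s a] and b' = germ_memD(1)[OF X t b]
    from a obtain V where V: "openin (tp X) V" "x \<in> V" "V \<subseteq> U" "V \<subseteq> A" "res X U V s = res X A V a"
      unfolding germ_def by blast
    from b obtain W where W: "openin (tp X) W" "x \<in> W" "W \<subseteq> U" "W \<subseteq> B" "res X U W t = res X B W b"
      unfolding germ_def by blast
    have open_: "openin (tp X) (A \<inter> B)" "openin (tp X) (V \<inter> W)"
      using a' b' V W by (auto simp: local_section_def)
    have sl: "res X U (V \<inter> W) s = res X A (V \<inter> W) a"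
      using X s a' V open_ presheaf_res_res[of X U V "V \<inter> W" s] presheaf_res_res[of X A V "V \<inter> W" a]
      by (simp add: local_section_def)
    have tl: "res X U (V \<inter> W) t = res X B (V \<inter> W) b"
      using X t b' W open_ presheaf_res_res[of X U W "V \<inter> W" t] presheaf_res_res[of X B W "V \<inter> W" b]
      by (simp add: local_section_def)
    have ra: "res X A (A \<inter> B) a \<in> carrier (sec X (A \<inter> B))" "res X B (A \<inter> B) b \<in> carrier (sec X (A \<inter> B))"
      using X a' b' open_ by (auto simp: local_section_def presheaf_res_closed)
    show ?thesis
    proof (rule germ_eqI[OF X, of x _ _ _ _ "V \<inter> W"])
      show "local_section X x (A \<inter> B) (f (A \<inter> B) (res X A (A \<inter> B) a) (res X B (A \<inter> B) b))"
        using a' b' open_ ra op_closed by (auto simp: local_section_def)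
      show "local_section X x U (f U s t)" using s t op_closed by (auto simp: local_section_def)
      have sub: "V \<inter> W \<subseteq> A \<inter> B" "V \<inter> W \<subseteq> U" using V W by auto
      show "res X (A \<inter> B) (V \<inter> W) (f (A \<inter> B) (res X A (A \<inter> B) a) (res X B (A \<inter> B) b)) =
          res X U (V \<inter> W) (f U s t)"
        using X s t a' b' sub open_ ra sl tl by (simp add: op_res presheaf_res_res local_section_def)
    qed (use V W open_ in auto)
  qed
  have "(\<Union>(A, a)\<in>germ X x U s. \<Union>(B, b)\<in>germ X x U t.
      germ X x (A \<inter> B) (f (A \<inter> B) (res X A (A \<inter> B) a) (res X B (A \<inter> B) b))) =
    (\<Union>p\<in>germ X x U s. \<Union>q\<in>germ X x U t. germ X x U (f U s t))"
    by (intro SUP_cong refl) (auto simp: * split: prod.split)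
  also have "\<dots> = germ X x U (f U s t)" using germ_self[OF s] germ_self[OF t] by auto
  finally show ?thesis .
qed

lemma stalk_operations:
  assumes X: "presheaf_of_rings X" and s: "local_section X x U s"
  shows stalk_mult: "local_section X x U t \<Longrightarrow>
      germ X x U s \<otimes>\<^bsub>stalk X x\<^esub> germ X x U t = germ X x U (s \<otimes>\<^bsub>sec X U\<^esub> t)" (is "?t \<Longrightarrow> ?m")
    and stalk_add: "local_section X x U t \<Longrightarrow>
      germ X x U s \<oplus>\<^bsub>stalk X x\<^esub> germ X x U t = germ X x U (s \<oplus>\<^bsub>sec X U\<^esub> t)" (is "?t \<Longrightarrow> ?a")
    and stalk_one: "\<one>\<^bsub>stalk X x\<^esub> = germ X x U \<one>\<^bsub>sec X U\<^esub>"
    and stalk_zero: "\<zero>\<^bsub>stalk X x\<^esub> = germ X x U \<zero>\<^bsub>sec X U\<^esub>"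
proof -
  have cr: "cring (sec X W)" if "openin (tp X) W" for W using X that by (rule presheaf_cring)
  note rh = presheaf_res_hom[OF X]
  have ring: "ring (sec X W)" if "openin (tp X) W" for W using cr[OF that] by (rule cring.axioms(1))
  show ?m if t: ?t
    unfolding stalk_def monoid.simps
    by (rule stalk_op[OF X _ _ s t, where f = "\<lambda>W. (\<otimes>\<^bsub>sec X W\<^esub>)"])
      (auto intro: ring_hom_memE(2)[OF rh] monoid.m_closed[OF ring.is_monoid[OF ring]])
  show ?a if t: ?t
    unfolding stalk_def ring.simps
    by (rule stalk_op[OF X _ _ s t, where f = "\<lambda>W. (\<oplus>\<^bsub>sec X W\<^esub>)"])
      (auto intro: ring_hom_memE(3)[OF rh] ring.ring_simprules(1)[OF ring])
  have U: "openin (tp X) U" "x \<in> U" "U \<subseteq> points X" and top: "openin (tp X) (points X)"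
    using s openin_subset by (auto simp: local_section_def)
  interpret P: cring "sec X (points X)" by (rule cr[OF top])
  interpret U: cring "sec X U" by (rule cr[OF U(1)])
  interpret r: ring_hom_cring "sec X (points X)" "sec X U" "res X (points X) U"
    using rh[OF top U(1,3)] by unfold_locales
  have "local_section X x (points X) \<one>\<^bsub>sec X (points X)\<^esub>"
    "local_section X x (points X) \<zero>\<^bsub>sec X (points X)\<^esub>"
    using U top by (auto simp: local_section_def)
  then show "\<one>\<^bsub>stalk X x\<^esub> = germ X x U \<one>\<^bsub>sec X U\<^esub>" "\<zero>\<^bsub>stalk X x\<^esub> = germ X x U \<zero>\<^bsub>sec X U\<^esub>"
    using germ_res[OF X _ U, of "\<one>\<^bsub>sec X (points X)\<^esub>"] germ_res[OF X _ U, of "\<zero>\<^bsub>sec X (points X)\<^esub>"]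
    by (simp_all add: stalk_def)
qed

lemma stalk_common_rep:
  assumes X: "presheaf_of_rings X" and "C \<in> carrier (stalk X x)" "D \<in> carrier (stalk X x)"
  obtains U s t where "local_section X x U s" "local_section X x U t"
    "C = germ X x U s" "D = germ X x U t"
proof -
  from assms obtain U s V t where s: "local_section X x U s" "C = germ X x U s"
    and t: "local_section X x V t" "D = germ X x V t" by (meson stalkE)
  have W: "openin (tp X) (U \<inter> V)" "x \<in> U \<inter> V" using s t by (auto simp: local_section_def)
  show ?thesis
    using that[of "U \<inter> V"] local_section_res[OF X s(1) W] local_section_res[OF X t(1) W]
      germ_res[OF X s(1) W] germ_res[OF X t(1) W] s t by auto
qed

section \<open>The category of spaces with a presheaf of rings\<close>

text \<open>Morphisms of locally ringed spaces without the condition on stalks. The laws of composition and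
  the functoriality of stalks already hold for them, and the morphisms between spectra enter the proof
  at this level.\<close>

definition presheaf_hom ::
  "('p, 'a) ringed_space \<Rightarrow> ('q, 'b) ringed_space \<Rightarrow> ('p, 'a, 'q, 'b) mor set" where
  "presheaf_hom X Y = {f. continuous_map (tp X) (tp Y) (pmap f) \<and>
     pmap f \<in> extensional (points X) \<and>
     smap f \<in> extensional {V. openin (tp Y) V} \<and>
     (\<forall>V. openin (tp Y) V \<longrightarrow> smap f V \<in> extensional (carrier (sec Y V)) \<and>
        smap f V \<in> ring_hom (sec Y V) (sec X (pre X f V))) \<and>
     (\<forall>V W t. openin (tp Y) V \<longrightarrow> openin (tp Y) W \<longrightarrow> W \<subseteq> V \<longrightarrow> t \<in> carrier (sec Y V) \<longrightarrow>
        smap f W (res Y V W t) = res X (pre X f V) (pre X f W) (smap f V t))}"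

lemma lrs_hom_iff:
  "f \<in> lrs_hom X Y \<longleftrightarrow> f \<in> presheaf_hom X Y \<and>
     (\<forall>x\<in>points X. local_hom (stalk Y (pmap f x)) (stalk X x) (stalk_map X f x))"
  unfolding lrs_hom_def presheaf_hom_def by blast

lemma presheaf_homD:
  assumes "f \<in> presheaf_hom X Y"
  shows presheaf_hom_point: "x \<in> points X \<Longrightarrow> pmap f x \<in> points Y"
    and presheaf_hom_ext: "pmap f \<in> extensional (points X)" "smap f \<in> extensional {V. openin (tp Y) V}"
      "openin (tp Y) V \<Longrightarrow> smap f V \<in> extensional (carrier (sec Y V))"
    and presheaf_hom_pre: "openin (tp Y) V \<Longrightarrow> openin (tp X) (pre X f V)"
    and presheaf_hom_ring_hom: "openin (tp Y) V \<Longrightarrow> smap f V \<in> ring_hom (sec Y V) (sec X (pre X f V))"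
    and presheaf_hom_closed: "openin (tp Y) V \<Longrightarrow> t \<in> carrier (sec Y V) \<Longrightarrow>
      smap f V t \<in> carrier (sec X (pre X f V))"
    and presheaf_hom_res: "openin (tp Y) V \<Longrightarrow> openin (tp Y) W \<Longrightarrow> W \<subseteq> V \<Longrightarrow> t \<in> carrier (sec Y V) \<Longrightarrow>
        smap f W (res Y V W t) = res X (pre X f V) (pre X f W) (smap f V t)"
proof -
  have c: "continuous_map (tp X) (tp Y) (pmap f)" using assms by (simp add: presheaf_hom_def)
  show "x \<in> points X \<Longrightarrow> pmap f x \<in> points Y"
    using continuous_map_image_subset_topspace[OF c] by auto
  show "openin (tp Y) V \<Longrightarrow> openin (tp X) (pre X f V)"
    using openin_continuous_map_preimage[OF c] by (simp add: pre_def)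
  show "openin (tp Y) V \<Longrightarrow> smap f V \<in> ring_hom (sec Y V) (sec X (pre X f V))"
    using assms by (simp add: presheaf_hom_def)
  then show "openin (tp Y) V \<Longrightarrow> t \<in> carrier (sec Y V) \<Longrightarrow> smap f V t \<in> carrier (sec X (pre X f V))"
    by (rule ring_hom_memE(1))
qed (use assms in \<open>auto simp: presheaf_hom_def\<close>)

lemma pre_comp:
  assumes "f \<in> presheaf_hom X Y"
  shows "pre X (mor_comp X Y Z g f) V = pre X f (pre Y g V)"
  using presheaf_hom_point[OF assms] by (auto simp: pre_def mor_comp_def compose_def)

lemma pre_mor_id: "V \<subseteq> points X \<Longrightarrow> pre X (mor_id X) V = V"
  by (auto simp: pre_def mor_id_def)

lemma mor_comp_simps:
  "x \<in> points X \<Longrightarrow> pmap (mor_comp X Y Z g f) x = pmap g (pmap f x)"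
  "openin (tp Z) V \<Longrightarrow> t \<in> carrier (sec Z V) \<Longrightarrow>
    smap (mor_comp X Y Z g f) V t = smap f (pre Y g V) (smap g V t)"
  by (simp_all add: mor_comp_def compose_def)

lemma mor_eqI:
  fixes f g :: "('p, 'a, 'q, 'b) mor"
  assumes "pmap f \<in> extensional (points X)" "pmap g \<in> extensional (points X)"
    and "smap f \<in> extensional {V. openin (tp Y) V}" "smap g \<in> extensional {V. openin (tp Y) V}"
    and "\<And>V. openin (tp Y) V \<Longrightarrow> smap f V \<in> extensional (carrier (sec Y V))"
    and "\<And>V. openin (tp Y) V \<Longrightarrow> smap g V \<in> extensional (carrier (sec Y V))"
    and "\<And>x. x \<in> points X \<Longrightarrow> pmap f x = pmap g x"
    and "\<And>V t. openin (tp Y) V \<Longrightarrow> t \<in> carrier (sec Y V) \<Longrightarrow> smap f V t = smap g V t"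
  shows "f = g"
proof -
  have "pmap f = pmap g" using assms(1,2,7) by (rule extensionalityI)
  moreover have "smap f = smap g"
    using assms(3,4)
  proof (rule extensionalityI)
    fix V assume "V \<in> {V. openin (tp Y) V}"
    then show "smap f V = smap g V"
      using assms(5,6,8) by (intro extensionalityI[of _ "carrier (sec Y V)"]) auto
  qed
  ultimately show ?thesis by simp
qed

lemma mor_comp_ext:
  "pmap (mor_comp X Y Z g f) \<in> extensional (points X)"
  "smap (mor_comp X Y Z g f) \<in> extensional {V. openin (tp Z) V}"
  "openin (tp Z) V \<Longrightarrow> smap (mor_comp X Y Z g f) V \<in> extensional (carrier (sec Z V))"
  by (simp_all add: mor_comp_def)

lemma presheaf_hom_eqI:
  assumes "f \<in> presheaf_hom X Y" "g \<in> presheaf_hom X Y"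
    and "\<And>x. x \<in> points X \<Longrightarrow> pmap f x = pmap g x"
    and "\<And>V t. openin (tp Y) V \<Longrightarrow> t \<in> carrier (sec Y V) \<Longrightarrow> smap f V t = smap g V t"
  shows "f = g"
  by (rule mor_eqI[of f X g Y]) (use assms in \<open>auto dest: presheaf_hom_ext\<close>)

lemma ring_hom_cong:
  assumes "cring R" "f \<in> ring_hom R S" "\<And>a. a \<in> carrier R \<Longrightarrow> g a = f a"
  shows "g \<in> ring_hom R S"
proof -
  interpret cring R by fact
  show ?thesis
    using assms(2,3) by (intro ring_hom_memI) (auto dest: ring_hom_memE)
qed

lemma mor_comp_presheaf_hom:
  assumes Z: "presheaf_of_rings Z" and f: "f \<in> presheaf_hom X Y" and g: "g \<in> presheaf_hom Y Z"
  shows "mor_comp X Y Z g f \<in> presheaf_hom X Z"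
proof -
  have "continuous_map (tp X) (tp Z) (pmap g \<circ> pmap f)"
    using f g by (intro continuous_map_compose) (auto simp: presheaf_hom_def)
  then have "continuous_map (tp X) (tp Z) (pmap (mor_comp X Y Z g f))"
    by (rule continuous_map_eq) (simp add: mor_comp_def compose_def)
  moreover have "smap (mor_comp X Y Z g f) V \<in> ring_hom (sec Z V) (sec X (pre X (mor_comp X Y Z g f) V))"
    if V: "openin (tp Z) V" for V
  proof -
    have "smap f (pre Y g V) \<circ> smap g V \<in> ring_hom (sec Z V) (sec X (pre X f (pre Y g V)))"
      using presheaf_hom_ring_hom[OF f presheaf_hom_pre[OF g V]] presheaf_hom_ring_hom[OF g V]
      by (rule ring_hom_trans[rotated])
    then show ?thesis
      unfolding pre_comp[OF f] by (rule ring_hom_cong[OF presheaf_cring[OF Z V]]) (simp add: mor_comp_simps V)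
  qed
  moreover have "smap (mor_comp X Y Z g f) W (res Z V W t) =
      res X (pre X (mor_comp X Y Z g f) V) (pre X (mor_comp X Y Z g f) W) (smap (mor_comp X Y Z g f) V t)"
    if "openin (tp Z) V" "openin (tp Z) W" "W \<subseteq> V" "t \<in> carrier (sec Z V)" for V W t
  proof -
    have "pre Y g W \<subseteq> pre Y g V" using that(3) by (auto simp: pre_def)
    then show ?thesis
      using that presheaf_hom_res[OF g that] presheaf_hom_pre[OF g] presheaf_hom_closed[OF g]
        presheaf_hom_res[OF f] presheaf_res_closed[OF Z that]
      by (simp add: mor_comp_simps pre_comp[OF f])
  qed
  ultimately show ?thesis
    using mor_comp_ext[where g = g and f = f and X = X and Y = Y and Z = Z]
    unfolding presheaf_hom_def by blast
qed

lemma mor_id_presheaf_hom: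
  assumes X: "presheaf_of_rings X"
  shows "mor_id X \<in> presheaf_hom X X"
proof -
  have "continuous_map (tp X) (tp X) (pmap (mor_id X))"
    by (rule continuous_map_eq[OF continuous_map_id]) (simp add: mor_id_def)
  moreover have "smap (mor_id X) V \<in> ring_hom (sec X V) (sec X (pre X (mor_id X) V))"
    if "openin (tp X) V" for V
    unfolding pre_mor_id[OF openin_subset[OF that]]
    by (rule ring_hom_cong[OF presheaf_cring[OF X that] id_ring_hom]) (simp add: mor_id_def that)
  moreover have "smap (mor_id X) W (res X V W t) = res X (pre X (mor_id X) V) (pre X (mor_id X) W) (smap (mor_id X) V t)"
    if "openin (tp X) V" "openin (tp X) W" "W \<subseteq> V" "t \<in> carrier (sec X V)" for V W t
    using that presheaf_res_closed[OF X that(1-3)] openin_subset[OF that(1)] openin_subset[OF that(2)]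
    by (simp add: pre_mor_id) (simp add: mor_id_def)
  ultimately show ?thesis
    unfolding presheaf_hom_def by (auto simp: mor_id_def)
qed

lemma mor_comp_assoc:
  assumes "presheaf_of_rings Z" "presheaf_of_rings W"
    and f: "f \<in> presheaf_hom X Y" and g: "g \<in> presheaf_hom Y Z" and h: "h \<in> presheaf_hom Z W"
  shows "mor_comp X Z W h (mor_comp X Y Z g f) = mor_comp X Y W (mor_comp Y Z W h g) f"
  by (rule presheaf_hom_eqI[of _ X W])
    (use assms in \<open>auto simp: mor_comp_simps mor_comp_presheaf_hom presheaf_hom_point presheaf_hom_pre
      presheaf_hom_closed pre_comp\<close>)

lemma mor_comp_id:
  assumes X: "presheaf_of_rings X" and Y: "presheaf_of_rings Y" and f: "f \<in> presheaf_hom X Y"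
  shows mor_comp_id_left: "mor_comp X Y Y (mor_id Y) f = f"
    and mor_comp_id_right: "mor_comp X X Y f (mor_id X) = f"
proof -
  have sub: "V \<subseteq> points Y" if "openin (tp Y) V" for V using that by (rule openin_subset)
  show "mor_comp X Y Y (mor_id Y) f = f"
    by (rule presheaf_hom_eqI[of _ X Y])
      (use f sub in \<open>auto simp: mor_comp_simps mor_comp_presheaf_hom[OF Y f] mor_id_presheaf_hom[OF Y]
        presheaf_hom_point pre_mor_id, auto simp: mor_id_def presheaf_hom_point\<close>)
  show "mor_comp X X Y f (mor_id X) = f"
    by (rule presheaf_hom_eqI[of _ X Y])
      (use f in \<open>auto simp: mor_comp_simps mor_comp_presheaf_hom[OF Y _ f] mor_id_presheaf_hom[OF X],
         auto simp: mor_id_def presheaf_hom_pre presheaf_hom_closed\<close>)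
qed

section \<open>Maps on stalks\<close>

lemma local_section_smap:
  assumes "f \<in> presheaf_hom X Y" "x \<in> points X" "local_section Y (pmap f x) V t"
  shows "local_section X x (pre X f V) (smap f V t)"
  using assms presheaf_hom_pre presheaf_hom_closed unfolding local_section_def by (fastforce simp: pre_def)

lemma stalk_map_germ:
  assumes X: "presheaf_of_rings X" and Y: "presheaf_of_rings Y" and f: "f \<in> presheaf_hom X Y"
    and x: "x \<in> points X" and t: "local_section Y (pmap f x) V t"
  shows "stalk_map X f x (germ Y (pmap f x) V t) = germ X x (pre X f V) (smap f V t)"
proof -
  have "germ X x (pre X f U) (smap f U s) = germ X x (pre X f V) (smap f V t)"
    if m: "(U, s) \<in> germ Y (pmap f x) V t" for U s
  proof -
    note s = germ_memD(1)[OF Y t m]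
    from m obtain W where W: "openin (tp Y) W" "pmap f x \<in> W" "W \<subseteq> V" "W \<subseteq> U" "res Y V W t = res Y U W s"
      unfolding germ_def by blast
    have "res X (pre X f U) (pre X f W) (smap f U s) = res X (pre X f V) (pre X f W) (smap f V t)"
      using s t W by (simp add: local_section_def flip: presheaf_hom_res[OF f])
    then show ?thesis
      using W x presheaf_hom_pre[OF f]
      by (intro germ_eqI[OF X local_section_smap[OF f x s] local_section_smap[OF f x t], of "pre X f W"])
        (auto simp: pre_def)
  qed
  then show ?thesis
    unfolding stalk_map_def using germ_self[OF t] by blast
qed

lemma stalk_map_ring_hom:
  assumes X: "presheaf_of_rings X" and Y: "presheaf_of_rings Y" and f: "f \<in> presheaf_hom X Y"
    and x: "x \<in> points X"
  shows "stalk_map X f x \<in> ring_hom (stalk Y (pmap f x)) (stalk X x)"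
proof (rule ring_hom_memI)
  note germ = stalk_map_germ[OF X Y f x] and ls = local_section_smap[OF f x]
  fix C assume C: "C \<in> carrier (stalk Y (pmap f x))"
  then obtain V t where "local_section Y (pmap f x) V t" "C = germ Y (pmap f x) V t" by (rule stalkE)
  then show "stalk_map X f x C \<in> carrier (stalk X x)" using germ ls germ_in_stalk by metis
  fix D assume D: "D \<in> carrier (stalk Y (pmap f x))"
  from stalk_common_rep[OF Y C D] obtain V s t where st: "local_section Y (pmap f x) V s"
    "local_section Y (pmap f x) V t" and CD: "C = germ Y (pmap f x) V s" "D = germ Y (pmap f x) V t" .
  have V: "openin (tp Y) V" "pmap f x \<in> V" and c: "s \<in> carrier (sec Y V)" "t \<in> carrier (sec Y V)"
    using st by (auto simp: local_section_def)
  interpret V: cring "sec Y V" by (rule presheaf_cring[OF Y V(1)])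
  have "local_section Y (pmap f x) V (s \<otimes>\<^bsub>sec Y V\<^esub> t)" "local_section Y (pmap f x) V (s \<oplus>\<^bsub>sec Y V\<^esub> t)"
    using V c by (auto simp: local_section_def)
  then show "stalk_map X f x (C \<otimes>\<^bsub>stalk Y (pmap f x)\<^esub> D) =
      stalk_map X f x C \<otimes>\<^bsub>stalk X x\<^esub> stalk_map X f x D"
    "stalk_map X f x (C \<oplus>\<^bsub>stalk Y (pmap f x)\<^esub> D) = stalk_map X f x C \<oplus>\<^bsub>stalk X x\<^esub> stalk_map X f x D"
    using st c ring_hom_memE(2,3)[OF presheaf_hom_ring_hom[OF f V(1)] c]
    by (simp_all add: CD stalk_mult[OF Y] stalk_add[OF Y] germ ls stalk_mult[OF X] stalk_add[OF X])
next
  have top: "openin (tp Y) (points Y)" by simp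
  interpret Y: cring "sec Y (points Y)" by (rule presheaf_cring[OF Y top])
  have l: "local_section Y (pmap f x) (points Y) \<one>\<^bsub>sec Y (points Y)\<^esub>"
    using presheaf_hom_point[OF f x] by (simp add: local_section_def)
  show "stalk_map X f x \<one>\<^bsub>stalk Y (pmap f x)\<^esub> = \<one>\<^bsub>stalk X x\<^esub>"
    using stalk_map_germ[OF X Y f x l] ring_hom_memE(4)[OF presheaf_hom_ring_hom[OF f top]]
      stalk_one[OF Y l] stalk_one[OF X local_section_smap[OF f x l]] by simp
qed

lemma stalk_map_comp:
  assumes X: "presheaf_of_rings X" and Y: "presheaf_of_rings Y" and Z: "presheaf_of_rings Z"
    and f: "f \<in> presheaf_hom X Y" and g: "g \<in> presheaf_hom Y Z"
    and x: "x \<in> points X" and C: "C \<in> carrier (stalk Z (pmap g (pmap f x)))"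
  shows "stalk_map X (mor_comp X Y Z g f) x C = stalk_map X f x (stalk_map Y g (pmap f x) C)"
proof -
  from C obtain V t where t: "local_section Z (pmap g (pmap f x)) V t" "C = germ Z (pmap g (pmap f x)) V t"
    by (rule stalkE)
  have V: "openin (tp Z) V" "t \<in> carrier (sec Z V)" using t by (auto simp: local_section_def)
  note fx = presheaf_hom_point[OF f x]
  note gf = mor_comp_presheaf_hom[OF Z f g]
  show ?thesis
    using stalk_map_germ[OF X Z gf x, of V t] stalk_map_germ[OF Y Z g fx, of V t] t
      stalk_map_germ[OF X Y f x local_section_smap[OF g fx t(1)]]
    by (simp add: mor_comp_simps x V pre_comp[OF f])
qed

lemma stalk_map_id:
  assumes X: "presheaf_of_rings X" and x: "x \<in> points X" and C: "C \<in> carrier (stalk X x)"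
  shows "stalk_map X (mor_id X) x C = C"
proof -
  from C obtain V t where t: "local_section X x V t" "C = germ X x V t" by (rule stalkE)
  have V: "openin (tp X) V" "t \<in> carrier (sec X V)" using t by (auto simp: local_section_def)
  show ?thesis
    using stalk_map_germ[OF X X mor_id_presheaf_hom[OF X] x, of V t] t V openin_subset[OF V(1)] x
    by (simp add: pre_mor_id) (simp add: mor_id_def)
qed

section \<open>Composition of morphisms of locally ringed spaces\<close>

text \<open>The definition of a local homomorphism speaks of maximal ideals of the source and the target, so
  that a composite is only seen to be local if the ring in the middle has a maximal ideal.\<close>

lemma mor_comp_lrs_hom:
  assumes X: "presheaf_of_rings X" and Y: "locally_ringed_space Y" and Z: "presheaf_of_rings Z"
    and f: "f \<in> lrs_hom X Y" and g: "g \<in> lrs_hom Y Z"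
  shows "mor_comp X Y Z g f \<in> lrs_hom X Z"
proof -
  have Y': "presheaf_of_rings Y"
    using Y by (simp add: locally_ringed_space_def sheaf_of_rings_def)
  have f': "f \<in> presheaf_hom X Y" and g': "g \<in> presheaf_hom Y Z" using f g by (auto simp: lrs_hom_iff)
  note gf = mor_comp_presheaf_hom[OF Z f' g']
  have "local_hom (stalk Z (pmap (mor_comp X Y Z g f) x)) (stalk X x) (stalk_map X (mor_comp X Y Z g f) x)"
    if x: "x \<in> points X" for x
    unfolding local_hom_def
  proof (intro conjI allI impI)
    show "stalk_map X (mor_comp X Y Z g f) x \<in> ring_hom (stalk Z (pmap (mor_comp X Y Z g f) x)) (stalk X x)"
      by (rule stalk_map_ring_hom[OF X Z gf x])
    note fx = presheaf_hom_point[OF f' x]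
    fix M N assume M: "maximalideal M (stalk Z (pmap (mor_comp X Y Z g f) x))" and N: "maximalideal N (stalk X x)"
    then have M': "maximalideal M (stalk Z (pmap g (pmap f x)))" by (simp add: mor_comp_simps x)
    obtain L where L: "maximalideal L (stalk Y (pmap f x))"
      using Y fx unfolding locally_ringed_space_def local_ring_def by blast
    have g'': "stalk_map Y g (pmap f x) ` M \<subseteq> L"
      using g fx M' L unfolding lrs_hom_iff local_hom_def by blast
    have f'': "stalk_map X f x ` L \<subseteq> N"
      using f x L N unfolding lrs_hom_iff local_hom_def by blast
    have "M \<subseteq> carrier (stalk Z (pmap g (pmap f x)))"
      using additive_subgroup.a_subset[OF ideal.axioms(1)[OF maximalideal.axioms(1)[OF M']]] .
    then show "stalk_map X (mor_comp X Y Z g f) x ` M \<subseteq> N"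
      using g'' f'' stalk_map_comp[OF X Y' Z f' g' x] by (auto simp: subset_iff image_subset_iff)
  qed
  with gf show ?thesis by (simp add: lrs_hom_iff)
qed

lemma mor_id_lrs_hom:
  assumes "locally_ringed_space X"
  shows "mor_id X \<in> lrs_hom X X"
proof -
  have X: "presheaf_of_rings X"
    using assms by (simp add: locally_ringed_space_def sheaf_of_rings_def)
  have "local_hom (stalk X (pmap (mor_id X) x)) (stalk X x) (stalk_map X (mor_id X) x)"
    if x: "x \<in> points X" for x
    unfolding local_hom_def
  proof (intro conjI allI impI)
    show "stalk_map X (mor_id X) x \<in> ring_hom (stalk X (pmap (mor_id X) x)) (stalk X x)"
      by (rule stalk_map_ring_hom[OF X X mor_id_presheaf_hom[OF X] x])
    fix M N assume M: "maximalideal M (stalk X (pmap (mor_id X) x))" and N: "maximalideal N (stalk X x)"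
    have M': "maximalideal M (stalk X x)" using M x by (simp add: mor_id_def)
    then have "M = N" using assms N x unfolding locally_ringed_space_def local_ring_def by blast
    moreover have "M \<subseteq> carrier (stalk X x)"
      using additive_subgroup.a_subset[OF ideal.axioms(1)[OF maximalideal.axioms(1)[OF M']]] .
    ultimately show "stalk_map X (mor_id X) x ` M \<subseteq> N"
      using stalk_map_id[OF X x] by (auto simp: subset_iff)
  qed
  then show ?thesis using mor_id_presheaf_hom[OF X] by (simp add: lrs_hom_iff)
qed

section \<open>Rings of fractions\<close>

locale localization = cring A + S: submonoid S A for A :: "'a ring" (structure) and S

lemma (in localization) S_carrier [simp]: "s \<in> S \<Longrightarrow> s \<in> carrier A"
  using S.subset by blast

text \<open>Transitivity of equality of fractions; the factor \<open>t\<close> is the denominator that has to be cancelled.\<close>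

lemma (in localization) frac_trans:
  assumes "a \<in> carrier A" "b \<in> carrier A" "c \<in> carrier A" "s \<in> S" "t \<in> S" "r \<in> S"
    and u: "u \<in> S" "u \<otimes> (a \<otimes> t) = u \<otimes> (b \<otimes> s)" and v: "v \<in> S" "v \<otimes> (b \<otimes> r) = v \<otimes> (c \<otimes> t)"
  shows "\<exists>w\<in>S. w \<otimes> (a \<otimes> r) = w \<otimes> (c \<otimes> s)"
proof -
  have c: "u \<in> carrier A" "v \<in> carrier A" "s \<in> carrier A" "t \<in> carrier A" "r \<in> carrier A"
    using assms by simp_all
  have "(u \<otimes> v \<otimes> t) \<otimes> (a \<otimes> r) = (u \<otimes> (a \<otimes> t)) \<otimes> (v \<otimes> r)" using assms(1-3) c by algebra
  also have "\<dots> = (v \<otimes> (b \<otimes> r)) \<otimes> (u \<otimes> s)" unfolding u(2) using assms(1-3) c by algebra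
  also have "\<dots> = (u \<otimes> v \<otimes> t) \<otimes> (c \<otimes> s)" unfolding v(2) using assms(1-3) c by algebra
  finally show ?thesis using u(1) v(1) assms(5) by blast
qed

lemma (in localization) frac_eq_iff:
  assumes "a \<in> carrier A" "b \<in> carrier A" "s \<in> S" "t \<in> S"
  shows "frac A S a s = frac A S b t \<longleftrightarrow> (\<exists>u\<in>S. u \<otimes> (a \<otimes> t) = u \<otimes> (b \<otimes> s))"
proof
  assume eq: "frac A S a s = frac A S b t"
  have "(b, t) \<in> frac A S b t" using assms S.one_closed by (auto simp: frac_def)
  then have "(b, t) \<in> frac A S a s" by (simp only: eq)
  then show "\<exists>u\<in>S. u \<otimes> (a \<otimes> t) = u \<otimes> (b \<otimes> s)" by (simp add: frac_def)
next
  assume "\<exists>u\<in>S. u \<otimes> (a \<otimes> t) = u \<otimes> (b \<otimes> s)"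
  then obtain u where u: "u \<in> S" "u \<otimes> (a \<otimes> t) = u \<otimes> (b \<otimes> s)" by blast
  have "frac A S a s \<subseteq> frac A S b t"
    using frac_trans[OF assms(2,1) _ assms(4,3) _ u(1) u(2)[symmetric]] by (auto simp: frac_def)
  moreover have "frac A S b t \<subseteq> frac A S a s"
    using frac_trans[OF assms(1,2) _ assms(3,4) _ u] by (auto simp: frac_def)
  ultimately show "frac A S a s = frac A S b t" by blast
qed

lemma (in localization) frac_eqI:
  assumes "a \<otimes> t = b \<otimes> s" "a \<in> carrier A" "b \<in> carrier A" "s \<in> S" "t \<in> S"
  shows "frac A S a s = frac A S b t"
  using assms by (subst frac_eq_iff) (auto intro!: bexI[OF _ S.one_closed])

lemma (in localization) frac_memD:
  assumes "(b, t) \<in> frac A S a s" "a \<in> carrier A" "s \<in> S"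
  shows "b \<in> carrier A" "t \<in> S" "\<exists>u\<in>S. u \<otimes> (a \<otimes> t) = u \<otimes> (b \<otimes> s)"
  using assms by (auto simp: frac_def)

lemma (in localization) frac_self:
  assumes "a \<in> carrier A" "s \<in> S"
  shows "(a, s) \<in> frac A S a s"
  using assms S.one_closed by (auto simp: frac_def)

lemma (in localization) frac_closed [simp]:
  assumes "a \<in> carrier A" "s \<in> S"
  shows "frac A S a s \<in> carrier (loc A S)"
  using assms by (auto simp: loc_def)

lemma (in localization) locE:
  assumes "x \<in> carrier (loc A S)"
  obtains a s where "a \<in> carrier A" "s \<in> S" "x = frac A S a s"
  using assms by (auto simp: loc_def)

lemma UN_UN_eq:
  assumes "p \<in> A" "q \<in> B" "\<And>x x' y y'. (x, x') \<in> A \<Longrightarrow> (y, y') \<in> B \<Longrightarrow> f x x' y y' = c"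
  shows "(\<Union>(x, x')\<in>A. \<Union>(y, y')\<in>B. f x x' y y') = c"
proof -
  have "(\<Union>(x, x')\<in>A. \<Union>(y, y')\<in>B. f x x' y y') = (\<Union>_\<in>A. \<Union>_\<in>B. c)"
    by (intro SUP_cong refl) (auto simp: assms(3) split: prod.split)
  then show ?thesis using assms(1,2) by auto
qed

lemma (in localization) loc_mult:
  assumes "a \<in> carrier A" "b \<in> carrier A" "s \<in> S" "t \<in> S"
  shows "frac A S a s \<otimes>\<^bsub>loc A S\<^esub> frac A S b t = frac A S (a \<otimes> b) (s \<otimes> t)"
  unfolding loc_def monoid.simps
proof (rule UN_UN_eq[OF frac_self frac_self])
  fix a' s' b' t' assume m: "(a', s') \<in> frac A S a s" "(b', t') \<in> frac A S b t"
  from frac_memD[OF m(1)] assms obtain u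
    where u: "u \<in> S" "u \<otimes> (a \<otimes> s') = u \<otimes> (a' \<otimes> s)" "a' \<in> carrier A" "s' \<in> S" by auto
  from frac_memD[OF m(2)] assms obtain v
    where v: "v \<in> S" "v \<otimes> (b \<otimes> t') = v \<otimes> (b' \<otimes> t)" "b' \<in> carrier A" "t' \<in> S" by auto
  have c: "u \<in> carrier A" "v \<in> carrier A" "s \<in> carrier A" "t \<in> carrier A" "s' \<in> carrier A" "t' \<in> carrier A"
    using assms u v by simp_all
  have "(u \<otimes> v) \<otimes> ((a' \<otimes> b') \<otimes> (s \<otimes> t)) = (u \<otimes> (a' \<otimes> s)) \<otimes> (v \<otimes> (b' \<otimes> t))"
    using assms(1,2) u(3) v(3) c by algebra
  also have "\<dots> = (u \<otimes> v) \<otimes> ((a \<otimes> b) \<otimes> (s' \<otimes> t'))"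
    unfolding u(2)[symmetric] v(2)[symmetric] using assms(1,2) u(3) v(3) c by algebra
  finally show "frac A S (a' \<otimes> b') (s' \<otimes> t') = frac A S (a \<otimes> b) (s \<otimes> t)"
    using assms u v by (subst frac_eq_iff) auto
qed (use assms in auto)

lemma (in localization) loc_add:
  assumes "a \<in> carrier A" "b \<in> carrier A" "s \<in> S" "t \<in> S"
  shows "frac A S a s \<oplus>\<^bsub>loc A S\<^esub> frac A S b t = frac A S ((a \<otimes> t) \<oplus> (b \<otimes> s)) (s \<otimes> t)"
  unfolding loc_def ring.simps
proof (rule UN_UN_eq[OF frac_self frac_self])
  fix a' s' b' t' assume m: "(a', s') \<in> frac A S a s" "(b', t') \<in> frac A S b t"
  from frac_memD[OF m(1)] assms obtain u
    where u: "u \<in> S" "u \<otimes> (a \<otimes> s') = u \<otimes> (a' \<otimes> s)" "a' \<in> carrier A" "s' \<in> S" by auto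
  from frac_memD[OF m(2)] assms obtain v
    where v: "v \<in> S" "v \<otimes> (b \<otimes> t') = v \<otimes> (b' \<otimes> t)" "b' \<in> carrier A" "t' \<in> S" by auto
  have c: "u \<in> carrier A" "v \<in> carrier A" "s \<in> carrier A" "t \<in> carrier A" "s' \<in> carrier A" "t' \<in> carrier A"
    using assms u v by simp_all
  have "(u \<otimes> v) \<otimes> (((a' \<otimes> t') \<oplus> (b' \<otimes> s')) \<otimes> (s \<otimes> t)) =
      (u \<otimes> (a' \<otimes> s)) \<otimes> (v \<otimes> (t \<otimes> t')) \<oplus> (v \<otimes> (b' \<otimes> t)) \<otimes> (u \<otimes> (s \<otimes> s'))"
    using assms(1,2) u(3) v(3) c by algebra
  also have "\<dots> = (u \<otimes> v) \<otimes> (((a \<otimes> t) \<oplus> (b \<otimes> s)) \<otimes> (s' \<otimes> t'))"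
    unfolding u(2)[symmetric] v(2)[symmetric] using assms(1,2) u(3) v(3) c by algebra
  finally show "frac A S ((a' \<otimes> t') \<oplus> (b' \<otimes> s')) (s' \<otimes> t') = frac A S ((a \<otimes> t) \<oplus> (b \<otimes> s)) (s \<otimes> t)"
    using assms u v by (subst frac_eq_iff) auto
qed (use assms in auto)

lemma loc_one_zero:
  "\<one>\<^bsub>loc A S\<^esub> = frac A S \<one>\<^bsub>A\<^esub> \<one>\<^bsub>A\<^esub>" "\<zero>\<^bsub>loc A S\<^esub> = frac A S \<zero>\<^bsub>A\<^esub> \<one>\<^bsub>A\<^esub>"
  by (simp_all add: loc_def)

lemma (in localization) cring_loc: "cring (loc A S)"
proof (rule cringI)
  show "abelian_group (loc A S)"
  proof (rule abelian_groupI)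
    fix x y z assume "x \<in> carrier (loc A S)" "y \<in> carrier (loc A S)" "z \<in> carrier (loc A S)"
    then obtain a s b t c r where x: "a \<in> carrier A" "s \<in> S" "x = frac A S a s"
      and y: "b \<in> carrier A" "t \<in> S" "y = frac A S b t" and z: "c \<in> carrier A" "r \<in> S" "z = frac A S c r"
      by (metis locE)
    note S = S_carrier[OF x(2)] S_carrier[OF y(2)] S_carrier[OF z(2)]
    have "((a \<otimes> t \<oplus> b \<otimes> s) \<otimes> r \<oplus> c \<otimes> (s \<otimes> t)) = (a \<otimes> (t \<otimes> r) \<oplus> (b \<otimes> r \<oplus> c \<otimes> t) \<otimes> s)"
      using x(1) y(1) z(1) S by algebra
    then show "x \<oplus>\<^bsub>loc A S\<^esub> y \<oplus>\<^bsub>loc A S\<^esub> z = x \<oplus>\<^bsub>loc A S\<^esub> (y \<oplus>\<^bsub>loc A S\<^esub> z)"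
      using x y z S by (simp add: loc_add m_assoc)
  next
    fix x y assume "x \<in> carrier (loc A S)" "y \<in> carrier (loc A S)"
    then obtain a s b t where x: "a \<in> carrier A" "s \<in> S" "x = frac A S a s"
      and y: "b \<in> carrier A" "t \<in> S" "y = frac A S b t"
      by (metis locE)
    note S = S_carrier[OF x(2)] S_carrier[OF y(2)]
    show "x \<oplus>\<^bsub>loc A S\<^esub> y \<in> carrier (loc A S)" using x y S by (simp add: loc_add)
    show "x \<oplus>\<^bsub>loc A S\<^esub> y = y \<oplus>\<^bsub>loc A S\<^esub> x"
      using x y S by (simp add: loc_add m_comm[of s t] a_comm)
    have "(\<ominus> a \<otimes> s \<oplus> a \<otimes> s) \<otimes> \<one> = \<zero> \<otimes> (s \<otimes> s)" using x(1) S by algebra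
    then have "frac A S (\<ominus> a) s \<oplus>\<^bsub>loc A S\<^esub> x = \<zero>\<^bsub>loc A S\<^esub>"
      using x S by (simp add: loc_add loc_one_zero) (rule frac_eqI, auto)
    then show "\<exists>y\<in>carrier (loc A S). y \<oplus>\<^bsub>loc A S\<^esub> x = \<zero>\<^bsub>loc A S\<^esub>" using x by auto
    show "\<zero>\<^bsub>loc A S\<^esub> \<oplus>\<^bsub>loc A S\<^esub> x = x" using x S by (simp add: loc_add loc_one_zero)
  qed (simp add: loc_one_zero)
  show "comm_monoid (loc A S)"
  proof (rule comm_monoidI)
    fix x y z assume "x \<in> carrier (loc A S)" "y \<in> carrier (loc A S)" "z \<in> carrier (loc A S)"
    then obtain a s b t c r where x: "a \<in> carrier A" "s \<in> S" "x = frac A S a s"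
      and y: "b \<in> carrier A" "t \<in> S" "y = frac A S b t" and z: "c \<in> carrier A" "r \<in> S" "z = frac A S c r"
      by (metis locE)
    note S = S_carrier[OF x(2)] S_carrier[OF y(2)] S_carrier[OF z(2)]
    show "x \<otimes>\<^bsub>loc A S\<^esub> y \<otimes>\<^bsub>loc A S\<^esub> z = x \<otimes>\<^bsub>loc A S\<^esub> (y \<otimes>\<^bsub>loc A S\<^esub> z)"
      using x y z S by (simp add: loc_mult m_assoc)
    show "x \<otimes>\<^bsub>loc A S\<^esub> y \<in> carrier (loc A S)" using x y S by (simp add: loc_mult)
    show "x \<otimes>\<^bsub>loc A S\<^esub> y = y \<otimes>\<^bsub>loc A S\<^esub> x"
      using x y S by (simp add: loc_mult m_comm)
    show "\<one>\<^bsub>loc A S\<^esub> \<otimes>\<^bsub>loc A S\<^esub> x = x" using x S by (simp add: loc_mult loc_one_zero)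
  qed (simp add: loc_one_zero)
  fix x y z assume "x \<in> carrier (loc A S)" "y \<in> carrier (loc A S)" "z \<in> carrier (loc A S)"
  then obtain a s b t c r where x: "a \<in> carrier A" "s \<in> S" "x = frac A S a s"
    and y: "b \<in> carrier A" "t \<in> S" "y = frac A S b t" and z: "c \<in> carrier A" "r \<in> S" "z = frac A S c r"
    by (metis locE)
  note S = S_carrier[OF x(2)] S_carrier[OF y(2)] S_carrier[OF z(2)]
  have "(a \<otimes> t \<oplus> b \<otimes> s) \<otimes> c \<otimes> (s \<otimes> r \<otimes> (t \<otimes> r)) =
      (a \<otimes> c \<otimes> (t \<otimes> r) \<oplus> b \<otimes> c \<otimes> (s \<otimes> r)) \<otimes> (s \<otimes> t \<otimes> r)"
    using x(1) y(1) z(1) S by algebra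
  then show "(x \<oplus>\<^bsub>loc A S\<^esub> y) \<otimes>\<^bsub>loc A S\<^esub> z = x \<otimes>\<^bsub>loc A S\<^esub> z \<oplus>\<^bsub>loc A S\<^esub> y \<otimes>\<^bsub>loc A S\<^esub> z"
    using x y z S by (simp add: loc_mult loc_add) (rule frac_eqI, auto)
qed

lemma (in localization) loc_minus:
  assumes a: "a \<in> carrier A" and s: "s \<in> S"
  shows "\<ominus>\<^bsub>loc A S\<^esub> frac A S a s = frac A S (\<ominus> a) s"
proof -
  interpret L: cring "loc A S" by (rule cring_loc)
  note c = S_carrier[OF s]
  have "frac A S (\<ominus> a \<otimes> s \<oplus> a \<otimes> s) (s \<otimes> s) = frac A S \<zero> \<one>"
  proof (rule frac_eqI)
    show "(\<ominus> a \<otimes> s \<oplus> a \<otimes> s) \<otimes> \<one> = \<zero> \<otimes> (s \<otimes> s)" using a c by algebra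
  qed (use a s c in auto)
  then have "frac A S (\<ominus> a) s \<oplus>\<^bsub>loc A S\<^esub> frac A S a s = \<zero>\<^bsub>loc A S\<^esub>"
    using a s by (simp add: loc_add loc_one_zero)
  then show ?thesis using a s by (intro L.minus_equality) auto
qed

text \<open>The ring map \<open>S\<^sup>-\<^sup>1A \<rightarrow> T\<^sup>-\<^sup>1B\<close> induced by \<open>\<phi>\<close>, as a union over representatives that all give the same
  fraction.\<close>

definition loc_map :: "'b ring \<Rightarrow> 'b set \<Rightarrow> ('a \<Rightarrow> 'b) \<Rightarrow> ('a \<times> 'a) set \<Rightarrow> ('b \<times> 'b) set" where
  "loc_map B T \<phi> x = (\<Union>(a, s)\<in>x. frac B T (\<phi> a) (\<phi> s))"

lemma loc_map_frac:
  assumes "localization A S" "localization B T" and \<phi>: "\<phi> \<in> ring_hom A B" and ST: "\<phi> ` S \<subseteq> T"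
    and a: "a \<in> carrier A" "s \<in> S"
  shows "loc_map B T \<phi> (frac A S a s) = frac B T (\<phi> a) (\<phi> s)"
proof -
  interpret A: localization A S by fact
  interpret B: localization B T by fact
  interpret ring_hom_cring A B \<phi> by unfold_locales (rule \<phi>)
  have "frac B T (\<phi> b) (\<phi> t) = frac B T (\<phi> a) (\<phi> s)" if bt: "(b, t) \<in> frac A S a s" for b t
  proof -
    from A.frac_memD[OF bt a] obtain u where u: "b \<in> carrier A" "t \<in> S" "u \<in> S"
      "u \<otimes>\<^bsub>A\<^esub> (a \<otimes>\<^bsub>A\<^esub> t) = u \<otimes>\<^bsub>A\<^esub> (b \<otimes>\<^bsub>A\<^esub> s)" by blast
    have "\<phi> (u \<otimes>\<^bsub>A\<^esub> (b \<otimes>\<^bsub>A\<^esub> s)) = \<phi> (u \<otimes>\<^bsub>A\<^esub> (a \<otimes>\<^bsub>A\<^esub> t))" by (simp only: u(4))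
    then have "\<phi> u \<otimes>\<^bsub>B\<^esub> (\<phi> b \<otimes>\<^bsub>B\<^esub> \<phi> s) = \<phi> u \<otimes>\<^bsub>B\<^esub> (\<phi> a \<otimes>\<^bsub>B\<^esub> \<phi> t)"
      using u(1-3) a by simp
    moreover have "\<phi> u \<in> T" "\<phi> s \<in> T" "\<phi> t \<in> T" using ST u a by auto
    ultimately show ?thesis using u(1-3) a by (subst B.frac_eq_iff) auto
  qed
  then have "loc_map B T \<phi> (frac A S a s) = (\<Union>_\<in>frac A S a s. frac B T (\<phi> a) (\<phi> s))"
    unfolding loc_map_def by (intro SUP_cong refl) (auto split: prod.split)
  then show ?thesis using A.frac_self[OF a] by auto
qed

lemma loc_map_ring_hom:
  assumes A: "localization A S" and B: "localization B T" and \<phi>: "\<phi> \<in> ring_hom A B" and ST: "\<phi> ` S \<subseteq> T"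
  shows "loc_map B T \<phi> \<in> ring_hom (loc A S) (loc B T)"
proof -
  interpret A: localization A S by fact
  interpret B: localization B T by fact
  interpret ring_hom_cring A B \<phi> by unfold_locales (rule \<phi>)
  note f = loc_map_frac[OF A B \<phi> ST]
  have T: "\<phi> s \<in> T" if "s \<in> S" for s using ST that by blast
  show ?thesis
  proof (rule ring_hom_memI)
    fix x assume "x \<in> carrier (loc A S)"
    then obtain a s where x: "a \<in> carrier A" "s \<in> S" "x = frac A S a s" by (rule A.locE)
    then show "loc_map B T \<phi> x \<in> carrier (loc B T)" using T by (simp add: f)
    fix y assume "y \<in> carrier (loc A S)"
    then obtain b t where y: "b \<in> carrier A" "t \<in> S" "y = frac A S b t" by (rule A.locE)
    show "loc_map B T \<phi> (x \<otimes>\<^bsub>loc A S\<^esub> y) = loc_map B T \<phi> x \<otimes>\<^bsub>loc B T\<^esub> loc_map B T \<phi> y"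
      "loc_map B T \<phi> (x \<oplus>\<^bsub>loc A S\<^esub> y) = loc_map B T \<phi> x \<oplus>\<^bsub>loc B T\<^esub> loc_map B T \<phi> y"
      using x y T by (simp_all add: f A.loc_mult A.loc_add B.loc_mult B.loc_add)
  next
    show "loc_map B T \<phi> \<one>\<^bsub>loc A S\<^esub> = \<one>\<^bsub>loc B T\<^esub>" by (simp add: loc_one_zero f)
  qed
qed

text \<open>For \<open>S = carrier A - P\<close> this rule makes the simplifier loop, since membership in \<open>S\<close> is
  rewritten to membership in \<open>carrier A\<close> and more.\<close>

declare (in localization) S_carrier [simp del]

lemma localization_at_prime:
  assumes "primeideal P A" "cring A"
  shows "localization A (carrier A - P)"
proof -
  interpret P: primeideal P A by fact
  interpret A: cring A by fact
  show ?thesis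
  proof unfold_locales
    show "\<one>\<^bsub>A\<^esub> \<in> carrier A - P" using P.I_notcarr P.one_imp_carrier by auto
  qed (use P.I_prime in auto)
qed

section \<open>The structure presheaf of a spectrum\<close>

abbreviation loc_at :: "'a ring \<Rightarrow> 'a set \<Rightarrow> ('a \<times> 'a) set ring" where
  "loc_at A P \<equiv> loc A (carrier A - P)"

abbreviation frac_at :: "'a ring \<Rightarrow> 'a set \<Rightarrow> 'a \<Rightarrow> 'a \<Rightarrow> ('a \<times> 'a) set" where
  "frac_at A P \<equiv> frac A (carrier A - P)"

lemma zariski_openD: "zariski_open A U \<Longrightarrow> P \<in> U \<Longrightarrow> primeideal P A"
  by (auto simp: zariski_open_def)

lemma zariski_open_Int: "cring A \<Longrightarrow> zariski_open A U \<Longrightarrow> zariski_open A V \<Longrightarrow> zariski_open A (U \<inter> V)"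
  using istopology_zariski[of A] by (simp add: istopology_def)

lemma zariski_open_basic: "a \<in> carrier A \<Longrightarrow> zariski_open A {P. primeideal P A \<and> a \<notin> P}"
  unfolding zariski_open_def by (intro exI[of _ "{a}"]) auto

text \<open>On \<open>V\<close> the function \<open>s\<close> is the single fraction \<open>a/b\<close>; sections are the functions of which this is
  true locally.\<close>

definition fraction_on :: "'a ring \<Rightarrow> 'a set set \<Rightarrow> ('a set \<Rightarrow> ('a \<times> 'a) set) \<Rightarrow> 'a \<Rightarrow> 'a \<Rightarrow> bool" where
  "fraction_on A V s a b \<longleftrightarrow> zariski_open A V \<and> a \<in> carrier A \<and> b \<in> carrier A \<and>
     (\<forall>Q\<in>V. b \<notin> Q \<and> s Q = frac_at A Q a b)"

lemma fraction_onD: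
  assumes "fraction_on A V s a b"
  shows "zariski_open A V" "a \<in> carrier A" "b \<in> carrier A" "Q \<in> V \<Longrightarrow> b \<notin> Q"
    "Q \<in> V \<Longrightarrow> b \<in> carrier A - Q" "Q \<in> V \<Longrightarrow> s Q = frac_at A Q a b"
  using assms by (auto simp: fraction_on_def)

lemma fraction_on_subset:
  "fraction_on A V s a b \<Longrightarrow> zariski_open A W \<Longrightarrow> W \<subseteq> V \<Longrightarrow> fraction_on A W s a b"
  by (auto simp: fraction_on_def)

lemma fraction_on_cong:
  "fraction_on A V s a b \<Longrightarrow> (\<And>Q. Q \<in> V \<Longrightarrow> s' Q = s Q) \<Longrightarrow> fraction_on A V s' a b"
  by (auto simp: fraction_on_def)

lemma sec_Spec_iff:
  assumes "cring A" "zariski_open A U"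
  shows "s \<in> carrier (sec (Spec A) U) \<longleftrightarrow> s \<in> extensional U \<and>
    (\<forall>P\<in>U. \<exists>V a b. P \<in> V \<and> V \<subseteq> U \<and> fraction_on A V s a b)"
proof -
  have "s P \<in> carrier (loc_at A P)" if "P \<in> V" "fraction_on A V s a b" for P V a b
  proof -
    interpret localization A "carrier A - P"
      by (rule localization_at_prime[OF zariski_openD[OF fraction_onD(1)[OF that(2)] that(1)] assms(1)])
    show ?thesis using fraction_onD(2,5,6)[OF that(2)] that(1) by simp
  qed
  moreover have "s \<in> carrier (sec (Spec A) U) \<longleftrightarrow> (\<forall>P\<in>U. s P \<in> carrier (loc_at A P)) \<and> s \<in> extensional U \<and>
    (\<forall>P\<in>U. \<exists>V a b. P \<in> V \<and> V \<subseteq> U \<and> fraction_on A V s a b)"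
    by (simp add: Spec_def fraction_on_def PiE_def Pi_def Ball_def conj_ac)
  ultimately show ?thesis by meson
qed

text \<open>The intersection of \<open>V\<close> with \<open>U\<close> is a neighbourhood of the kind that the definition asks for.\<close>

lemma sec_SpecI:
  assumes "cring A" "zariski_open A U" "s \<in> extensional U"
    and "\<And>P. P \<in> U \<Longrightarrow> \<exists>V a b. P \<in> V \<and> fraction_on A V s a b"
  shows "s \<in> carrier (sec (Spec A) U)"
  unfolding sec_Spec_iff[OF assms(1,2)]
proof (intro conjI ballI assms(3))
  fix P assume P: "P \<in> U"
  then obtain V a b where "P \<in> V" "fraction_on A V s a b" using assms(4) by blast
  moreover from this have "fraction_on A (V \<inter> U) s a b"
    by (intro fraction_on_subset[OF _ zariski_open_Int[OF assms(1) fraction_onD(1) assms(2)]]) auto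
  ultimately show "\<exists>V a b. P \<in> V \<and> V \<subseteq> U \<and> fraction_on A V s a b" using P by blast
qed

lemma sec_SpecE:
  assumes "cring A" "zariski_open A U" "s \<in> carrier (sec (Spec A) U)" "P \<in> U"
  obtains V a b where "P \<in> V" "V \<subseteq> U" "fraction_on A V s a b"
  using assms(3,4) unfolding sec_Spec_iff[OF assms(1,2)] by blast

lemma sec_Spec_ext:
  assumes "cring A" "zariski_open A U" "s \<in> carrier (sec (Spec A) U)"
  shows "s \<in> extensional U"
  using assms(3) unfolding sec_Spec_iff[OF assms(1,2)] by blast

lemma sec_Spec_at:
  assumes "cring A" "zariski_open A U" "s \<in> carrier (sec (Spec A) U)" "P \<in> U"
  shows "s P \<in> carrier (loc_at A P)"
  using assms(3,4) by (auto simp: Spec_def PiE_def Pi_def)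

lemma sec_Spec_ops:
  "s \<otimes>\<^bsub>sec (Spec A) U\<^esub> t = (\<lambda>P\<in>U. s P \<otimes>\<^bsub>loc_at A P\<^esub> t P)"
  "s \<oplus>\<^bsub>sec (Spec A) U\<^esub> t = (\<lambda>P\<in>U. s P \<oplus>\<^bsub>loc_at A P\<^esub> t P)"
  "\<one>\<^bsub>sec (Spec A) U\<^esub> = (\<lambda>P\<in>U. \<one>\<^bsub>loc_at A P\<^esub>)"
  "\<zero>\<^bsub>sec (Spec A) U\<^esub> = (\<lambda>P\<in>U. \<zero>\<^bsub>loc_at A P\<^esub>)"
  by (simp_all add: Spec_def)

lemma res_Spec: "res (Spec A) U V s = restrict s V"
  by (simp add: Spec_def)

lemma fraction_on_ops:
  assumes A: "cring A" and s: "fraction_on A V s a b" and t: "fraction_on A V t c d"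
  shows fraction_on_mult: "fraction_on A V (\<lambda>P. s P \<otimes>\<^bsub>loc_at A P\<^esub> t P) (a \<otimes>\<^bsub>A\<^esub> c) (b \<otimes>\<^bsub>A\<^esub> d)"
    and fraction_on_add: "fraction_on A V (\<lambda>P. s P \<oplus>\<^bsub>loc_at A P\<^esub> t P)
      ((a \<otimes>\<^bsub>A\<^esub> d) \<oplus>\<^bsub>A\<^esub> (c \<otimes>\<^bsub>A\<^esub> b)) (b \<otimes>\<^bsub>A\<^esub> d)"
proof -
  interpret cring A by fact
  have "b \<otimes>\<^bsub>A\<^esub> d \<notin> Q \<and> s Q \<otimes>\<^bsub>loc_at A Q\<^esub> t Q = frac_at A Q (a \<otimes>\<^bsub>A\<^esub> c) (b \<otimes>\<^bsub>A\<^esub> d) \<and>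
      s Q \<oplus>\<^bsub>loc_at A Q\<^esub> t Q = frac_at A Q ((a \<otimes>\<^bsub>A\<^esub> d) \<oplus>\<^bsub>A\<^esub> (c \<otimes>\<^bsub>A\<^esub> b)) (b \<otimes>\<^bsub>A\<^esub> d)"
    if Q: "Q \<in> V" for Q
  proof -
    interpret Q: localization A "carrier A - Q"
      by (rule localization_at_prime[OF zariski_openD[OF fraction_onD(1)[OF s] Q] A])
    show ?thesis
      using fraction_onD[OF s] fraction_onD[OF t] Q
        Q.S.m_closed[OF fraction_onD(5)[OF s Q] fraction_onD(5)[OF t Q]]
      by (simp add: Q.loc_mult Q.loc_add)
  qed
  then show "fraction_on A V (\<lambda>P. s P \<otimes>\<^bsub>loc_at A P\<^esub> t P) (a \<otimes>\<^bsub>A\<^esub> c) (b \<otimes>\<^bsub>A\<^esub> d)"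
    "fraction_on A V (\<lambda>P. s P \<oplus>\<^bsub>loc_at A P\<^esub> t P)
      ((a \<otimes>\<^bsub>A\<^esub> d) \<oplus>\<^bsub>A\<^esub> (c \<otimes>\<^bsub>A\<^esub> b)) (b \<otimes>\<^bsub>A\<^esub> d)"
    using fraction_onD[OF s] fraction_onD[OF t] by (auto simp: fraction_on_def)
qed

lemma sec_Spec_common:
  assumes A: "cring A" and U: "zariski_open A U"
    and s: "s \<in> carrier (sec (Spec A) U)" and t: "t \<in> carrier (sec (Spec A) U)" and P: "P \<in> U"
  obtains V a b c d where "P \<in> V" "V \<subseteq> U" "fraction_on A V s a b" "fraction_on A V t c d"
proof -
  obtain V a b where V: "P \<in> V" "V \<subseteq> U" "fraction_on A V s a b" by (rule sec_SpecE[OF A U s P])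
  obtain W c d where W: "P \<in> W" "W \<subseteq> U" "fraction_on A W t c d" by (rule sec_SpecE[OF A U t P])
  have VW: "zariski_open A (V \<inter> W)"
    using zariski_open_Int[OF A fraction_onD(1)[OF V(3)] fraction_onD(1)[OF W(3)]] .
  show ?thesis
    by (rule that[OF _ _ fraction_on_subset[OF V(3) VW] fraction_on_subset[OF W(3) VW]]) (use V W in auto)
qed

lemma fraction_on_const:
  assumes A: "cring A" and U: "zariski_open A U"
    and a: "a \<in> carrier A" "b \<in> carrier A" "\<And>P. P \<in> U \<Longrightarrow> b \<notin> P"
  shows "fraction_on A U (\<lambda>P\<in>U. frac_at A P a b) a b"
  using assms by (auto simp: fraction_on_def)

lemma one_notin_prime: "primeideal P A \<Longrightarrow> \<one>\<^bsub>A\<^esub> \<notin> P"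
  using ideal.one_imp_carrier[of P A] primeideal.I_notcarr[of P A] primeideal.axioms(1)[of P A] by auto

lemma sec_Spec_const:
  assumes A: "cring A" and U: "zariski_open A U"
    and a: "a \<in> carrier A" "b \<in> carrier A" "\<And>P. P \<in> U \<Longrightarrow> b \<notin> P"
  shows "(\<lambda>P\<in>U. frac_at A P a b) \<in> carrier (sec (Spec A) U)"
  by (rule sec_SpecI[OF A U]) (use fraction_on_const[OF assms] in auto)

text \<open>The ring laws hold pointwise, in the rings of fractions. What has to be shown is that sums,
  products and negatives of functions that are locally fractions are locally fractions.\<close>

lemma cring_sec_Spec:
  assumes A: "cring A" and U: "zariski_open A U"
  shows "cring (sec (Spec A) U)"
proof -
  let ?R = "sec (Spec A) U"
  interpret A: cring A by fact
  note at = sec_Spec_at[OF A U] and ext = sec_Spec_ext[OF A U]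
  have L: "cring (loc_at A P)" if "P \<in> U" for P
    using localization.cring_loc[OF localization_at_prime[OF zariski_openD[OF U that] A]] .
  have eqI: "s = t" if "s \<in> extensional U" "t \<in> extensional U" "\<And>P. P \<in> U \<Longrightarrow> s P = t P"
    for s t :: "'a set \<Rightarrow> ('a \<times> 'a) set" using that by (rule extensionalityI)
  note L' = cring.axioms(1)[OF L]
  have add: "s \<oplus>\<^bsub>?R\<^esub> t \<in> carrier ?R" and mult: "s \<otimes>\<^bsub>?R\<^esub> t \<in> carrier ?R"
    if s: "s \<in> carrier ?R" and t: "t \<in> carrier ?R" for s t
  proof -
    have "\<exists>V a b. P \<in> V \<and> fraction_on A V (s \<oplus>\<^bsub>?R\<^esub> t) a b"
      "\<exists>V a b. P \<in> V \<and> fraction_on A V (s \<otimes>\<^bsub>?R\<^esub> t) a b" if P: "P \<in> U" for P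
    proof -
      obtain V a b c d where V: "P \<in> V" "V \<subseteq> U" "fraction_on A V s a b" "fraction_on A V t c d"
        by (rule sec_Spec_common[OF A U s t P])
      have "fraction_on A V (s \<oplus>\<^bsub>?R\<^esub> t) ((a \<otimes>\<^bsub>A\<^esub> d) \<oplus>\<^bsub>A\<^esub> (c \<otimes>\<^bsub>A\<^esub> b)) (b \<otimes>\<^bsub>A\<^esub> d)"
        by (rule fraction_on_cong[OF fraction_on_add[OF A V(3,4)]]) (use V(2) in \<open>auto simp: sec_Spec_ops\<close>)
      moreover have "fraction_on A V (s \<otimes>\<^bsub>?R\<^esub> t) (a \<otimes>\<^bsub>A\<^esub> c) (b \<otimes>\<^bsub>A\<^esub> d)"
        by (rule fraction_on_cong[OF fraction_on_mult[OF A V(3,4)]]) (use V(2) in \<open>auto simp: sec_Spec_ops\<close>)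
      ultimately show "\<exists>V a b. P \<in> V \<and> fraction_on A V (s \<oplus>\<^bsub>?R\<^esub> t) a b"
        "\<exists>V a b. P \<in> V \<and> fraction_on A V (s \<otimes>\<^bsub>?R\<^esub> t) a b" using V(1) by blast+
    qed
    then show "s \<oplus>\<^bsub>?R\<^esub> t \<in> carrier ?R" "s \<otimes>\<^bsub>?R\<^esub> t \<in> carrier ?R"
      by (auto intro!: sec_SpecI[OF A U] simp: sec_Spec_ops)
  qed
  have const: "\<one>\<^bsub>?R\<^esub> \<in> carrier ?R" "\<zero>\<^bsub>?R\<^esub> \<in> carrier ?R"
    unfolding sec_Spec_ops loc_one_zero
    by (rule sec_Spec_const[OF A U], use one_notin_prime[OF zariski_openD[OF U]] in auto)+
  show ?thesis
  proof (rule cringI)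
    show "abelian_group ?R"
    proof (rule abelian_groupI)
      fix s t r assume s: "s \<in> carrier ?R" and t: "t \<in> carrier ?R" and r: "r \<in> carrier ?R"
      show "s \<oplus>\<^bsub>?R\<^esub> t \<oplus>\<^bsub>?R\<^esub> r = s \<oplus>\<^bsub>?R\<^esub> (t \<oplus>\<^bsub>?R\<^esub> r)"
        by (rule eqI) (use at[OF s] at[OF t] at[OF r] L' in \<open>auto simp: sec_Spec_ops ring.ring_simprules\<close>)
    next
      fix s t assume s: "s \<in> carrier ?R" and t: "t \<in> carrier ?R"
      show "s \<oplus>\<^bsub>?R\<^esub> t \<in> carrier ?R" using add[OF s t] .
      show "s \<oplus>\<^bsub>?R\<^esub> t = t \<oplus>\<^bsub>?R\<^esub> s"
        by (rule eqI) (use at[OF s] at[OF t] ring.ring_simprules(10)[OF L'] in \<open>auto simp: sec_Spec_ops\<close>)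
      show "\<zero>\<^bsub>?R\<^esub> \<oplus>\<^bsub>?R\<^esub> s = s"
        by (rule eqI) (use at[OF s] ext[OF s] L' in \<open>auto simp: sec_Spec_ops ring.ring_simprules\<close>)
      let ?m = "\<lambda>P\<in>U. \<ominus>\<^bsub>loc_at A P\<^esub> s P"
      have "?m \<in> carrier ?R"
      proof (rule sec_SpecI[OF A U])
        fix P assume P: "P \<in> U"
        obtain V a b where V: "P \<in> V" "V \<subseteq> U" "fraction_on A V s a b" by (rule sec_SpecE[OF A U s P])
        have "?m Q = frac_at A Q (\<ominus>\<^bsub>A\<^esub> a) b" if Q: "Q \<in> V" for Q
        proof -
          note b = fraction_onD[OF V(3)] fraction_onD(5)[OF V(3) Q]
          interpret Q: localization A "carrier A - Q"
            by (rule localization_at_prime[OF zariski_openD[OF b(1) Q] A])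
          have "\<ominus>\<^bsub>loc_at A Q\<^esub> frac_at A Q a b = frac_at A Q (\<ominus>\<^bsub>A\<^esub> a) b"
            by (rule Q.loc_minus[OF b(2,7)])
          then show ?thesis using b(6)[OF Q] subsetD[OF V(2) Q] by simp
        qed
        then have "fraction_on A V ?m (\<ominus>\<^bsub>A\<^esub> a) b"
          using fraction_onD[OF V(3)] by (simp add: fraction_on_def)
        then show "\<exists>V a b. P \<in> V \<and> fraction_on A V ?m a b" using V(1) by blast
      qed simp
      moreover have "?m \<oplus>\<^bsub>?R\<^esub> s = \<zero>\<^bsub>?R\<^esub>"
        by (rule eqI) (use at[OF s] L' in \<open>auto simp: sec_Spec_ops ring.ring_simprules\<close>)
      ultimately show "\<exists>t\<in>carrier ?R. t \<oplus>\<^bsub>?R\<^esub> s = \<zero>\<^bsub>?R\<^esub>" by blast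
    qed (rule const)
    show "comm_monoid ?R"
    proof (rule comm_monoidI)
      fix s t r assume s: "s \<in> carrier ?R" and t: "t \<in> carrier ?R" and r: "r \<in> carrier ?R"
      show "s \<otimes>\<^bsub>?R\<^esub> t \<otimes>\<^bsub>?R\<^esub> r = s \<otimes>\<^bsub>?R\<^esub> (t \<otimes>\<^bsub>?R\<^esub> r)"
        by (rule eqI) (use at[OF s] at[OF t] at[OF r] L' in \<open>auto simp: sec_Spec_ops ring.ring_simprules\<close>)
    next
      fix s t assume s: "s \<in> carrier ?R" and t: "t \<in> carrier ?R"
      show "s \<otimes>\<^bsub>?R\<^esub> t \<in> carrier ?R" using mult[OF s t] .
      show "s \<otimes>\<^bsub>?R\<^esub> t = t \<otimes>\<^bsub>?R\<^esub> s"
        by (rule eqI) (use at[OF s] at[OF t] cring.cring_simprules(14)[OF L] in \<open>auto simp: sec_Spec_ops\<close>)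
      show "\<one>\<^bsub>?R\<^esub> \<otimes>\<^bsub>?R\<^esub> s = s"
        by (rule eqI) (use at[OF s] ext[OF s] L' in \<open>auto simp: sec_Spec_ops ring.ring_simprules\<close>)
    qed (rule const)
    fix s t r assume s: "s \<in> carrier ?R" and t: "t \<in> carrier ?R" and r: "r \<in> carrier ?R"
    show "(s \<oplus>\<^bsub>?R\<^esub> t) \<otimes>\<^bsub>?R\<^esub> r = s \<otimes>\<^bsub>?R\<^esub> r \<oplus>\<^bsub>?R\<^esub> t \<otimes>\<^bsub>?R\<^esub> r"
      by (rule eqI) (use at[OF s] at[OF t] at[OF r] L' in \<open>auto simp: sec_Spec_ops ring.ring_simprules\<close>)
  qed
qed

lemma presheaf_Spec:
  assumes A: "cring A"
  shows "presheaf_of_rings (Spec A)"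
  unfolding presheaf_of_rings_def openin_Spec[OF A] res_Spec
proof (intro conjI allI impI)
  fix U assume "zariski_open A U"
  then show "cring (sec (Spec A) U)" by (rule cring_sec_Spec[OF A])
next
  fix U V assume U: "zariski_open A U" and V: "zariski_open A V" and VU: "V \<subseteq> U"
  show "(\<lambda>s. restrict s V) \<in> ring_hom (sec (Spec A) U) (sec (Spec A) V)"
  proof (rule ring_hom_memI)
    fix s assume s: "s \<in> carrier (sec (Spec A) U)"
    show "restrict s V \<in> carrier (sec (Spec A) V)"
    proof (rule sec_SpecI[OF A V])
      fix P assume P: "P \<in> V"
      obtain W a b where W: "P \<in> W" "W \<subseteq> U" "fraction_on A W s a b"
        using sec_SpecE[OF A U s] P VU by blast
      have "fraction_on A (W \<inter> V) (restrict s V) a b"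
        using fraction_on_subset[OF W(3) zariski_open_Int[OF A fraction_onD(1)[OF W(3)] V]]
        by (auto intro: fraction_on_cong)
      then show "\<exists>V' a b. P \<in> V' \<and> fraction_on A V' (restrict s V) a b" using P W(1) by blast
    qed simp
  qed (use VU in \<open>auto simp: sec_Spec_ops restrict_def fun_eq_iff\<close>)
next
  fix U s assume "zariski_open A U" "s \<in> carrier (sec (Spec A) U)"
  then show "restrict s U = s" using sec_Spec_ext[OF A] by (simp add: extensional_restrict)
qed (simp add: Int_absorb1)

text \<open>Every germ on a spectrum is the germ of a fraction, so that computations in stalks are computations
  with fractions.\<close>

lemma Spec_local_section:
  assumes A: "cring A" and s: "local_section (Spec A) P U s"
  obtains V a b where "fraction_on A V (\<lambda>Q\<in>V. frac_at A Q a b) a b" "P \<in> V"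
    "germ (Spec A) P U s = germ (Spec A) P V (\<lambda>Q\<in>V. frac_at A Q a b)"
proof -
  have U: "zariski_open A U" "P \<in> U" "s \<in> carrier (sec (Spec A) U)"
    using s by (auto simp: local_section_def openin_Spec[OF A])
  obtain V a b where V: "P \<in> V" "V \<subseteq> U" "fraction_on A V s a b" by (rule sec_SpecE[OF A U(1,3,2)])
  have "restrict s V = (\<lambda>Q\<in>V. frac_at A Q a b)" by (rule restrict_ext, rule fraction_onD(6)[OF V(3)])
  moreover have "germ (Spec A) P V (restrict s V) = germ (Spec A) P U s"
    using germ_res[OF presheaf_Spec[OF A] s _ V(1,2)] fraction_onD(1)[OF V(3)]
    by (simp add: res_Spec openin_Spec[OF A])
  moreover have "fraction_on A V (restrict s V) a b" by (rule fraction_on_cong[OF V(3)]) simp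
  ultimately show ?thesis using that[OF _ V(1)] by simp
qed

section \<open>Morphisms between spectra\<close>

context
  fixes A :: "'a ring" and B :: "'b ring" and \<phi>
  assumes A: "cring A" and B: "cring B" and \<phi>: "\<phi> \<in> ring_hom A B"
begin

interpretation A: cring A by (rule A)
interpretation B: cring B by (rule B)
interpretation ring_hom_cring A B \<phi> by unfold_locales (rule \<phi>)

lemma contract_prime: "primeideal Q B \<Longrightarrow> primeideal {a \<in> carrier A. \<phi> a \<in> Q} A"
  by (rule ring_hom_ring.primeideal_vimage[OF ring_hom_ringI2[OF A.ring_axioms B.ring_axioms \<phi>] A])

lemma pre_Spec_map:
  "pre (Spec B) (Spec_map A B \<phi>) V = {Q. primeideal Q B \<and> {a \<in> carrier A. \<phi> a \<in> Q} \<in> V}"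
  by (auto simp: pre_def Spec_map_def points_Spec[OF B])

lemma zariski_open_contract:
  assumes "zariski_open A V"
  shows "zariski_open B {Q. primeideal Q B \<and> {a \<in> carrier A. \<phi> a \<in> Q} \<in> V}"
proof -
  from assms obtain S where S: "S \<subseteq> carrier A" "V = {P. primeideal P A \<and> \<not> S \<subseteq> P}"
    unfolding zariski_open_def by blast
  have "{Q. primeideal Q B \<and> {a \<in> carrier A. \<phi> a \<in> Q} \<in> V} = {Q. primeideal Q B \<and> \<not> \<phi> ` S \<subseteq> Q}"
    using S contract_prime by auto
  moreover have "\<phi> ` S \<subseteq> carrier B" using S(1) by auto
  ultimately show ?thesis unfolding zariski_open_def by (intro exI[of _ "\<phi> ` S"]) simp
qed

lemma Spec_map_smap:
  assumes "zariski_open A V" "s \<in> carrier (sec (Spec A) V)" "primeideal Q B"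
    "{a \<in> carrier A. \<phi> a \<in> Q} \<in> V"
  shows "smap (Spec_map A B \<phi>) V s Q = loc_map B (carrier B - Q) \<phi> (s {a \<in> carrier A. \<phi> a \<in> Q})"
  using assms by (simp add: Spec_map_def openin_Spec[OF A] points_Spec[OF B] loc_map_def)

lemma loc_map_contract:
  assumes Q: "primeideal Q B"
  defines "P \<equiv> {a \<in> carrier A. \<phi> a \<in> Q}"
  shows "loc_map B (carrier B - Q) \<phi> \<in> ring_hom (loc_at A P) (loc_at B Q)"
    and "a \<in> carrier A \<Longrightarrow> b \<in> carrier A \<Longrightarrow> \<phi> b \<notin> Q \<Longrightarrow>
      loc_map B (carrier B - Q) \<phi> (frac_at A P a b) = frac_at B Q (\<phi> a) (\<phi> b)"
proof -
  have P: "localization A (carrier A - P)"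
    unfolding P_def by (rule localization_at_prime[OF contract_prime[OF Q] A])
  have sub: "\<phi> ` (carrier A - P) \<subseteq> carrier B - Q" by (auto simp: P_def)
  note lQ = localization_at_prime[OF Q B]
  show "loc_map B (carrier B - Q) \<phi> \<in> ring_hom (loc_at A P) (loc_at B Q)"
    by (rule loc_map_ring_hom[OF P lQ \<phi> sub])
  show "a \<in> carrier A \<Longrightarrow> b \<in> carrier A \<Longrightarrow> \<phi> b \<notin> Q \<Longrightarrow>
      loc_map B (carrier B - Q) \<phi> (frac_at A P a b) = frac_at B Q (\<phi> a) (\<phi> b)"
    by (rule loc_map_frac[OF P lQ \<phi> sub]) (auto simp: P_def)
qed

lemma Spec_map_fraction:
  assumes V: "zariski_open A V" and s: "s \<in> carrier (sec (Spec A) V)"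
    and W: "fraction_on A W s a b" "W \<subseteq> V"
  shows "fraction_on B {Q. primeideal Q B \<and> {a \<in> carrier A. \<phi> a \<in> Q} \<in> W}
    (smap (Spec_map A B \<phi>) V s) (\<phi> a) (\<phi> b)"
proof -
  note ab = fraction_onD[OF W(1)]
  have "\<phi> b \<notin> Q \<and> smap (Spec_map A B \<phi>) V s Q = frac_at B Q (\<phi> a) (\<phi> b)"
    if Q: "primeideal Q B" "{a \<in> carrier A. \<phi> a \<in> Q} \<in> W" for Q
  proof -
    have b: "\<phi> b \<notin> Q" using ab(3) ab(4)[OF Q(2)] by simp
    have "{a \<in> carrier A. \<phi> a \<in> Q} \<in> V" using Q(2) W(2) by blast
    then show ?thesis
      using b Spec_map_smap[OF V s Q(1)] ab(6)[OF Q(2)] loc_map_contract(2)[OF Q(1) ab(2,3) b] by simp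
  qed
  then show ?thesis using ab zariski_open_contract[OF ab(1)] by (auto simp: fraction_on_def)
qed

lemma Spec_map_presheaf_hom: "Spec_map A B \<phi> \<in> presheaf_hom (Spec B) (Spec A)"
proof -
  let ?f = "Spec_map A B \<phi>"
  let ?c = "\<lambda>Q. {a \<in> carrier A. \<phi> a \<in> Q}"
  have pt: "pmap ?f Q = ?c Q" if "primeideal Q B" for Q
    using that by (simp add: Spec_map_def points_Spec[OF B])
  have "continuous_map (tp (Spec B)) (tp (Spec A)) (pmap ?f)"
    unfolding continuous_map_def points_Spec[OF A] points_Spec[OF B] openin_Spec[OF A] openin_Spec[OF B]
  proof (intro conjI allI impI)
    show "pmap ?f \<in> {Q. primeideal Q B} \<rightarrow> {P. primeideal P A}"
      using contract_prime by (auto simp: pt)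
    fix V assume "zariski_open A V"
    moreover have "{Q \<in> {Q. primeideal Q B}. pmap ?f Q \<in> V} = {Q. primeideal Q B \<and> ?c Q \<in> V}"
      by (auto simp: pt)
    ultimately show "zariski_open B {Q \<in> {Q. primeideal Q B}. pmap ?f Q \<in> V}"
      using zariski_open_contract by simp
  qed
  moreover have "pmap ?f \<in> extensional (points (Spec B))" "smap ?f \<in> extensional {V. openin (tp (Spec A)) V}"
    "\<And>V. openin (tp (Spec A)) V \<Longrightarrow> smap ?f V \<in> extensional (carrier (sec (Spec A) V))"
    by (simp_all add: Spec_map_def)
  moreover have "smap ?f V \<in> ring_hom (sec (Spec A) V) (sec (Spec B) (pre (Spec B) ?f V))"
    if "openin (tp (Spec A)) V" for V
  proof -
    have V: "zariski_open A V" using that openin_Spec[OF A] by simp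
    interpret VA: cring "sec (Spec A) V" by (rule cring_sec_Spec[OF A V])
    have ext: "smap ?f V s \<in> extensional {Q. primeideal Q B \<and> ?c Q \<in> V}"
      if "s \<in> carrier (sec (Spec A) V)" for s
      using that V by (auto simp: Spec_map_def openin_Spec[OF A] points_Spec[OF B] extensional_def)
    note h = loc_map_contract(1) and at = sec_Spec_at[OF A V]
    have eqI: "smap ?f V s = (\<lambda>Q\<in>{Q. primeideal Q B \<and> ?c Q \<in> V}. g Q)"
      if s: "s \<in> carrier (sec (Spec A) V)"
        and g: "\<And>Q. primeideal Q B \<Longrightarrow> ?c Q \<in> V \<Longrightarrow> loc_map B (carrier B - Q) \<phi> (s (?c Q)) = g Q"
      for s g
    proof (rule extensionalityI[OF ext[OF s] restrict_extensional])
      fix Q assume "Q \<in> {Q. primeideal Q B \<and> ?c Q \<in> V}"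
      then show "smap ?f V s Q = restrict g {Q. primeideal Q B \<and> ?c Q \<in> V} Q"
        by (simp add: Spec_map_smap[OF V s] g)
    qed
    show ?thesis
      unfolding pre_Spec_map
    proof (rule ring_hom_memI)
      fix s assume s: "s \<in> carrier (sec (Spec A) V)"
      show "smap ?f V s \<in> carrier (sec (Spec B) {Q. primeideal Q B \<and> ?c Q \<in> V})"
      proof (rule sec_SpecI[OF B zariski_open_contract[OF V] ext[OF s]])
        fix Q assume Q: "Q \<in> {Q. primeideal Q B \<and> ?c Q \<in> V}"
        then have cQ: "?c Q \<in> V" by simp
        obtain W a b where W: "?c Q \<in> W" "W \<subseteq> V" "fraction_on A W s a b"
          by (rule sec_SpecE[OF A V s cQ])
        show "\<exists>V' a b. Q \<in> V' \<and> fraction_on B V' (smap ?f V s) a b"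
          by (intro exI conjI, rule_tac [2] Spec_map_fraction[OF V s W(3,2)]) (use Q W(1) in simp)
      qed
      fix t assume t: "t \<in> carrier (sec (Spec A) V)"
      show "smap ?f V (s \<otimes>\<^bsub>sec (Spec A) V\<^esub> t) =
          smap ?f V s \<otimes>\<^bsub>sec (Spec B) {Q. primeideal Q B \<and> ?c Q \<in> V}\<^esub> smap ?f V t"
        unfolding sec_Spec_ops(1)[where A = B]
      proof (rule eqI[OF VA.m_closed[OF s t]])
        fix Q assume Q: "primeideal Q B" "?c Q \<in> V"
        have "(s \<otimes>\<^bsub>sec (Spec A) V\<^esub> t) (?c Q) = s (?c Q) \<otimes>\<^bsub>loc_at A (?c Q)\<^esub> t (?c Q)"
          unfolding sec_Spec_ops by (rule restrict_apply'[OF Q(2)])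
        then show "loc_map B (carrier B - Q) \<phi> ((s \<otimes>\<^bsub>sec (Spec A) V\<^esub> t) (?c Q)) =
            smap ?f V s Q \<otimes>\<^bsub>loc_at B Q\<^esub> smap ?f V t Q"
          using ring_hom_memE(2)[OF h[OF Q(1)] at[OF s Q(2)] at[OF t Q(2)]]
          by (simp only: Spec_map_smap[OF V s Q] Spec_map_smap[OF V t Q])
      qed
      show "smap ?f V (s \<oplus>\<^bsub>sec (Spec A) V\<^esub> t) =
          smap ?f V s \<oplus>\<^bsub>sec (Spec B) {Q. primeideal Q B \<and> ?c Q \<in> V}\<^esub> smap ?f V t"
        unfolding sec_Spec_ops(2)[where A = B]
      proof (rule eqI[OF VA.a_closed[OF s t]])
        fix Q assume Q: "primeideal Q B" "?c Q \<in> V"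
        have "(s \<oplus>\<^bsub>sec (Spec A) V\<^esub> t) (?c Q) = s (?c Q) \<oplus>\<^bsub>loc_at A (?c Q)\<^esub> t (?c Q)"
          unfolding sec_Spec_ops by (rule restrict_apply'[OF Q(2)])
        then show "loc_map B (carrier B - Q) \<phi> ((s \<oplus>\<^bsub>sec (Spec A) V\<^esub> t) (?c Q)) =
            smap ?f V s Q \<oplus>\<^bsub>loc_at B Q\<^esub> smap ?f V t Q"
          using ring_hom_memE(3)[OF h[OF Q(1)] at[OF s Q(2)] at[OF t Q(2)]]
          by (simp only: Spec_map_smap[OF V s Q] Spec_map_smap[OF V t Q])
      qed
    next
      show "smap ?f V \<one>\<^bsub>sec (Spec A) V\<^esub> = \<one>\<^bsub>sec (Spec B) {Q. primeideal Q B \<and> ?c Q \<in> V}\<^esub>"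
        unfolding sec_Spec_ops(3)[where A = B]
      proof (rule eqI[OF VA.one_closed])
        fix Q assume Q: "primeideal Q B" "?c Q \<in> V"
        have "\<one>\<^bsub>sec (Spec A) V\<^esub> (?c Q) = \<one>\<^bsub>loc_at A (?c Q)\<^esub>"
          unfolding sec_Spec_ops by (rule restrict_apply'[OF Q(2)])
        then show "loc_map B (carrier B - Q) \<phi> (\<one>\<^bsub>sec (Spec A) V\<^esub> (?c Q)) = \<one>\<^bsub>loc_at B Q\<^esub>"
          using ring_hom_memE(4)[OF h[OF Q(1)]] by (simp only:)
      qed
    qed
  qed
  moreover have "smap ?f W (res (Spec A) V W s) =
      res (Spec B) (pre (Spec B) ?f V) (pre (Spec B) ?f W) (smap ?f V s)"
    if V: "openin (tp (Spec A)) V" and W: "openin (tp (Spec A)) W" and WV: "W \<subseteq> V"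
      and s: "s \<in> carrier (sec (Spec A) V)" for V W s
  proof -
    have VW: "zariski_open A V" "zariski_open A W" using V W by (simp_all add: openin_Spec[OF A])
    have r: "restrict s W \<in> carrier (sec (Spec A) W)"
      using presheaf_res_closed[OF presheaf_Spec[OF A] V W WV s] by (simp add: res_Spec)
    show ?thesis
      unfolding res_Spec pre_Spec_map
    proof (rule extensionalityI)
      show "smap ?f W (restrict s W) \<in> extensional {Q. primeideal Q B \<and> ?c Q \<in> W}"
        using r W by (auto simp: Spec_map_def points_Spec[OF B] extensional_def)
      fix Q assume "Q \<in> {Q. primeideal Q B \<and> ?c Q \<in> W}"
      then show "smap ?f W (restrict s W) Q =
          restrict (smap ?f V s) {Q. primeideal Q B \<and> ?c Q \<in> W} Q"
        using WV by (simp add: Spec_map_smap[OF VW(2) r] Spec_map_smap[OF VW(1) s] subset_iff)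
    qed simp
  qed
  ultimately show ?thesis unfolding presheaf_hom_def by blast
qed

end

text \<open>A ring map \<open>\<phi>\<close> with left inverse \<open>\<psi>\<close>: contracting a prime ideal along \<open>\<psi>\<close> and then along \<open>\<phi>\<close>, or
  mapping a fraction by \<open>\<phi>\<close> and then by \<open>\<psi>\<close>, changes nothing.\<close>

lemma Spec_map_retract:
  assumes A: "cring A" and B: "cring B" and \<phi>: "\<phi> \<in> ring_hom A B" and \<psi>: "\<psi> \<in> ring_hom B A"
    and id: "\<And>a. a \<in> carrier A \<Longrightarrow> \<psi> (\<phi> a) = a"
  shows "mor_comp (Spec A) (Spec B) (Spec A) (Spec_map A B \<phi>) (Spec_map B A \<psi>) = mor_id (Spec A)"
proof (rule presheaf_hom_eqI)
  note f = Spec_map_presheaf_hom[OF A B \<phi>] and g = Spec_map_presheaf_hom[OF B A \<psi>]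
  note PA = presheaf_Spec[OF A]
  show "mor_comp (Spec A) (Spec B) (Spec A) (Spec_map A B \<phi>) (Spec_map B A \<psi>) \<in> presheaf_hom (Spec A) (Spec A)"
    by (rule mor_comp_presheaf_hom[OF PA g f])
  show "mor_id (Spec A) \<in> presheaf_hom (Spec A) (Spec A)" by (rule mor_id_presheaf_hom[OF PA])
  have P: "{a \<in> carrier A. \<phi> a \<in> {b \<in> carrier B. \<psi> b \<in> P}} = P" if "primeideal P A" for P
    using additive_subgroup.a_subset[OF ideal.axioms(1)[OF primeideal.axioms(1)[OF that]]]
      ring_hom_memE(1)[OF \<phi>] id by auto
  fix P assume "P \<in> points (Spec A)"
  then show "pmap (mor_comp (Spec A) (Spec B) (Spec A) (Spec_map A B \<phi>) (Spec_map B A \<psi>)) P =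
      pmap (mor_id (Spec A)) P"
    using P contract_prime[OF B A \<psi>]
    by (simp add: mor_comp_simps) (simp add: mor_id_def Spec_map_def points_Spec A B)
next
  fix V s assume V: "openin (tp (Spec A)) V" and s: "s \<in> carrier (sec (Spec A) V)"
  note f = Spec_map_presheaf_hom[OF A B \<phi>] and g = Spec_map_presheaf_hom[OF B A \<psi>]
  have V': "zariski_open A V" using V by (simp add: openin_Spec[OF A])
  let ?U = "pre (Spec B) (Spec_map A B \<phi>) V"
  have P: "{a \<in> carrier A. \<phi> a \<in> {b \<in> carrier B. \<psi> b \<in> P}} = P" if "primeideal P A" for P
    using additive_subgroup.a_subset[OF ideal.axioms(1)[OF primeideal.axioms(1)[OF that]]]
      ring_hom_memE(1)[OF \<phi>] id by auto
  have U: "zariski_open B ?U" using presheaf_hom_pre[OF f V] by (simp add: openin_Spec[OF B])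
  have s': "smap (Spec_map A B \<phi>) V s \<in> carrier (sec (Spec B) ?U)"
    by (rule presheaf_hom_closed[OF f V s])
  have preU: "pre (Spec A) (Spec_map B A \<psi>) ?U = V"
    unfolding pre_Spec_map[OF B A \<psi>] unfolding pre_Spec_map[OF A B \<phi>]
    using P zariski_openD[OF V'] contract_prime[OF B A \<psi>] by auto
  have "smap (Spec_map B A \<psi>) ?U (smap (Spec_map A B \<phi>) V s) = s"
  proof (rule extensionalityI)
    show "smap (Spec_map B A \<psi>) ?U (smap (Spec_map A B \<phi>) V s) \<in> extensional V"
      using presheaf_hom_closed[OF g presheaf_hom_pre[OF f V] s'] preU sec_Spec_ext[OF A V'] by simp
    show "s \<in> extensional V" using sec_Spec_ext[OF A V' s] .
    fix Q assume Q: "Q \<in> V"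
    let ?Q = "{b \<in> carrier B. \<psi> b \<in> Q}"
    note Qp = zariski_openD[OF V' Q]
    note Q' = contract_prime[OF B A \<psi> Qp]
    have Q'U: "?Q \<in> ?U" unfolding pre_Spec_map[OF A B \<phi>] using Q' P[OF Qp] Q by simp
    obtain W a b where W: "Q \<in> W" "W \<subseteq> V" "fraction_on A W s a b" by (rule sec_SpecE[OF A V' s Q])
    have "smap (Spec_map B A \<psi>) ?U (smap (Spec_map A B \<phi>) V s) Q = frac_at A Q (\<psi> (\<phi> a)) (\<psi> (\<phi> b))"
    proof (rule fraction_onD(6)[OF Spec_map_fraction[OF B A \<psi> U s' Spec_map_fraction[OF A B \<phi> V' s W(3,2)]]])
      show "{Q. primeideal Q B \<and> {a \<in> carrier A. \<phi> a \<in> Q} \<in> W} \<subseteq> ?U"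
        unfolding pre_Spec_map[OF A B \<phi>] using W(2) by blast
      show "Q \<in> {P. primeideal P A \<and> {b \<in> carrier B. \<psi> b \<in> P}
          \<in> {Q. primeideal Q B \<and> {a \<in> carrier A. \<phi> a \<in> Q} \<in> W}}"
        using Qp Q' P[OF Qp] W(1) by simp
    qed
    then show "smap (Spec_map B A \<psi>) ?U (smap (Spec_map A B \<phi>) V s) Q = s Q"
      using fraction_onD[OF W(3)] W(1) id by simp
  qed
  then show "smap (mor_comp (Spec A) (Spec B) (Spec A) (Spec_map A B \<phi>) (Spec_map B A \<psi>)) V s =
      smap (mor_id (Spec A)) V s"
    by (simp add: mor_comp_simps V s) (simp add: mor_id_def V s)
qed

section \<open>Points with values in a field\<close>

lemma maximalideal_no_unit:
  assumes "maximalideal M R" "C \<in> M" "D \<in> carrier R"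
  shows "C \<otimes>\<^bsub>R\<^esub> D \<noteq> \<one>\<^bsub>R\<^esub>"
proof
  interpret maximalideal M R by fact
  assume "C \<otimes>\<^bsub>R\<^esub> D = \<one>\<^bsub>R\<^esub>"
  then have "\<one>\<^bsub>R\<^esub> \<in> M" using I_r_closed[OF assms(2,3)] by simp
  then show False using one_imp_carrier I_notcarr by simp
qed

lemma field_prime_zero:
  assumes "field K" "primeideal Q K" "a \<in> Q"
  shows "a = \<zero>\<^bsub>K\<^esub>"
proof (rule ccontr)
  interpret field K by fact
  interpret Q: primeideal Q K by fact
  have a: "a \<in> carrier K" using assms(3) by (rule Q.Icarr)
  assume "a \<noteq> \<zero>\<^bsub>K\<^esub>"
  then have "a \<in> Units K" using a field_Units by simp
  then have "inv\<^bsub>K\<^esub> a \<in> carrier K" "inv\<^bsub>K\<^esub> a \<otimes>\<^bsub>K\<^esub> a = \<one>\<^bsub>K\<^esub>" by auto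
  then show False using Q.I_l_closed[OF assms(3), of "inv\<^bsub>K\<^esub> a"] one_notin_prime[OF assms(2)] by simp
qed

text \<open>The inverse of \<open>a/b\<close> is \<open>b/a\<close>, on the smaller neighbourhood where \<open>a\<close> does not vanish.\<close>

lemma Spec_germ_unit:
  assumes A: "cring A" and f: "fraction_on A V (\<lambda>Q\<in>V. frac_at A Q a b) a b"
    and P: "P \<in> V" "a \<notin> P"
  shows "\<exists>D\<in>carrier (stalk (Spec A) P).
    germ (Spec A) P V (\<lambda>Q\<in>V. frac_at A Q a b) \<otimes>\<^bsub>stalk (Spec A) P\<^esub> D = \<one>\<^bsub>stalk (Spec A) P\<^esub>"
proof -
  interpret A: cring A by fact
  note F = fraction_onD[OF f] and pre = presheaf_Spec[OF A]
  let ?W = "V \<inter> {Q. primeideal Q A \<and> a \<notin> Q}"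
  let ?s = "\<lambda>U. \<lambda>Q\<in>U. frac_at A Q a b" and ?t = "\<lambda>Q\<in>?W. frac_at A Q b a"
  have W: "zariski_open A ?W" by (rule zariski_open_Int[OF A F(1) zariski_open_basic[OF F(2)]])
  have PW: "P \<in> ?W" using P zariski_openD[OF F(1)] by simp
  have sV: "local_section (Spec A) P V (?s V)"
    unfolding local_section_def openin_Spec[OF A]
    using F(1) P(1) sec_Spec_const[OF A F(1-3)] F(4) by simp
  have sW: "local_section (Spec A) P ?W (?s ?W)"
    unfolding local_section_def openin_Spec[OF A]
    using W PW sec_Spec_const[OF A W F(2,3)] F(4) by simp
  have tW: "local_section (Spec A) P ?W ?t"
    unfolding local_section_def openin_Spec[OF A]
    using W PW sec_Spec_const[OF A W F(3,2)] by simp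
  have "restrict (?s V) ?W = ?s ?W" by (rule ext) simp
  then have germ: "germ (Spec A) P V (?s V) = germ (Spec A) P ?W (?s ?W)"
    using germ_res[OF pre sV, of ?W] W PW by (simp add: res_Spec openin_Spec[OF A])
  have "?s ?W \<otimes>\<^bsub>sec (Spec A) ?W\<^esub> ?t = \<one>\<^bsub>sec (Spec A) ?W\<^esub>"
    unfolding sec_Spec_ops
  proof (rule restrict_ext)
    fix Q assume Q: "Q \<in> ?W"
    interpret Q: localization A "carrier A - Q"
      by (rule localization_at_prime[OF zariski_openD[OF W Q] A])
    have b: "b \<in> carrier A - Q" and a: "a \<in> carrier A - Q" using F Q by auto
    have "frac_at A Q a b \<otimes>\<^bsub>loc_at A Q\<^esub> frac_at A Q b a = frac_at A Q (a \<otimes>\<^bsub>A\<^esub> b) (b \<otimes>\<^bsub>A\<^esub> a)"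
      by (rule Q.loc_mult[OF F(2,3) b a])
    also have "\<dots> = \<one>\<^bsub>loc_at A Q\<^esub>"
      unfolding loc_one_zero
    proof (rule Q.frac_eqI)
      show "a \<otimes>\<^bsub>A\<^esub> b \<otimes>\<^bsub>A\<^esub> \<one>\<^bsub>A\<^esub> = \<one>\<^bsub>A\<^esub> \<otimes>\<^bsub>A\<^esub> (b \<otimes>\<^bsub>A\<^esub> a)" using F(2,3) by algebra
      show "b \<otimes>\<^bsub>A\<^esub> a \<in> carrier A - Q" by (rule Q.S.m_closed[OF b a])
      show "\<one>\<^bsub>A\<^esub> \<in> carrier A - Q" by (rule Q.S.one_closed)
    qed (use F(2,3) in simp_all)
    finally show "?s ?W Q \<otimes>\<^bsub>loc_at A Q\<^esub> ?t Q = \<one>\<^bsub>loc_at A Q\<^esub>" using Q by simp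
  qed
  then show ?thesis
    using germ_in_stalk[OF tW] stalk_mult[OF pre sW tW] stalk_one[OF pre sW] germ by auto
qed

text \<open>An element of the maximal ideal is not a unit, so it is the germ of a fraction \<open>a/b\<close> with \<open>a\<close> in the
  prime ideal that is the image of \<open>Q\<close>, by \<open>Spec_germ_unit\<close>. This means that \<open>\<phi> a\<close> lies in \<open>Q\<close>, which is
  zero because \<open>K\<close> is a field.\<close>

lemma Spec_map_field_kills:
  assumes A: "cring A" and K: "field K" and \<phi>: "\<phi> \<in> ring_hom A K" and Q: "Q \<in> points (Spec K)"
    and M: "maximalideal M (stalk (Spec A) (pmap (Spec_map A K \<phi>) Q))" and C: "C \<in> M"
  shows "stalk_map (Spec K) (Spec_map A K \<phi>) Q C = \<zero>\<^bsub>stalk (Spec K) Q\<^esub>"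
proof -
  interpret K: field K by fact
  have cK: "cring K" by (rule K.is_cring)
  interpret \<phi>: ring_hom_cring A K \<phi>
    using A cK \<phi> by (simp add: ring_hom_cring_def ring_hom_cring_axioms_def)
  let ?f = "Spec_map A K \<phi>"
  let ?P = "pmap ?f Q"
  have Qp: "primeideal Q K" using Q by (simp add: points_Spec[OF cK])
  have P: "?P = {a \<in> carrier A. \<phi> a \<in> Q}" using Q by (simp add: Spec_map_def)
  note pA = presheaf_Spec[OF A] and pK = presheaf_Spec[OF cK]
  note f = Spec_map_presheaf_hom[OF A cK \<phi>]
  have "C \<in> carrier (stalk (Spec A) ?P)"
    using C additive_subgroup.a_subset[OF ideal.axioms(1)[OF maximalideal.axioms(1)[OF M]]] by blast
  then obtain U s where "local_section (Spec A) ?P U s" "C = germ (Spec A) ?P U s" by (rule stalkE)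
  then obtain V a b where V: "fraction_on A V (\<lambda>Q\<in>V. frac_at A Q a b) a b" "?P \<in> V"
    and CV: "C = germ (Spec A) ?P V (\<lambda>Q\<in>V. frac_at A Q a b)"
    using Spec_local_section[OF A] by metis
  note F = fraction_onD[OF V(1)]
  let ?s = "\<lambda>Q\<in>V. frac_at A Q a b"
  have "a \<in> ?P"
  proof (rule ccontr)
    assume "a \<notin> ?P"
    from Spec_germ_unit[OF A V this] show False
      using maximalideal_no_unit[OF M C] unfolding CV by blast
  qed
  then have "\<phi> a \<in> Q" unfolding P by simp
  then have a0: "\<phi> a = \<zero>\<^bsub>K\<^esub>" by (rule field_prime_zero[OF K Qp])
  have s: "?s \<in> carrier (sec (Spec A) V)" by (rule sec_Spec_const[OF A F(1-4)])
  have ls: "local_section (Spec A) ?P V ?s"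
    using s V(2) F(1) by (simp add: local_section_def openin_Spec[OF A])
  let ?W = "pre (Spec K) ?f V"
  have Veq: "?W = {Q. primeideal Q K \<and> {a \<in> carrier A. \<phi> a \<in> Q} \<in> V}"
    by (rule pre_Spec_map[OF A cK \<phi>])
  have lW: "local_section (Spec K) Q ?W (smap ?f V ?s)" by (rule local_section_smap[OF f Q ls])
  then have W: "zariski_open K ?W" and sW: "smap ?f V ?s \<in> carrier (sec (Spec K) ?W)"
    by (simp_all add: local_section_def openin_Spec[OF cK])
  have fr: "fraction_on K ?W (smap ?f V ?s) (\<phi> a) (\<phi> b)"
    unfolding Veq by (rule Spec_map_fraction[OF A cK \<phi> F(1) s V(1) subset_refl])
  note G = fraction_onD[OF fr]
  have "smap ?f V ?s = \<zero>\<^bsub>sec (Spec K) ?W\<^esub>"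
    unfolding sec_Spec_ops
  proof (rule extensionalityI[OF sec_Spec_ext[OF cK W sW] restrict_extensional])
    fix R assume R: "R \<in> ?W"
    interpret R: localization K "carrier K - R"
      by (rule localization_at_prime[OF zariski_openD[OF W R] cK])
    have "frac_at K R (\<phi> a) (\<phi> b) = \<zero>\<^bsub>loc_at K R\<^esub>"
      unfolding loc_one_zero a0
      by (rule R.frac_eqI) (use G(3) G(5)[OF R] R.S.one_closed in simp_all)
    then show "smap ?f V ?s R = (\<lambda>P\<in>?W. \<zero>\<^bsub>loc_at K P\<^esub>) R" using G(6)[OF R] R by simp
  qed
  then show ?thesis
    using stalk_map_germ[OF pK pA f Q ls] stalk_zero[OF pK lW] CV by simp
qed

lemma stalk_map_zero:
  assumes X: "presheaf_of_rings X" and Y: "presheaf_of_rings Y" and f: "f \<in> presheaf_hom X Y"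
    and x: "x \<in> points X"
  shows "stalk_map X f x \<zero>\<^bsub>stalk Y (pmap f x)\<^esub> = \<zero>\<^bsub>stalk X x\<^esub>"
proof -
  have top: "openin (tp Y) (points Y)" by simp
  let ?R = "sec Y (points Y)" and ?S = "sec X (pre X f (points Y))"
  interpret R: cring ?R by (rule presheaf_cring[OF Y top])
  interpret S: cring ?S by (rule presheaf_cring[OF X presheaf_hom_pre[OF f top]])
  interpret ring_hom_cring ?R ?S "smap f (points Y)"
    by unfold_locales (rule presheaf_hom_ring_hom[OF f top])
  have l: "local_section Y (pmap f x) (points Y) \<zero>\<^bsub>?R\<^esub>"
    using presheaf_hom_point[OF f x] by (simp add: local_section_def)
  show ?thesis
    using stalk_map_germ[OF X Y f x l] stalk_zero[OF Y l] stalk_zero[OF X local_section_smap[OF f x l]]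
    by simp
qed

lemma locally_ringed_presheaf: "locally_ringed_space X \<Longrightarrow> presheaf_of_rings X"
  by (simp add: locally_ringed_space_def sheaf_of_rings_def)

text \<open>The stalk map of the composite sends a maximal ideal to zero, which belongs to every ideal.\<close>

lemma Spec_map_field_comp_lrs_hom:
  assumes A: "cring A" and K: "field K" and \<phi>: "\<phi> \<in> ring_hom A K"
    and Z: "locally_ringed_space Z" and f: "f \<in> lrs_hom Z (Spec K)"
  shows "mor_comp Z (Spec K) (Spec A) (Spec_map A K \<phi>) f \<in> lrs_hom Z (Spec A)"
proof -
  have cK: "cring K" using K by (simp add: field_def domain_def)
  note pA = presheaf_Spec[OF A] and pK = presheaf_Spec[OF cK]
  note e = Spec_map_presheaf_hom[OF A cK \<phi>]
  have pZ: "presheaf_of_rings Z" by (rule locally_ringed_presheaf[OF Z])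
  have f': "f \<in> presheaf_hom Z (Spec K)" using f by (simp add: lrs_hom_iff)
  let ?g = "mor_comp Z (Spec K) (Spec A) (Spec_map A K \<phi>) f"
  have g: "?g \<in> presheaf_hom Z (Spec A)" by (rule mor_comp_presheaf_hom[OF pA f' e])
  have "local_hom (stalk (Spec A) (pmap ?g z)) (stalk Z z) (stalk_map Z ?g z)" if z: "z \<in> points Z" for z
    unfolding local_hom_def
  proof (intro conjI allI impI image_subsetI)
    show "stalk_map Z ?g z \<in> ring_hom (stalk (Spec A) (pmap ?g z)) (stalk Z z)"
      by (rule stalk_map_ring_hom[OF pZ pA g z])
    fix M N C assume M: "maximalideal M (stalk (Spec A) (pmap ?g z))" and N: "maximalideal N (stalk Z z)"
      and C: "C \<in> M"
    note fz = presheaf_hom_point[OF f' z]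
    have M': "maximalideal M (stalk (Spec A) (pmap (Spec_map A K \<phi>) (pmap f z)))"
      using M by (simp add: mor_comp_simps(1)[OF z])
    have C': "C \<in> carrier (stalk (Spec A) (pmap (Spec_map A K \<phi>) (pmap f z)))"
      using C additive_subgroup.a_subset[OF ideal.axioms(1)[OF maximalideal.axioms(1)[OF M']]] by blast
    have "stalk_map Z ?g z C = \<zero>\<^bsub>stalk Z z\<^esub>"
      using stalk_map_comp[OF pZ pK pA f' e z C'] Spec_map_field_kills[OF A K \<phi> fz M' C]
        stalk_map_zero[OF pZ pK f' z] by simp
    then show "stalk_map Z ?g z C \<in> N"
      using additive_subgroup.zero_closed[OF ideal.axioms(1)[OF maximalideal.axioms(1)[OF N]]] by simp
  qed
  with g show ?thesis by (simp add: lrs_hom_iff)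
qed

section \<open>The truncated polynomial ring\<close>

lemma quotient_ring_hom:
  assumes "ring R" "ring S" and h: "h \<in> ring_hom R S" and I: "ideal I R" "\<And>i. i \<in> I \<Longrightarrow> h i = \<zero>\<^bsub>S\<^esub>"
  shows quotient_ring_hom_coset: "r \<in> carrier R \<Longrightarrow> the_elem (h ` (I +>\<^bsub>R\<^esub> r)) = h r"
    and quotient_ring_hom_hom: "(\<lambda>C. the_elem (h ` C)) \<in> ring_hom (R Quot I) S"
proof -
  interpret R: ring R by fact
  interpret S: ring S by fact
  interpret I: ideal I R by (rule I)
  interpret h: ring_hom_ring R S h by (rule ring_hom_ringI2[OF assms(1-3)])
  have coset: "the_elem (h ` (I +>\<^bsub>R\<^esub> r)) = h r" if r: "r \<in> carrier R" for r
  proof -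
    have "h x = h r" if "x \<in> I +>\<^bsub>R\<^esub> r" for x
    proof -
      from that obtain i where "i \<in> I" "x = i \<oplus>\<^bsub>R\<^esub> r" by (auto simp: a_r_coset_def r_coset_def)
      then show ?thesis using r I(2)[of i] I.Icarr[of i] by simp
    qed
    then have "h ` (I +>\<^bsub>R\<^esub> r) = {h r}" using I.a_rcos_self[OF r] by blast
    then show ?thesis by simp
  qed
  then show "r \<in> carrier R \<Longrightarrow> the_elem (h ` (I +>\<^bsub>R\<^esub> r)) = h r" .
  note q = ring_hom_memE[OF I.rcos_ring_hom]
  have rep: "\<exists>r\<in>carrier R. C = I +>\<^bsub>R\<^esub> r" if "C \<in> carrier (R Quot I)" for C
    using that by (auto simp: FactRing_def A_RCOSETS_def')
  show "(\<lambda>C. the_elem (h ` C)) \<in> ring_hom (R Quot I) S"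
  proof (rule ring_hom_memI)
    fix C assume "C \<in> carrier (R Quot I)"
    then obtain r where r: "r \<in> carrier R" "C = I +>\<^bsub>R\<^esub> r" using rep by blast
    then show "the_elem (h ` C) \<in> carrier S" by (simp add: coset)
    fix D assume "D \<in> carrier (R Quot I)"
    then obtain s where s: "s \<in> carrier R" "D = I +>\<^bsub>R\<^esub> s" using rep by blast
    show "the_elem (h ` (C \<otimes>\<^bsub>R Quot I\<^esub> D)) = the_elem (h ` C) \<otimes>\<^bsub>S\<^esub> the_elem (h ` D)"
      using r s q(2)[OF r(1) s(1)] coset[of "r \<otimes>\<^bsub>R\<^esub> s"] by (simp add: coset)
    show "the_elem (h ` (C \<oplus>\<^bsub>R Quot I\<^esub> D)) = the_elem (h ` C) \<oplus>\<^bsub>S\<^esub> the_elem (h ` D)"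
      using r s q(3)[OF r(1) s(1)] coset[of "r \<oplus>\<^bsub>R\<^esub> s"] by (simp add: coset)
  next
    show "the_elem (h ` \<one>\<^bsub>R Quot I\<^esub>) = \<one>\<^bsub>S\<^esub>" using q(4) coset[of "\<one>\<^bsub>R\<^esub>"] by simp
  qed
qed

text \<open>The ring map \<open>t \<mapsto> 0\<close>: evaluation at zero is constant on cosets, so its image of a coset has one
  element.\<close>

definition trunc_eval :: "'k ring \<Rightarrow> 'k list set \<Rightarrow> 'k" where
  "trunc_eval K C = the_elem ((\<lambda>p. ring.eval K p \<zero>\<^bsub>K\<^esub>) ` C)"

text \<open>The structure map of \<open>K[t]/(t\<^sup>m\<^sup>+\<^sup>1)\<close> has the evaluation at \<open>t = 0\<close> as left inverse; the exponent
  \<open>m + 1\<close> is positive, so the evaluation factors through the quotient.\<close>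

lemma trunc_ring_maps:
  assumes K: "field K"
  shows cring_trunc_ring: "cring (trunc_ring K m)"
    and trunc_const_hom: "trunc_const K m \<in> ring_hom K (trunc_ring K m)"
    and trunc_eval_hom: "trunc_eval K \<in> ring_hom (trunc_ring K m) K"
    and trunc_eval_const: "a \<in> carrier K \<Longrightarrow> trunc_eval K (trunc_const K m a) = a"
proof -
  interpret K: field K by fact
  let ?P = "poly_ring K" and ?I = "trunc_ideal K m" and ?h = "\<lambda>p. ring.eval K p \<zero>\<^bsub>K\<^esub>"
  note sub = K.carrier_is_subring
  interpret P: cring ?P by (rule K.univ_poly_is_cring[OF sub])
  have X: "var K \<in> carrier ?P" by (rule K.var_closed(1)[OF sub])
  have I: "ideal ?I ?P" by (rule P.cgenideal_ideal[OF P.nat_pow_closed[OF X]])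
  have h: "?h \<in> ring_hom ?P K" by (rule K.eval_is_hom[OF sub K.zero_closed])
  interpret h: ring_hom_cring ?P K ?h by unfold_locales (rule h)
  have I0: "?h i = \<zero>\<^bsub>K\<^esub>" if i: "i \<in> ?I" for i
  proof -
    from i obtain p where p: "p \<in> carrier ?P" "i = p \<otimes>\<^bsub>?P\<^esub> var K [^]\<^bsub>?P\<^esub> (m + 1)"
      by (auto simp: cgenideal_def)
    have "?h (var K [^]\<^bsub>?P\<^esub> (m + 1)) = \<zero>\<^bsub>K\<^esub>"
      using X by (simp add: K.eval_var)
    then show ?thesis using p X by simp
  qed
  show "cring (trunc_ring K m)"
    unfolding trunc_ring_def by (rule ideal.quotient_is_cring[OF I P.is_cring])
  have c: "ring.poly_of_const K \<in> ring_hom K ?P"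
    using K.canonical_embedding_is_hom[OF sub] by simp
  have "(+>\<^bsub>?P\<^esub>) ?I \<circ> ring.poly_of_const K \<in> ring_hom K (?P Quot ?I)"
    by (rule ring_hom_trans[OF c ideal.rcos_ring_hom[OF I]])
  then show "trunc_const K m \<in> ring_hom K (trunc_ring K m)"
    unfolding trunc_ring_def by (rule ring_hom_cong[OF K.is_cring]) (simp add: trunc_const_def)
  have Q: "the_elem (?h ` (?I +>\<^bsub>?P\<^esub> p)) = ?h p" if "p \<in> carrier ?P" for p
    by (rule quotient_ring_hom_coset[OF P.ring_axioms K.ring_axioms h I I0 that])
  have E: "(\<lambda>C. the_elem (?h ` C)) \<in> ring_hom (?P Quot ?I) K"
    by (rule quotient_ring_hom_hom[OF P.ring_axioms K.ring_axioms h I I0])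
  show "trunc_eval K \<in> ring_hom (trunc_ring K m) K"
    using E unfolding trunc_ring_def trunc_eval_def[abs_def] .
  show "trunc_eval K (trunc_const K m a) = a" if a: "a \<in> carrier K"
    using Q[OF ring_hom_memE(1)[OF c a]] a
    by (simp add: trunc_eval_def trunc_const_def K.poly_of_const_def)
qed

section \<open>Schemes over a field\<close>

lemma scheme_lrs: "scheme X \<Longrightarrow> locally_ringed_space X"
  by (simp add: scheme_def)

lemma scheme_presheaf: "scheme X \<Longrightarrow> presheaf_of_rings X"
  by (simp add: scheme_lrs locally_ringed_presheaf)

lemma lrs_hom_presheaf_hom: "f \<in> lrs_hom X Y \<Longrightarrow> f \<in> presheaf_hom X Y"
  by (simp add: lrs_hom_iff)

lemma scheme_overD:
  assumes "scheme_over K X"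
  shows "scheme (tot X)" "presheaf_of_rings (tot X)" "locally_ringed_space (tot X)"
    "str X \<in> lrs_hom (tot X) (Spec K)" "str X \<in> presheaf_hom (tot X) (Spec K)"
  using assms by (auto simp: scheme_over_def scheme_presheaf scheme_lrs lrs_hom_presheaf_hom)

lemma hom_overD:
  assumes "f \<in> hom_over K X Y"
  shows "f \<in> lrs_hom (tot X) (tot Y)" "f \<in> presheaf_hom (tot X) (tot Y)"
    "mor_comp (tot X) (tot Y) (Spec K) (str Y) f = str X"
  using assms by (auto simp: hom_over_def lrs_hom_presheaf_hom)

lemma comp_over_hom:
  assumes K: "cring K" and X: "scheme_over K X" and Y: "scheme_over K Y" and Z: "scheme_over K Z"
    and f: "f \<in> hom_over K X Y" and g: "g \<in> hom_over K Y Z"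
  shows "comp_over X Y Z g f \<in> hom_over K X Z"
proof -
  note D = scheme_overD and H = hom_overD
  have "mor_comp (tot X) (tot Y) (tot Z) g f \<in> lrs_hom (tot X) (tot Z)"
    by (rule mor_comp_lrs_hom[OF D(2)[OF X] D(3)[OF Y] D(2)[OF Z] H(1)[OF f] H(1)[OF g]])
  moreover have "mor_comp (tot X) (tot Z) (Spec K) (str Z) (mor_comp (tot X) (tot Y) (tot Z) g f) = str X"
    using mor_comp_assoc[OF D(2)[OF Z] presheaf_Spec[OF K] H(2)[OF f] H(2)[OF g] D(5)[OF Z]]
    by (simp add: H(3)[OF f] H(3)[OF g])
  ultimately show ?thesis by (simp add: hom_over_def comp_over_def)
qed

lemma comp_over_assoc:
  assumes "scheme_over K Z" "scheme_over K W"
    and f: "f \<in> hom_over K X Y" and g: "g \<in> hom_over K Y Z" and h: "h \<in> hom_over K Z W"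
  shows "comp_over X Z W h (comp_over X Y Z g f) = comp_over X Y W (comp_over Y Z W h g) f"
  unfolding comp_over_def
  by (rule mor_comp_assoc) (use assms scheme_overD hom_overD in auto)

lemma comp_over_id:
  assumes X: "scheme_over K X" and Y: "scheme_over K Y" and f: "f \<in> hom_over K X Y"
  shows comp_over_id_left: "comp_over X Y Y (mor_id (tot Y)) f = f"
    and comp_over_id_right: "comp_over X X Y f (mor_id (tot X)) = f"
  unfolding comp_over_def
  using mor_comp_id[OF scheme_overD(2)[OF X] scheme_overD(2)[OF Y] hom_overD(2)[OF f]] by auto

lemma mor_id_hom_over:
  assumes K: "cring K" and X: "scheme_over K X"
  shows "mor_id (tot X) \<in> hom_over K X X"
  unfolding hom_over_def
  using mor_id_lrs_hom[OF scheme_overD(3)[OF X]]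
    mor_comp_id_right[OF scheme_overD(2)[OF X] presheaf_Spec[OF K] scheme_overD(5)[OF X]] by simp

section \<open>Products with the jet disc\<close>

context
  fixes K :: "'k ring" and m :: nat
  assumes K: "field K"
begin

interpretation K: field K by (rule K)

text \<open>\<open>D\<close> is the jet disc \<open>Spec K[t]/(t\<^sup>m\<^sup>+\<^sup>1)\<close>, \<open>c\<close> its structure morphism to \<open>Spec K\<close> and \<open>e\<close> the inclusion of its
  closed point.\<close>

private abbreviation "D \<equiv> Spec (trunc_ring K m)"
private abbreviation "c \<equiv> Spec_map K (trunc_ring K m) (trunc_const K m)"
private abbreviation "e \<equiv> Spec_map (trunc_ring K m) K (trunc_eval K)"

private lemma cK: "cring K" by (rule K.is_cring)
private lemmas cD = cring_trunc_ring[OF K, of m]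
private lemmas pK = presheaf_Spec[OF cK]
private lemmas pD = presheaf_Spec[OF cD]
private lemmas hc = Spec_map_presheaf_hom[OF cK cD trunc_const_hom[OF K]]
private lemmas he = Spec_map_presheaf_hom[OF cD cK trunc_eval_hom[OF K]]

private lemma ce: "mor_comp (Spec K) D (Spec K) c e = mor_id (Spec K)"
  by (rule Spec_map_retract[OF cK cD trunc_const_hom[OF K] trunc_eval_hom[OF K] trunc_eval_const[OF K]])

text \<open>The constant morphism to the closed point of the jet disc, over \<open>K\<close>.\<close>

definition closed_point :: "('p, 'a, 'k) over_scheme \<Rightarrow> ('p, 'a, 'k list set) mor_to_Spec" where
  "closed_point Z = mor_comp (tot Z) (Spec K) D e (str Z)"

lemma closed_point_hom: "scheme_over K Z \<Longrightarrow> closed_point Z \<in> lrs_hom (tot Z) D"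
  unfolding closed_point_def
  by (rule Spec_map_field_comp_lrs_hom[OF cD K trunc_eval_hom[OF K]]) (auto dest: scheme_overD)

lemma closed_point_over:
  assumes Z: "scheme_over K Z"
  shows "mor_comp (tot Z) D (Spec K) c (closed_point Z) = str Z"
  unfolding closed_point_def
  using mor_comp_assoc[OF pD pK scheme_overD(5)[OF Z] he hc] ce
    mor_comp_id_left[OF scheme_overD(2)[OF Z] pK scheme_overD(5)[OF Z]] by simp

lemma closed_point_natural:
  assumes Z: "scheme_over K Z" and g: "g \<in> hom_over K Z' Z"
  shows "mor_comp (tot Z') (tot Z) D (closed_point Z) g = closed_point Z'"
  unfolding closed_point_def
  using mor_comp_assoc[OF pK pD hom_overD(2)[OF g] scheme_overD(5)[OF Z] he] hom_overD(3)[OF g] by simp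

lemma jet_productD:
  assumes Z: "scheme_over K Z" and C: "jet_product K m Z C"
  shows "scheme_over K (apex C)" "pr1 C \<in> hom_over K (apex C) Z"
    "pr2 C \<in> lrs_hom (tot (apex C)) D"
    "mor_comp (tot (apex C)) D (Spec K) c (pr2 C) = str (apex C)"
proof -
  have P: "scheme (tot (apex C))" "pr1 C \<in> lrs_hom (tot (apex C)) (tot Z)"
    "pr2 C \<in> lrs_hom (tot (apex C)) D"
    "mor_comp (tot (apex C)) (tot Z) (Spec K) (str Z) (pr1 C) = mor_comp (tot (apex C)) D (Spec K) c (pr2 C)"
    "str (apex C) = mor_comp (tot (apex C)) (tot Z) (Spec K) (str Z) (pr1 C)"
    using C by (simp_all add: jet_product_def fibre_product_def jet_disc_def)
  show "pr2 C \<in> lrs_hom (tot (apex C)) D" by (rule P)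
  show "mor_comp (tot (apex C)) D (Spec K) c (pr2 C) = str (apex C)" using P by simp
  show "pr1 C \<in> hom_over K (apex C) Z" using P by (simp add: hom_over_def)
  have "str (apex C) \<in> lrs_hom (tot (apex C)) (Spec K)"
    unfolding P(5)
    by (rule mor_comp_lrs_hom[OF scheme_presheaf[OF P(1)] _ pK P(2)]) (use scheme_overD[OF Z] in auto)
  then show "scheme_over K (apex C)" using P(1) by (simp add: scheme_over_def)
qed

text \<open>The universal property within schemes over \<open>K\<close>: a morphism to the product is over \<open>K\<close> as soon as its
  first component is.\<close>

lemma jet_product_ex1:
  fixes Z W :: "('p, 'a, 'k) over_scheme"
  assumes Z: "scheme_over K Z" and C: "jet_product K m Z C" and W: "scheme_over K W"
    and u: "u \<in> hom_over K W Z" and v: "v \<in> lrs_hom (tot W) D" "mor_comp (tot W) D (Spec K) c v = str W"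
  shows "\<exists>!w. w \<in> hom_over K W (apex C) \<and> comp_over W (apex C) Z (pr1 C) w = u \<and>
    mor_comp (tot W) (tot (apex C)) D (pr2 C) w = v"
proof -
  have univ: "\<forall>W :: ('p, 'a) ringed_space. \<forall>u v. scheme W \<longrightarrow> u \<in> lrs_hom W (tot Z) \<longrightarrow> v \<in> lrs_hom W D \<longrightarrow>
      mor_comp W (tot Z) (Spec K) (str Z) u = mor_comp W D (Spec K) c v \<longrightarrow>
      (\<exists>!w. w \<in> lrs_hom W (tot (apex C)) \<and> mor_comp W (tot (apex C)) (tot Z) (pr1 C) w = u \<and>
        mor_comp W (tot (apex C)) D (pr2 C) w = v)"
    using C by (simp add: jet_product_def fibre_product_def jet_disc_def)
  have "\<exists>!w. w \<in> lrs_hom (tot W) (tot (apex C)) \<and>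
      mor_comp (tot W) (tot (apex C)) (tot Z) (pr1 C) w = u \<and>
      mor_comp (tot W) (tot (apex C)) D (pr2 C) w = v"
    by (rule univ[rule_format]) (use scheme_overD(1)[OF W] hom_overD[OF u] v in auto)
  moreover have "w \<in> hom_over K W (apex C)"
    if w: "w \<in> lrs_hom (tot W) (tot (apex C))" "mor_comp (tot W) (tot (apex C)) (tot Z) (pr1 C) w = u" for w
  proof -
    note JP = jet_productD[OF Z C]
    have "mor_comp (tot W) (tot (apex C)) (Spec K)
        (mor_comp (tot (apex C)) (tot Z) (Spec K) (str Z) (pr1 C)) w = str W"
      using mor_comp_assoc[OF scheme_overD(2)[OF Z] pK lrs_hom_presheaf_hom[OF w(1)] hom_overD(2)[OF JP(2)]
          scheme_overD(5)[OF Z]] w(2) hom_overD(3)[OF u] by simp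
    then show ?thesis using w(1) hom_overD(3)[OF JP(2)] by (simp add: hom_over_def)
  qed
  ultimately show ?thesis
    unfolding comp_over_def by (metis hom_overD(1))
qed

lemma jet_product_unique:
  fixes Z W :: "('p, 'a, 'k) over_scheme"
  assumes Z: "scheme_over K Z" and C: "jet_product K m Z C" and W: "scheme_over K W"
    and w: "w \<in> hom_over K W (apex C)" and w': "w' \<in> hom_over K W (apex C)"
    and eq: "comp_over W (apex C) Z (pr1 C) w = comp_over W (apex C) Z (pr1 C) w'"
      "mor_comp (tot W) (tot (apex C)) D (pr2 C) w = mor_comp (tot W) (tot (apex C)) D (pr2 C) w'"
  shows "w = w'"
proof -
  note JP = jet_productD[OF Z C]
  have u: "comp_over W (apex C) Z (pr1 C) w \<in> hom_over K W Z"
    by (rule comp_over_hom[OF cK W JP(1) Z w JP(2)])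
  have v: "mor_comp (tot W) (tot (apex C)) D (pr2 C) w \<in> lrs_hom (tot W) D"
    by (rule mor_comp_lrs_hom[OF _ _ pD hom_overD(1)[OF w] JP(3)]) (use scheme_overD W JP(1) in auto)
  have v': "mor_comp (tot W) D (Spec K) c (mor_comp (tot W) (tot (apex C)) D (pr2 C) w) = str W"
    using mor_comp_assoc[OF pD pK hom_overD(2)[OF w] lrs_hom_presheaf_hom[OF JP(3)] hc] JP(4)
      hom_overD(3)[OF w] by simp
  show ?thesis using jet_product_ex1[OF Z C W u v v'] w w' eq by metis
qed

text \<open>The morphism \<open>g'\<close> is \<open>g \<times> id\<close>, characterized as in the naturality condition of a jet scheme.\<close>

lemma jet_product_map:
  fixes Z Z' :: "('p, 'a, 'k) over_scheme"
  assumes Z: "scheme_over K Z" and C: "jet_product K m Z C"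
    and Z': "scheme_over K Z'" and C': "jet_product K m Z' C'" and g: "g \<in> hom_over K Z' Z"
  obtains g' where "g' \<in> hom_over K (apex C') (apex C)"
    "comp_over (apex C') (apex C) Z (pr1 C) g' = comp_over (apex C') Z' Z g (pr1 C')"
    "mor_comp (tot (apex C')) (tot (apex C)) D (pr2 C) g' = pr2 C'"
proof -
  note JP = jet_productD[OF Z' C']
  have "comp_over (apex C') Z' Z g (pr1 C') \<in> hom_over K (apex C') Z"
    by (rule comp_over_hom[OF cK JP(1) Z' Z JP(2) g])
  from jet_product_ex1[OF Z C JP(1) this JP(3,4)] that show ?thesis by blast
qed

text \<open>The section of \<open>Z \<times> Spec K[t]/(t\<^sup>m\<^sup>+\<^sup>1) \<rightarrow> Z\<close> given by \<open>t = 0\<close>.\<close>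

definition zero_section :: "('p, 'a, 'k) over_scheme \<Rightarrow> ('p, 'a, 'k) cone \<Rightarrow> ('p, 'a, 'p, 'a) mor \<Rightarrow> bool" where
  "zero_section Z C w \<longleftrightarrow> w \<in> hom_over K Z (apex C) \<and>
    comp_over Z (apex C) Z (pr1 C) w = mor_id (tot Z) \<and>
    mor_comp (tot Z) (tot (apex C)) D (pr2 C) w = closed_point Z"

lemma zero_section_exists:
  assumes Z: "scheme_over K Z" and C: "jet_product K m Z C"
  obtains w where "zero_section Z C w"
  using jet_product_ex1[OF Z C Z mor_id_hom_over[OF cK Z] closed_point_hom[OF Z] closed_point_over[OF Z]] that
  unfolding zero_section_def by blast

text \<open>The two composites have the same components: \<open>g\<close>, and the closed point.\<close>

lemma zero_section_natural:
  fixes Z Z' :: "('p, 'a, 'k) over_scheme"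
  assumes Z: "scheme_over K Z" and C: "jet_product K m Z C"
    and Z': "scheme_over K Z'" and C': "jet_product K m Z' C'" and g: "g \<in> hom_over K Z' Z"
    and g': "g' \<in> hom_over K (apex C') (apex C)"
      "comp_over (apex C') (apex C) Z (pr1 C) g' = comp_over (apex C') Z' Z g (pr1 C')"
      "mor_comp (tot (apex C')) (tot (apex C)) D (pr2 C) g' = pr2 C'"
    and w: "zero_section Z C w" and w': "zero_section Z' C' w'"
  shows "comp_over Z' (apex C') (apex C) g' w' = comp_over Z' Z (apex C) w g"
proof (rule jet_product_unique[OF Z C Z'])
  note JP = jet_productD[OF Z C] and JP' = jet_productD[OF Z' C']
  note W = w[unfolded zero_section_def] and W' = w'[unfolded zero_section_def]
  have w1: "w \<in> hom_over K Z (apex C)" and w1': "w' \<in> hom_over K Z' (apex C')" using W W' by auto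
  show "comp_over Z' (apex C') (apex C) g' w' \<in> hom_over K Z' (apex C)"
    by (rule comp_over_hom[OF cK Z' JP'(1) JP(1) w1' g'(1)])
  show "comp_over Z' Z (apex C) w g \<in> hom_over K Z' (apex C)"
    by (rule comp_over_hom[OF cK Z' Z JP(1) g w1])
  have "comp_over Z' (apex C) Z (pr1 C) (comp_over Z' (apex C') (apex C) g' w') =
      comp_over Z' (apex C') Z (comp_over (apex C') Z' Z g (pr1 C')) w'"
    using comp_over_assoc[OF JP(1) Z w1' g'(1) JP(2)] g'(2) by simp
  also have "\<dots> = comp_over Z' Z' Z g (mor_id (tot Z'))"
    using comp_over_assoc[OF Z' Z w1' JP'(2) g] W' by simp
  also have "\<dots> = comp_over Z' Z Z (mor_id (tot Z)) g"
    using comp_over_id_left[OF Z' Z g] comp_over_id_right[OF Z' Z g] by simp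
  also have "\<dots> = comp_over Z' (apex C) Z (pr1 C) (comp_over Z' Z (apex C) w g)"
    using comp_over_assoc[OF JP(1) Z g w1 JP(2)] W by simp
  finally show "comp_over Z' (apex C) Z (pr1 C) (comp_over Z' (apex C') (apex C) g' w') =
      comp_over Z' (apex C) Z (pr1 C) (comp_over Z' Z (apex C) w g)" .
  have p2: "pr2 C \<in> presheaf_hom (tot (apex C)) D" using JP(3) by (rule lrs_hom_presheaf_hom)
  note assoc = mor_comp_assoc[OF scheme_overD(2)[OF JP(1)] pD _ _ p2]
  show "mor_comp (tot Z') (tot (apex C)) D (pr2 C) (comp_over Z' (apex C') (apex C) g' w') =
      mor_comp (tot Z') (tot (apex C)) D (pr2 C) (comp_over Z' Z (apex C) w g)"
    unfolding comp_over_def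
    using assoc[OF hom_overD(2)[OF w1'] hom_overD(2)[OF g'(1)]] assoc[OF hom_overD(2)[OF g] hom_overD(2)[OF w1]]
      g'(3) W W' closed_point_natural[OF Z g] by simp
qed

section \<open>Constant jets and the projection of the jet scheme\<close>

lemma jet_schemeD:
  assumes J: "jet_scheme K m X J \<Phi>"
  shows "scheme_over K J"
    and jet_scheme_product: "scheme_over K Z \<Longrightarrow> \<exists>C. jet_product K m Z C"
    and jet_scheme_bij: "scheme_over K Z \<Longrightarrow> jet_product K m Z C \<Longrightarrow>
        bij_betw (\<Phi> Z C) (hom_over K Z J) (hom_over K (apex C) X)"
    and jet_scheme_natural: "scheme_over K Z \<Longrightarrow> jet_product K m Z C \<Longrightarrow>
        scheme_over K Z' \<Longrightarrow> jet_product K m Z' C' \<Longrightarrow>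
        g \<in> hom_over K Z' Z \<Longrightarrow> g' \<in> hom_over K (apex C') (apex C) \<Longrightarrow>
        comp_over (apex C') (apex C) Z (pr1 C) g' = comp_over (apex C') Z' Z g (pr1 C') \<Longrightarrow>
        mor_comp (tot (apex C')) (tot (apex C)) D (pr2 C) g' = pr2 C' \<Longrightarrow>
        h \<in> hom_over K Z J \<Longrightarrow>
        \<Phi> Z' C' (comp_over Z' Z J h g) = comp_over (apex C') (apex C) X (\<Phi> Z C h) g'"
proof -
  note J' = J[unfolded jet_scheme_def]
  show "scheme_over K J" using J' by (simp add: finite_type_over_def)
  show "scheme_over K Z \<Longrightarrow> \<exists>C. jet_product K m Z C" using J' by simp
  show "scheme_over K Z \<Longrightarrow> jet_product K m Z C \<Longrightarrow>
        bij_betw (\<Phi> Z C) (hom_over K Z J) (hom_over K (apex C) X)" using J' by simp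
  show "scheme_over K Z \<Longrightarrow> jet_product K m Z C \<Longrightarrow>
        scheme_over K Z' \<Longrightarrow> jet_product K m Z' C' \<Longrightarrow>
        g \<in> hom_over K Z' Z \<Longrightarrow> g' \<in> hom_over K (apex C') (apex C) \<Longrightarrow>
        comp_over (apex C') (apex C) Z (pr1 C) g' = comp_over (apex C') Z' Z g (pr1 C') \<Longrightarrow>
        mor_comp (tot (apex C')) (tot (apex C)) D (pr2 C) g' = pr2 C' \<Longrightarrow>
        h \<in> hom_over K Z J \<Longrightarrow>
        \<Phi> Z' C' (comp_over Z' Z J h g) = comp_over (apex C') (apex C) X (\<Phi> Z C h) g'"
    by (rule conjunct2[OF conjunct2[OF conjunct2[OF J']], rule_format])
      (simp_all add: comp_over_def jet_disc_def)
qed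

lemma jet_scheme_closed:
  assumes J: "jet_scheme K m X J \<Phi>" and Z: "scheme_over K Z" "jet_product K m Z C" and h: "h \<in> hom_over K Z J"
  shows "\<Phi> Z C h \<in> hom_over K (apex C) X"
  using bij_betw_apply[OF jet_scheme_bij[OF J Z] h] .

text \<open>By the Yoneda lemma \<open>\<pi>\<close> is determined by what it does to the points \<open>h\<close> of the jet scheme with values
  in an arbitrary \<open>Z\<close>: it restricts the corresponding family of jets to \<open>t = 0\<close>.\<close>

definition jet_projection ::
  "('p, 'a, 'k) over_scheme \<Rightarrow> ('p, 'a, 'k) over_scheme \<Rightarrow>
   (('p, 'a, 'k) over_scheme \<Rightarrow> ('p, 'a, 'k) cone \<Rightarrow> ('p, 'a, 'p, 'a) mor \<Rightarrow> ('p, 'a, 'p, 'a) mor) \<Rightarrow>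
   ('p, 'a, 'p, 'a) mor \<Rightarrow> bool" where
  "jet_projection X J \<Phi> \<pi> \<longleftrightarrow> \<pi> \<in> hom_over K J X \<and>
     (\<forall>Z C h w. scheme_over K Z \<longrightarrow> jet_product K m Z C \<longrightarrow> h \<in> hom_over K Z J \<longrightarrow> zero_section Z C w \<longrightarrow>
        comp_over Z (apex C) X (\<Phi> Z C h) w = comp_over Z J X \<pi> h)"

text \<open>The projection is the value at \<open>t = 0\<close> of the universal jet, which corresponds to the identity of \<open>J\<close>.
  Every other jet is the pull-back of the universal one, and restriction to \<open>t = 0\<close> commutes with
  pull-back by \<open>zero_section_natural\<close>.\<close>

lemma jet_projection_exists:
  assumes X: "scheme_over K X" and J: "jet_scheme K m X J \<Phi>"
  obtains \<pi> where "jet_projection X J \<Phi> \<pi>"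
proof -
  note J' = jet_schemeD(1)[OF J]
  obtain B where B: "jet_product K m J B" using jet_scheme_product[OF J J'] by blast
  obtain z where z: "zero_section J B z" by (rule zero_section_exists[OF J' B])
  have z1: "z \<in> hom_over K J (apex B)" using z by (simp add: zero_section_def)
  note B' = jet_productD(1)[OF J' B]
  note i = mor_id_hom_over[OF cK J']
  let ?u = "\<Phi> J B (mor_id (tot J))"
  have u: "?u \<in> hom_over K (apex B) X" by (rule jet_scheme_closed[OF J J' B i])
  let ?\<pi> = "comp_over J (apex B) X ?u z"
  have \<pi>: "?\<pi> \<in> hom_over K J X" by (rule comp_over_hom[OF cK J' B' X z1 u])
  have "comp_over Z (apex C) X (\<Phi> Z C h) w = comp_over Z J X ?\<pi> h"
    if Z: "scheme_over K Z" and C: "jet_product K m Z C" and h: "h \<in> hom_over K Z J" and w: "zero_section Z C w"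
    for Z C h w
  proof -
    obtain h' where h': "h' \<in> hom_over K (apex C) (apex B)"
      "comp_over (apex C) (apex B) J (pr1 B) h' = comp_over (apex C) Z J h (pr1 C)"
      "mor_comp (tot (apex C)) (tot (apex B)) D (pr2 B) h' = pr2 C"
      by (rule jet_product_map[OF J' B Z C h])
    have w1: "w \<in> hom_over K Z (apex C)" using w by (simp add: zero_section_def)
    have "\<Phi> Z C h = comp_over (apex C) (apex B) X ?u h'"
      using jet_scheme_natural[OF J J' B Z C h h' i] comp_over_id_left[OF Z J' h] by simp
    then have "comp_over Z (apex C) X (\<Phi> Z C h) w =
        comp_over Z (apex B) X ?u (comp_over Z (apex C) (apex B) h' w)"
      using comp_over_assoc[OF B' X w1 h'(1) u] by simp
    also have "\<dots> = comp_over Z (apex B) X ?u (comp_over Z J (apex B) z h)"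
      using zero_section_natural[OF J' B Z C h h' z w] by simp
    also have "\<dots> = comp_over Z J X ?\<pi> h" by (rule comp_over_assoc[OF B' X h z1 u])
    finally show ?thesis .
  qed
  then show ?thesis using that[of ?\<pi>] \<pi> unfolding jet_projection_def by blast
qed

text \<open>The morphism \<open>s\<close> corresponds to the first projection of \<open>X \<times> Spec K[t]/(t\<^sup>m\<^sup>+\<^sup>1)\<close>, that is, to the family of
  jets that do not depend on \<open>t\<close>.\<close>

definition constant_jets ::
  "('p, 'a, 'k) over_scheme \<Rightarrow> ('p, 'a, 'k) over_scheme \<Rightarrow>
   (('p, 'a, 'k) over_scheme \<Rightarrow> ('p, 'a, 'k) cone \<Rightarrow> ('p, 'a, 'p, 'a) mor \<Rightarrow> ('p, 'a, 'p, 'a) mor) \<Rightarrow>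
   ('p, 'a, 'k) cone \<Rightarrow> ('p, 'a, 'p, 'a) mor \<Rightarrow> bool" where
  "constant_jets X J \<Phi> C s \<longleftrightarrow> jet_product K m X C \<and> s \<in> hom_over K X J \<and> \<Phi> X C s = pr1 C"

lemma constant_jets_exist:
  assumes X: "scheme_over K X" and J: "jet_scheme K m X J \<Phi>"
  obtains C s where "constant_jets X J \<Phi> C s"
proof -
  obtain C where C: "jet_product K m X C" using jet_scheme_product[OF J X] by blast
  have "pr1 C \<in> \<Phi> X C ` hom_over K X J"
    using jet_scheme_bij[OF J X C] jet_productD(2)[OF X C] by (simp add: bij_betw_def)
  then show ?thesis using that C unfolding constant_jets_def by force
qed

text \<open>The value at \<open>t = 0\<close> of the family of constant jets is the first projection composed with the zero
  section, hence the identity.\<close>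

lemma projection_constant_jets:
  assumes X: "scheme_over K X" and \<pi>: "jet_projection X J \<Phi> \<pi>" and s: "constant_jets X J \<Phi> C s"
  shows "comp_over X J X \<pi> s = mor_id (tot X)"
proof -
  have C: "jet_product K m X C" and s': "s \<in> hom_over K X J" and eq: "\<Phi> X C s = pr1 C"
    using s by (auto simp: constant_jets_def)
  obtain w where w: "zero_section X C w" by (rule zero_section_exists[OF X C])
  have "comp_over X (apex C) X (\<Phi> X C s) w = comp_over X J X \<pi> s"
    using \<pi> X C s' w unfolding jet_projection_def by blast
  then show ?thesis using w by (simp add: eq zero_section_def)
qed

context
  fixes X Y J I :: "('p, 'a, 'k) over_scheme" and \<Phi> \<Psi> f f\<^sub>m
  assumes X: "scheme_over K X" and Y: "scheme_over K Y"
    and f: "f \<in> hom_over K X Y"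
    and J: "jet_scheme K m X J \<Phi>" and I: "jet_scheme K m Y I \<Psi>"
    and f\<^sub>m: "induced_jet_mor K m X Y f J \<Phi> I \<Psi> f\<^sub>m"
begin

lemma induced_jet_morD:
  shows "f\<^sub>m \<in> hom_over K J I"
    and "scheme_over K Z \<Longrightarrow> jet_product K m Z C \<Longrightarrow> h \<in> hom_over K Z J \<Longrightarrow>
      \<Psi> Z C (comp_over Z J I f\<^sub>m h) = comp_over (apex C) X Y f (\<Phi> Z C h)"
  using f\<^sub>m by (auto simp: induced_jet_mor_def)

text \<open>Both sides are the value at \<open>t = 0\<close> of the image under \<open>f\<close> of the universal jet of \<open>X\<close>.\<close>

lemma jet_projection_natural:
  assumes \<pi>: "jet_projection X J \<Phi> \<pi>" and \<rho>: "jet_projection Y I \<Psi> \<rho>"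
  shows "comp_over J X Y f \<pi> = comp_over J I Y \<rho> f\<^sub>m"
proof -
  note J' = jet_schemeD(1)[OF J] and I' = jet_schemeD(1)[OF I] and F = induced_jet_morD
  obtain B where B: "jet_product K m J B" using jet_scheme_product[OF J J'] by blast
  obtain z where z: "zero_section J B z" by (rule zero_section_exists[OF J' B])
  have z1: "z \<in> hom_over K J (apex B)" using z by (simp add: zero_section_def)
  note i = mor_id_hom_over[OF cK J']
  let ?u = "\<Phi> J B (mor_id (tot J))"
  have u: "?u \<in> hom_over K (apex B) X" by (rule jet_scheme_closed[OF J J' B i])
  have \<pi>': "\<pi> \<in> hom_over K J X" using \<pi> by (simp add: jet_projection_def)
  have "comp_over J I Y \<rho> f\<^sub>m = comp_over J (apex B) Y (\<Psi> J B f\<^sub>m) z"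
    using \<rho> J' B F(1) z unfolding jet_projection_def by simp
  also have "\<Psi> J B f\<^sub>m = comp_over (apex B) X Y f ?u"
    using F(2)[OF J' B i] comp_over_id_right[OF J' I' F(1)] by simp
  also have "comp_over J (apex B) Y (comp_over (apex B) X Y f ?u) z =
      comp_over J X Y f (comp_over J (apex B) X ?u z)"
    by (rule comp_over_assoc[OF X Y z1 u f, symmetric])
  also have "comp_over J (apex B) X ?u z = comp_over J J X \<pi> (mor_id (tot J))"
    using \<pi> J' B i z unfolding jet_projection_def by simp
  also have "\<dots> = \<pi>" by (rule comp_over_id_right[OF J' X \<pi>'])
  finally show ?thesis by simp
qed

text \<open>Both sides correspond to \<open>f\<close> composed with the first projection of \<open>X \<times> Spec K[t]/(t\<^sup>m\<^sup>+\<^sup>1)\<close>.\<close>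

lemma constant_jets_natural:
  assumes s: "constant_jets X J \<Phi> C s" and r: "constant_jets Y I \<Psi> B r"
  shows "comp_over X J I f\<^sub>m s = comp_over X Y I r f"
proof -
  note J' = jet_schemeD(1)[OF J] and I' = jet_schemeD(1)[OF I] and F = induced_jet_morD
  have C: "jet_product K m X C" and s': "s \<in> hom_over K X J" and seq: "\<Phi> X C s = pr1 C"
    using s by (auto simp: constant_jets_def)
  have B: "jet_product K m Y B" and r': "r \<in> hom_over K Y I" and req: "\<Psi> Y B r = pr1 B"
    using r by (auto simp: constant_jets_def)
  obtain f' where f': "f' \<in> hom_over K (apex C) (apex B)"
      "comp_over (apex C) (apex B) Y (pr1 B) f' = comp_over (apex C) X Y f (pr1 C)"
      "mor_comp (tot (apex C)) (tot (apex B)) D (pr2 B) f' = pr2 C"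
    by (rule jet_product_map[OF Y B X C f])
  have "\<Psi> X C (comp_over X J I f\<^sub>m s) = comp_over (apex C) X Y f (pr1 C)"
    using F(2)[OF X C s'] by (simp add: seq)
  also have "\<dots> = \<Psi> X C (comp_over X Y I r f)"
    using jet_scheme_natural[OF I Y B X C f f' r'] f'(2) by (simp add: req)
  finally have "\<Psi> X C (comp_over X J I f\<^sub>m s) = \<Psi> X C (comp_over X Y I r f)" .
  moreover have "comp_over X J I f\<^sub>m s \<in> hom_over K X I" by (rule comp_over_hom[OF cK X J' I' s' F(1)])
  moreover have "comp_over X Y I r f \<in> hom_over K X I" by (rule comp_over_hom[OF cK X Y I' f r'])
  ultimately show ?thesis
    using bij_betw_imp_inj_on[OF jet_scheme_bij[OF I X C]] by (simp add: inj_on_eq_iff)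
qed

end

end

section \<open>Flatness of retracts\<close>

text \<open>On points, \<open>x\<close> is sent to \<open>i x\<close> and back by \<open>r\<close>, so the stalk maps of \<open>r\<close> and \<open>q\<close> go from the stalks at
  \<open>x\<close> and \<open>f x\<close> to those at \<open>i x\<close> and \<open>f' (i x)\<close>, and those of \<open>i\<close> and \<open>j\<close> go back and are left inverse to them.\<close>

lemma flat_mor_retract:
  fixes Y Y' :: "('q, 'b) ringed_space"
  assumes lrs: "locally_ringed_space X" "locally_ringed_space Y" "locally_ringed_space X'" "locally_ringed_space Y'"
    and f: "f \<in> presheaf_hom X Y" and f': "f' \<in> presheaf_hom X' Y'"
    and i: "i \<in> presheaf_hom X X'" and r: "r \<in> presheaf_hom X' X"
    and j: "j \<in> presheaf_hom Y Y'" and q: "q \<in> presheaf_hom Y' Y"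
    and ri: "mor_comp X X' X r i = mor_id X" and qj: "mor_comp Y Y' Y q j = mor_id Y"
    and i_nat: "mor_comp X X' Y' f' i = mor_comp X Y Y' j f"
    and r_nat: "mor_comp X' X Y f r = mor_comp X' Y' Y q f'"
    and flat: "flat_mor X' Y' f'"
  shows "flat_mor X Y f"
  unfolding flat_mor_def
proof
  fix x assume x: "x \<in> points X"
  note p = lrs[THEN locally_ringed_presheaf]
  define x' where "x' = pmap i x"
  define y where "y = pmap f x"
  define y' where "y' = pmap f' x'"
  have x': "x' \<in> points X'" unfolding x'_def by (rule presheaf_hom_point[OF i x])
  have y: "y \<in> points Y" unfolding y_def by (rule presheaf_hom_point[OF f x])
  have y': "y' \<in> points Y'" unfolding y'_def by (rule presheaf_hom_point[OF f' x'])
  have rx: "pmap r x' = x"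
    using arg_cong[OF ri, of "\<lambda>h. pmap h x"] x by (simp add: mor_comp_simps x'_def) (simp add: mor_id_def)
  have jy: "pmap j y = y'"
    using arg_cong[OF i_nat, of "\<lambda>h. pmap h x"] x by (simp add: mor_comp_simps x'_def y'_def y_def)
  have qy: "pmap q y' = y"
    using arg_cong[OF qj, of "\<lambda>h. pmap h y"] y by (simp add: mor_comp_simps jy) (simp add: mor_id_def)
  have "flat_ring_hom (stalk Y y) (stalk X x) (stalk_map X f x)"
  proof (rule flat_ring_hom_retract[where A' = "stalk Y' y'" and B' = "stalk X' x'"
        and \<phi>' = "stalk_map X' f' x'" and p = "stalk_map Y' q y'" and q = "stalk_map X' r x'"
        and s = "stalk_map Y j y" and t = "stalk_map X i x"])
    show "cring (stalk Y y)" "cring (stalk X x)" "cring (stalk Y' y')" "cring (stalk X' x')"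
      using lrs x y x' y' by (auto simp: locally_ringed_space_def local_ring_def)
    show "stalk_map X f x \<in> ring_hom (stalk Y y) (stalk X x)"
      unfolding y_def by (rule stalk_map_ring_hom[OF p(1,2) f x])
    show "stalk_map X' f' x' \<in> ring_hom (stalk Y' y') (stalk X' x')"
      unfolding y'_def by (rule stalk_map_ring_hom[OF p(3,4) f' x'])
    show "stalk_map Y' q y' \<in> ring_hom (stalk Y y) (stalk Y' y')"
      using stalk_map_ring_hom[OF p(4,2) q y'] by (simp add: qy)
    show "stalk_map X' r x' \<in> ring_hom (stalk X x) (stalk X' x')"
      using stalk_map_ring_hom[OF p(3,1) r x'] by (simp add: rx)
    show "stalk_map Y j y \<in> ring_hom (stalk Y' y') (stalk Y y)"
      using stalk_map_ring_hom[OF p(2,4) j y] by (simp add: jy)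
    show "stalk_map X i x \<in> ring_hom (stalk X' x') (stalk X x)"
      unfolding x'_def by (rule stalk_map_ring_hom[OF p(1,3) i x])
    show "stalk_map Y j y (stalk_map Y' q y' a) = a" if a: "a \<in> carrier (stalk Y y)" for a
      using stalk_map_comp[OF p(2,4,2) j q y, of a] stalk_map_id[OF p(2) y a] a by (simp add: jy qy qj)
    show "stalk_map X i x (stalk_map X' r x' b) = b" if b: "b \<in> carrier (stalk X x)" for b
      using stalk_map_comp[OF p(1,3,1) i r x, of b] stalk_map_id[OF p(1) x b] b
      by (simp add: rx ri flip: x'_def)
    show "stalk_map X' r x' (stalk_map X f x a) = stalk_map X' f' x' (stalk_map Y' q y' a)"
      if a: "a \<in> carrier (stalk Y y)" for a
      using stalk_map_comp[OF p(3,1,2) r f x', of a] stalk_map_comp[OF p(3,4,2) f' q x', of a] a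
      by (simp add: rx r_nat qy flip: y_def y'_def)
    show "stalk_map X i x (stalk_map X' f' x' a) = stalk_map X f x (stalk_map Y j y a)"
      if a: "a \<in> carrier (stalk Y' y')" for a
      using stalk_map_comp[OF p(1,3,4) i f' x, of a] stalk_map_comp[OF p(1,2,4) f j x, of a] a
      by (simp add: i_nat jy flip: x'_def y_def y'_def)
    show "flat_ring_hom (stalk Y' y') (stalk X' x') (stalk_map X' f' x')"
      using flat x' unfolding flat_mor_def y'_def by blast
  qed
  then show "flat_ring_hom (stalk Y (pmap f x)) (stalk X x) (stalk_map X f x)" unfolding y_def .
qed

theorem theorem4p1:
  fixes K :: "'k ring"
    and X Y X\<^sub>m Y\<^sub>m :: "('p, 'a, 'k) over_scheme"
    and f f\<^sub>m :: "('p, 'a, 'p, 'a) mor"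
    and m :: nat
  assumes "algebraically_closed K"
    and "finite_type_over K X" and "finite_type_over K Y"
    and "f \<in> hom_over K X Y"
    and "m \<ge> 1"
    and "jet_scheme K m X X\<^sub>m \<Phi>" and "jet_scheme K m Y Y\<^sub>m \<Psi>"
    and "induced_jet_mor K m X Y f X\<^sub>m \<Phi> Y\<^sub>m \<Psi> f\<^sub>m"
    and "flat_mor (tot X\<^sub>m) (tot Y\<^sub>m) f\<^sub>m"
  shows "flat_mor (tot X) (tot Y) f"
proof -
  have K: "field K" using assms(1) by (rule algebraically_closed.axioms(1))
  have X: "scheme_over K X" and Y: "scheme_over K Y"
    using assms(2,3) by (auto simp: finite_type_over_def)
  note Xm = assms(6) and Ym = assms(7) and fm = assms(8)
  note Xm' = jet_schemeD(1)[OF K Xm] and Ym' = jet_schemeD(1)[OF K Ym]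
  obtain \<pi> where \<pi>: "jet_projection K m X X\<^sub>m \<Phi> \<pi>" by (rule jet_projection_exists[OF K X Xm])
  obtain \<rho> where \<rho>: "jet_projection K m Y Y\<^sub>m \<Psi> \<rho>" by (rule jet_projection_exists[OF K Y Ym])
  obtain C s where s: "constant_jets K m X X\<^sub>m \<Phi> C s" by (rule constant_jets_exist[OF K X Xm])
  obtain B r where r: "constant_jets K m Y Y\<^sub>m \<Psi> B r" by (rule constant_jets_exist[OF K Y Ym])
  show ?thesis
  proof (rule flat_mor_retract[where X' = "tot X\<^sub>m" and Y' = "tot Y\<^sub>m" and f' = f\<^sub>m
        and i = s and r = \<pi> and j = r and q = \<rho>])
    show "mor_comp (tot X) (tot X\<^sub>m) (tot X) \<pi> s = mor_id (tot X)"
      using projection_constant_jets[OF K X \<pi> s] by (simp add: comp_over_def)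
    show "mor_comp (tot Y) (tot Y\<^sub>m) (tot Y) \<rho> r = mor_id (tot Y)"
      using projection_constant_jets[OF K Y \<rho> r] by (simp add: comp_over_def)
    show "mor_comp (tot X) (tot X\<^sub>m) (tot Y\<^sub>m) f\<^sub>m s = mor_comp (tot X) (tot Y) (tot Y\<^sub>m) r f"
      using constant_jets_natural[OF K X Y assms(4) Xm Ym fm s r] by (simp add: comp_over_def)
    show "mor_comp (tot X\<^sub>m) (tot X) (tot Y) f \<pi> = mor_comp (tot X\<^sub>m) (tot Y\<^sub>m) (tot Y) \<rho> f\<^sub>m"
      using jet_projection_natural[OF K X Y assms(4) Xm Ym fm \<pi> \<rho>] by (simp add: comp_over_def)
    show "f\<^sub>m \<in> presheaf_hom (tot X\<^sub>m) (tot Y\<^sub>m)"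
      using fm by (auto simp: induced_jet_mor_def dest: hom_overD)
    show "s \<in> presheaf_hom (tot X) (tot X\<^sub>m)" "r \<in> presheaf_hom (tot Y) (tot Y\<^sub>m)"
      using s r by (auto simp: constant_jets_def[OF K] dest: hom_overD)
    show "\<pi> \<in> presheaf_hom (tot X\<^sub>m) (tot X)" "\<rho> \<in> presheaf_hom (tot Y\<^sub>m) (tot Y)"
      using \<pi> \<rho> by (auto simp: jet_projection_def[OF K] dest: hom_overD)
  qed (use assms(4,9) X Y Xm' Ym' in \<open>auto dest: hom_overD scheme_overD\<close>)
qed

end
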